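(* Let $\mathbb{K}$ be a field, let $V$ be an $\ell$-dimensional vector space over $\mathbb{K}$ with $\ell\ge 1$, and let $\mathcal{A}$ be a central arrangement of hyperplanes in $V$. Then the following four conditions are equivalent: (1) $\mathcal{A}$ is totally free, i.e., $\mathcal{NFM}(\mathcal{A})$ is empty; (2) $\mathcal{NFM}(\mathcal{A})$ is a finite set; (3) $\mathcal{A}$ has a decomposition $$\mathcal{A}=\mathcal{A}_1\times\mathcal{A}_2\times\cdots\times\mathcal{A}_s,$$ where each $\mathcal{A}_i$ is a central arrangement in $\mathbb{K}^1$ or $\mathbb{K}^2$; (4) every subarrangement of $\mathcal{A}$ is free.
   Context: A central arrangement in a finite-dimensional $\mathbb{K}$-vector space $V$ is a finite (possibly empty) collection of linear hyperplanes of $V$; a subarrangement of $\mathcal{A}$ is a subset of $\mathcal{A}$, viewed as an arrangement in $V$. Let $S=\mathrm{Sym}(V^* )\simeq\mathbb{K}[x_1,\ldots,x_\ell]$ for a basis $x_1,\ldots,x_\ell$ of $V^*$, and let $\mathrm{Der}_{\mathbb{K}}(S)=\bigoplus_{i=1}^{\ell}S\,\partial_{x_i}$ be the $S$-module of $\mathbb{K}$-linear derivations of $S$ to itself. For each $H\in\mathcal{A}$ fix $\alpha_H\in V^*$ with $\ker(\alpha_H)=H$. A multiplicity on $\mathcal{A}$ is a function $m:\mathcal{A}\to\mathbb{Z}_{>0}$; the pair $(\mathcal{A},m)$ is called a multiarrangement. Its logarithmic derivation module is $$D(\mathcal{A},m)=\{\theta\in\mathrm{Der}_{\mathbb{K}}(S)\mid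 \theta(\alpha_H)\in S\cdot\alpha_H^{m(H)}\text{ for all }H\in\mathcal{A}\}.$$ The multiarrangement $(\mathcal{A},m)$ is free (and $m$ is a free multiplicity on $\mathcal{A}$) if $D(\mathcal{A},m)$ is a free $S$-module. An arrangement $\mathcal{A}$ is free if $(\mathcal{A},m)$ is free for the constant multiplicity $m\equiv 1$. Put $$\mathcal{NFM}(\mathcal{A})=\{m:\mathcal{A}\to\mathbb{Z}_{>0}\mid m\text{ is not a free multiplicity}\}.$$ The arrangement $\mathcal{A}$ is totally free if every multiplicity $m:\mathcal{A}\to\mathbb{Z}_{>0}$ is free, i.e. $\mathcal{NFM}(\mathcal{A})=\emptyset$. For arrangements $\mathcal{A}_i$ in $V_i$ ($i=1,2$), the product $\mathcal{A}_1\times\mathcal{A}_2$ is the arrangement in $V_1\oplus V_2$ given by $$\mathcal{A}_1\times\mathcal{A}_2=\{H_1\oplus V_2\mid H_1\in\mathcal{A}_1\}\cup\{V_1\oplus H_2\mid H_2\in\mathcal{A}_2\},$$ and products of more factors are defined by iteration. A decomposition of $\mathcal{A}$ as a product means a direct sum decomposition $V=V_1\oplus\cdots\oplus V_s$ and arrangements $\mathcal{A}_i$ in $V_i$ such that $\mathcal{A}$ is the product of the $\mathcal{A}_i$; "$\mathcal{A}_i$ is in $\mathbb{K}^d$" means that $\dim V_i=d$. The factors $\mathcal{A}_i$ may be empty. *)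

theory Defs
  imports Complex_Main "HOL-Library.FuncSet" "HOL-Library.Function_Algebras" "HOL-Library.Poly_Mapping"
begin

section \<open>Arrangements\<close>

text \<open>The ambient space \<open>V\<close> is the type \<open>'v\<close> with scalar multiplication \<open>scale\<close>. The predicates
  below are relative to a subspace \<open>W\<close>, so that they also apply to the factors of a product.\<close>

definition hyperplane_in ::
    "('k::field \<Rightarrow> 'v::ab_group_add \<Rightarrow> 'v) \<Rightarrow> 'v set \<Rightarrow> 'v set \<Rightarrow> bool" where
  "hyperplane_in scale W H \<longleftrightarrow>
     module.subspace scale H \<and> H \<subseteq> W \<and>
     vector_space.dim scale W = vector_space.dim scale H + 1"

definition central_arrangement ::
    "('k::field \<Rightarrow> 'v::ab_group_add \<Rightarrow> 'v) \<Rightarrow> 'v set \<Rightarrow> 'v set set \<Rightarrow> bool" where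
  "central_arrangement scale W \<A> \<longleftrightarrow> finite \<A> \<and> (\<forall>H\<in>\<A>. hyperplane_in scale W H)"

definition defining_forms ::
    "('k::field \<Rightarrow> 'v::ab_group_add \<Rightarrow> 'v) \<Rightarrow> 'v set set \<Rightarrow> ('v set \<Rightarrow> 'v \<Rightarrow> 'k) \<Rightarrow> bool" where
  "defining_forms scale \<A> \<alpha> \<longleftrightarrow>
     (\<forall>H\<in>\<A>. Vector_Spaces.linear scale (*) (\<alpha> H) \<and> {v. \<alpha> H v = 0} = H)"

section \<open>Logarithmic derivations and freeness\<close>

text \<open>\<open>S = Sym(V\<^sup>*)\<close> is the polynomial ring in the coordinates \<open>x\<^sub>i\<close> dual to a basis
  \<open>b\<^sub>i\<close> (\<open>i\<close> ranging over the finite type \<open>'n\<close>) of \<open>V\<close>; monomials are exponent vectors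
  of type \<open>'n \<Rightarrow>\<^sub>0 nat\<close>.\<close>

type_synonym ('n, 'k) polys = "('n \<Rightarrow>\<^sub>0 nat) \<Rightarrow>\<^sub>0 'k"

definition const_poly :: "'k::field \<Rightarrow> ('n, 'k) polys" where
  "const_poly c = Poly_Mapping.single 0 c"

definition var_poly :: "'n \<Rightarrow> ('n, 'k::field) polys" where
  "var_poly i = Poly_Mapping.single (Poly_Mapping.single i 1) 1"

text \<open>The inclusion \<open>V\<^sup>* \<subseteq> S\<close>: in the basis dual to \<open>b\<close>, the form \<open>a\<close> has coordinates
  \<open>a (b i)\<close>.\<close>

definition form_poly :: "('n::finite \<Rightarrow> 'v) \<Rightarrow> ('v \<Rightarrow> 'k) \<Rightarrow> ('n, 'k::field) polys" where
  "form_poly b a = (\<Sum>i\<in>UNIV. const_poly (a (b i)) * var_poly i)"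

definition Derivations :: "(('n, 'k::field) polys \<Rightarrow> ('n, 'k) polys) set" where
  "Derivations =
     {\<theta>. (\<forall>f g. \<theta> (f + g) = \<theta> f + \<theta> g) \<and>
          (\<forall>c f. \<theta> (const_poly c * f) = const_poly c * \<theta> f) \<and>
          (\<forall>f g. \<theta> (f * g) = \<theta> f * g + f * \<theta> g)}"

definition log_derivations ::
    "('n::finite \<Rightarrow> 'v) \<Rightarrow> ('v set \<Rightarrow> 'v \<Rightarrow> 'k) \<Rightarrow> 'v set set \<Rightarrow> ('v set \<Rightarrow> nat)
      \<Rightarrow> (('n, 'k::field) polys \<Rightarrow> ('n, 'k) polys) set" where
  "log_derivations b \<alpha> \<A> m =
     {\<theta> \<in> Derivations. \<forall>H\<in>\<A>. form_poly b (\<alpha> H) ^ m H dvd \<theta> (form_poly b (\<alpha> H))}"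

text \<open>The \<open>S\<close>-module structure on maps \<open>S \<rightarrow> S\<close>; addition is the pointwise one of
  \<^theory>\<open>HOL-Library.Function_Algebras\<close>.\<close>

definition der_scale ::
    "('n, 'k::field) polys \<Rightarrow> (('n, 'k) polys \<Rightarrow> ('n, 'k) polys)
      \<Rightarrow> (('n, 'k) polys \<Rightarrow> ('n, 'k) polys)" where
  "der_scale f \<theta> = (\<lambda>g. f * \<theta> g)"

lemma module_der_scale: "module der_scale"
  by unfold_locales (auto simp: der_scale_def fun_eq_iff algebra_simps)

definition free_submodule :: "(('n, 'k::field) polys \<Rightarrow> ('n, 'k) polys) set \<Rightarrow> bool" where
  "free_submodule D \<longleftrightarrow>
     (\<exists>B. \<not> module.dependent der_scale B \<and> module.span der_scale B = D)"

definition free_multiarrangement ::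
    "('n::finite \<Rightarrow> 'v) \<Rightarrow> ('v set \<Rightarrow> 'v \<Rightarrow> 'k::field) \<Rightarrow> 'v set set \<Rightarrow> ('v set \<Rightarrow> nat) \<Rightarrow> bool"
  where
  "free_multiarrangement b \<alpha> \<A> m \<longleftrightarrow> free_submodule (log_derivations b \<alpha> \<A> m)"

definition free_arrangement ::
    "('n::finite \<Rightarrow> 'v) \<Rightarrow> ('v set \<Rightarrow> 'v \<Rightarrow> 'k::field) \<Rightarrow> 'v set set \<Rightarrow> bool" where
  "free_arrangement b \<alpha> \<A> \<longleftrightarrow> free_multiarrangement b \<alpha> \<A> (\<lambda>_. 1)"

text \<open>Multiplicities are extensional (fixed outside \<open>\<A>\<close>), so that the finiteness of a set of
  them has its usual meaning.\<close>

definition multiplicities :: "'v set set \<Rightarrow> ('v set \<Rightarrow> nat) set" where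
  "multiplicities \<A> = \<A> \<rightarrow>\<^sub>E {0<..}"

definition NFM ::
    "('n::finite \<Rightarrow> 'v) \<Rightarrow> ('v set \<Rightarrow> 'v \<Rightarrow> 'k::field) \<Rightarrow> 'v set set \<Rightarrow> ('v set \<Rightarrow> nat) set" where
  "NFM b \<alpha> \<A> = {m \<in> multiplicities \<A>. \<not> free_multiarrangement b \<alpha> \<A> m}"

definition totally_free ::
    "('n::finite \<Rightarrow> 'v) \<Rightarrow> ('v set \<Rightarrow> 'v \<Rightarrow> 'k::field) \<Rightarrow> 'v set set \<Rightarrow> bool" where
  "totally_free b \<alpha> \<A> \<longleftrightarrow> (\<forall>m\<in>multiplicities \<A>. free_multiarrangement b \<alpha> \<A> m)"

lemma totally_free_iff_NFM_empty: "totally_free b \<alpha> \<A> \<longleftrightarrow> NFM b \<alpha> \<A> = {}"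
  by (auto simp: totally_free_def NFM_def)

section \<open>Products\<close>

text \<open>Products are internal: an arrangement is paired with the subspace of \<open>V\<close> it lives in.\<close>

type_synonym 'v arr = "'v set \<times> 'v set set"

definition sum_set :: "'v::ab_group_add set \<Rightarrow> 'v set \<Rightarrow> 'v set" where
  "sum_set X Y = {x + y | x y. x \<in> X \<and> y \<in> Y}"

fun arr_product :: "'v::ab_group_add arr \<Rightarrow> 'v arr \<Rightarrow> 'v arr" where
  "arr_product (W1, \<A>1) (W2, \<A>2) =
     (sum_set W1 W2, {sum_set H1 W2 | H1. H1 \<in> \<A>1} \<union> {sum_set W1 H2 | H2. H2 \<in> \<A>2})"

text \<open>The empty arrangement in the zero space is neutral for \<open>arr_product\<close>.\<close>

definition arr_product_list :: "'v::ab_group_add arr list \<Rightarrow> 'v arr" where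
  "arr_product_list Fs = foldr arr_product Fs ({0}, {})"

definition direct_sum_decomposition ::
    "('k::field \<Rightarrow> 'v::ab_group_add \<Rightarrow> 'v) \<Rightarrow> 'v set list \<Rightarrow> bool" where
  "direct_sum_decomposition scale Ws \<longleftrightarrow>
     (\<forall>W\<in>set Ws. module.subspace scale W) \<and>
     (\<forall>v. \<exists>!xs. length xs = length Ws \<and> (\<forall>i<length Ws. xs ! i \<in> Ws ! i) \<and> sum_list xs = v)"

definition is_product_decomposition ::
    "('k::field \<Rightarrow> 'v::ab_group_add \<Rightarrow> 'v) \<Rightarrow> 'v set set \<Rightarrow> 'v arr list \<Rightarrow> bool" where
  "is_product_decomposition scale \<A> Fs \<longleftrightarrow>
     direct_sum_decomposition scale (map fst Fs) \<and>
     (\<forall>(W, \<B>)\<in>set Fs. central_arrangement scale W \<B>) \<and>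
     arr_product_list Fs = (UNIV, \<A>)"

end

theory Submission
  imports Defs
begin

text \<open>Everything depends on the linear relations between the forms \<open>\<alpha>\<^sub>H\<close>. Either the space has a
  basis, split into blocks of size one and two, such that every \<open>\<alpha>\<^sub>H\<close> only involves the coordinates of one block
  (\<open>block_basis\<close>), or one of the forms is a combination of others in which at least three independent
  ones have a nonzero coefficient (\<open>long_dependency\<close>). For this dichotomy
  (\<open>block_basis_or_long_dependency\<close>), expand all forms in a maximal independent family: in the absence of a long
  relation all supports have size at most two and, by an exchange argument, overlapping supports of size two
  coincide.

  A block basis is the same as a decomposition into factors of dimension one and two (\<open>block_basis_of_product\<close>,
  \<open>product_of_block_basis\<close>).

  A block basis makes every multiplicity free (\<open>block_basis_imp_free\<close>), and it is also one for every
  subarrangement. Starting from the partial derivatives, the multiplicities are raised one by one.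
  The value of a basis derivation at \<open>\<alpha>\<^sub>H\<close>, divided by the power already attained, is a binary form in the
  coordinates of the block of \<open>H\<close>, and modulo \<open>\<alpha>\<^sub>H\<close> binary forms are multiples of powers of a single
  element. So the cofactor of least degree can be used as a pivot to clear the others, and multiplying the
  pivot derivation by \<open>\<alpha>\<^sub>H\<close> gives a basis for the larger multiplicity (\<open>adapted_basis_Suc\<close>).

  A long relation obstructs freeness (\<open>not_free_of_dual_vectors\<close>). Logarithmic derivations are the
  solutions of the homogeneous system \<open>\<theta>(\<alpha>\<^sub>H) \<equiv> 0\<close> modulo \<open>\<alpha>\<^sub>H\<^sup>m\<close>. If they form a free module, then, by exactness of the
  Koszul complex of a regular sequence of length three, an inhomogeneous system that becomes solvable after multiplication
  with each member of the sequence is solvable (\<open>free_lifting\<close>). Powers of three of the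
  forms in the relation are such a sequence. For a suitable right hand side, solvability would put the product \<open>Q\<close>
  of the powers of the forms outside the relation into the ideal generated by the powers of the forms in the relation, which fails by
  degree as soon as the multiplicities on the relation are large compared to \<open>Q\<close>. Multiplicity one outside the relation and large
  multiplicities on it yield infinitely many multiplicities that are not free; on the subarrangement of the relation alone \<open>Q = 1\<close>, and multiplicity one
  is not free.\<close>

section \<open>The polynomial ring\<close>

lemma poly_mapping_sum_single:
  "p = (\<Sum>m\<in>Poly_Mapping.keys p. Poly_Mapping.single m (Poly_Mapping.lookup p m))"
proof (rule poly_mapping_eqI)
  fix k
  have "Poly_Mapping.lookup (\<Sum>m\<in>Poly_Mapping.keys p. Poly_Mapping.single m (Poly_Mapping.lookup p m)) k
     = (\<Sum>m\<in>Poly_Mapping.keys p. if m = k then Poly_Mapping.lookup p m else 0)"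
    by (simp add: lookup_sum lookup_single when_def)
  also have "\<dots> = Poly_Mapping.lookup p k"
    by (simp add: sum.delta' in_keys_iff)
  finally show "Poly_Mapping.lookup p k =
    Poly_Mapping.lookup (\<Sum>m\<in>Poly_Mapping.keys p. Poly_Mapping.single m (Poly_Mapping.lookup p m)) k" ..
qed

lemma poly_mapping_induct_single [case_names single add]:
  fixes p :: "'a \<Rightarrow>\<^sub>0 'b::comm_monoid_add"
  assumes "\<And>m c. P (Poly_Mapping.single m c)" and "\<And>p q. P p \<Longrightarrow> P q \<Longrightarrow> P (p + q)"
  shows "P p"
proof -
  have "P 0" using assms(1)[of undefined 0] by simp
  have "P (\<Sum>m\<in>A. Poly_Mapping.single m (Poly_Mapping.lookup p m))" if "finite A" for A
    using that by induction (use assms \<open>P 0\<close> in auto)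
  then show ?thesis using poly_mapping_sum_single[of p] by (metis finite_keys)
qed

lemma const_poly_simps [simp]:
  "const_poly 0 = 0" "const_poly 1 = 1"
  by (simp_all add: const_poly_def)

lemma const_poly_add: "const_poly (a + b) = const_poly a + const_poly b"
  by (simp add: const_poly_def single_add)

lemma const_poly_diff: "const_poly (a - b) = const_poly a - const_poly b"
  by (simp add: const_poly_def single_diff)

lemma const_poly_uminus: "const_poly (- a) = - const_poly a"
  by (simp add: const_poly_def single_uminus)

lemma const_poly_mult: "const_poly (a * b) = const_poly a * const_poly b"
  by (simp add: const_poly_def mult_single)

lemma const_poly_sum: "const_poly (sum f A) = (\<Sum>x\<in>A. const_poly (f x))"
  by (induction A rule: infinite_finite_induct) (auto simp: const_poly_add)

lemma const_poly_inverse: "c \<noteq> 0 \<Longrightarrow> const_poly c * const_poly (inverse c) = 1"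
  by (simp flip: const_poly_mult)

lemma const_poly_eq_0_iff [simp]: "const_poly c = 0 \<longleftrightarrow> c = 0"
  by (metis const_poly_def lookup_single_eq lookup_zero const_poly_simps(1))

lemma const_mult_single:
  "const_poly c * Poly_Mapping.single m d = Poly_Mapping.single m (c * d)"
  by (simp add: const_poly_def mult_single)

lemma poly_induct [case_names const var add mult]:
  fixes p :: "('n::finite, 'k::field) polys"
  assumes const: "\<And>c. P (const_poly c)" and var: "\<And>i. P (var_poly i)"
    and add: "\<And>p q. P p \<Longrightarrow> P q \<Longrightarrow> P (p + q)"
    and mult: "\<And>p q. P p \<Longrightarrow> P q \<Longrightarrow> P (p * q)"
  shows "P p"
proof (induction p rule: poly_mapping_induct_single)
  case (single m c)
  have pow: "P (var_poly i ^ k)" for i k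
    by (induction k) (use const[of 1] var mult in auto)
  have pow_eq: "var_poly i ^ k = Poly_Mapping.single (Poly_Mapping.single i k) (1::'k)" for i :: 'n and k
    by (induction k) (auto simp: var_poly_def mult_single simp flip: single_add)
  have "P (\<Prod>i\<in>A. var_poly i ^ Poly_Mapping.lookup m i)" if "finite A" for A
    using that by induction (use const[of 1] mult pow in auto)
  moreover have "(\<Prod>i\<in>A. var_poly i ^ Poly_Mapping.lookup m i) =
     Poly_Mapping.single (\<Sum>i\<in>A. Poly_Mapping.single i (Poly_Mapping.lookup m i)) (1::'k)"
    if "finite A" for A
    using that by induction (auto simp: pow_eq mult_single)
  ultimately have "P (Poly_Mapping.single (\<Sum>i\<in>UNIV. Poly_Mapping.single i (Poly_Mapping.lookup m i)) 1)"
    by (metis finite_code)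
  also have "(\<Sum>i\<in>UNIV. Poly_Mapping.single i (Poly_Mapping.lookup m i)) = m"
    by (rule poly_mapping_eqI) (simp add: lookup_sum lookup_single when_def)
  finally have "P (Poly_Mapping.single m 1)" .
  from mult[OF const[of c] this] show ?case by (simp add: const_mult_single)
qed (use add in auto)

text \<open>Leading monomials: exponent vectors \<open>'n \<Rightarrow>\<^sub>0 nat\<close> are compared through an additive embedding into
  \<open>nat \<Rightarrow>\<^sub>0 nat\<close>, whose lexicographic order is compatible with addition, so the product of the leading
  terms of two factors cannot cancel.\<close>

lemma polys_no_zero_divisors:
  fixes f g :: "('n::finite, 'k::field) polys"
  assumes "f \<noteq> 0" "g \<noteq> 0" shows "f * g \<noteq> 0"
proof -
  obtain i :: "'n \<Rightarrow> nat" where "inj i"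
    using finite_imp_inj_to_nat_seg[of "UNIV :: 'n set"] by auto
  define \<kappa> :: "('n \<Rightarrow>\<^sub>0 nat) \<Rightarrow> (nat \<Rightarrow>\<^sub>0 nat)"
    where "\<kappa> m = (\<Sum>j\<in>UNIV. Poly_Mapping.single (i j) (Poly_Mapping.lookup m j))" for m
  have \<kappa>_add: "\<kappa> (m + n) = \<kappa> m + \<kappa> n" for m n
    by (simp add: \<kappa>_def lookup_add single_add sum.distrib)
  have lookup_\<kappa>: "Poly_Mapping.lookup (\<kappa> m) (i j) = Poly_Mapping.lookup m j" for m j
    using \<open>inj i\<close> by (simp add: \<kappa>_def lookup_sum lookup_single when_def inj_eq)
  have \<kappa>_inj: "\<kappa> m = \<kappa> n \<Longrightarrow> m = n" for m n
    by (metis lookup_\<kappa> poly_mapping_eqI)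
  have lead: "\<exists>m\<in>Poly_Mapping.keys h. \<forall>n\<in>Poly_Mapping.keys h. \<kappa> n \<le> \<kappa> m" if "h \<noteq> 0"
    for h :: "('n, 'k) polys"
  proof -
    have "finite (\<kappa> ` Poly_Mapping.keys h)" "\<kappa> ` Poly_Mapping.keys h \<noteq> {}"
      using that by (auto simp: keys_eq_empty)
    from Max_in[OF this] Max_ge[OF this(1)] show ?thesis by (metis (no_types, lifting) image_iff)
  qed
  obtain m where m: "m \<in> Poly_Mapping.keys f" "\<And>n. n \<in> Poly_Mapping.keys f \<Longrightarrow> \<kappa> n \<le> \<kappa> m"
    using lead[OF assms(1)] by auto
  obtain n where n: "n \<in> Poly_Mapping.keys g" "\<And>k. k \<in> Poly_Mapping.keys g \<Longrightarrow> \<kappa> k \<le> \<kappa> n"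
    using lead[OF assms(2)] by auto
  have uniq: "a = m \<and> b = n"
    if "a \<in> Poly_Mapping.keys f" "b \<in> Poly_Mapping.keys g" "a + b = m + n" for a b
  proof -
    have "\<kappa> a + \<kappa> b = \<kappa> m + \<kappa> n" using that(3) by (metis \<kappa>_add)
    moreover have "\<kappa> a \<le> \<kappa> m" "\<kappa> b \<le> \<kappa> n" using that m n by auto
    ultimately have "\<kappa> a = \<kappa> m"
      by (metis add_right_mono add_left_mono add_left_cancel add_right_cancel antisym)
    then have "a = m" by (rule \<kappa>_inj)
    with that(3) show ?thesis by simp
  qed
  have "f * g = (\<Sum>a\<in>Poly_Mapping.keys f. \<Sum>b\<in>Poly_Mapping.keys g.
      Poly_Mapping.single (a + b) (Poly_Mapping.lookup f a * Poly_Mapping.lookup g b))"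
    by (subst poly_mapping_sum_single[of f], subst poly_mapping_sum_single[of g])
       (simp add: sum_product mult_single)
  then have "Poly_Mapping.lookup (f * g) (m + n) = (\<Sum>a\<in>Poly_Mapping.keys f. \<Sum>b\<in>Poly_Mapping.keys g.
      if a + b = m + n then Poly_Mapping.lookup f a * Poly_Mapping.lookup g b else 0)"
    by (simp add: lookup_sum lookup_single when_def)
  also have "\<dots> = (\<Sum>a\<in>Poly_Mapping.keys f. \<Sum>b\<in>Poly_Mapping.keys g.
      if a = m then if b = n then Poly_Mapping.lookup f a * Poly_Mapping.lookup g b else 0 else 0)"
    by (intro sum.cong refl) (use uniq in auto)
  also have "\<dots> = (\<Sum>a\<in>Poly_Mapping.keys f. if a = m then Poly_Mapping.lookup f a * Poly_Mapping.lookup g n else 0)"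
    using n by (intro sum.cong refl) auto
  also have "\<dots> = Poly_Mapping.lookup f m * Poly_Mapping.lookup g n"
    using m by simp
  finally show ?thesis using m n by (auto simp: in_keys_iff)
qed

lemma polys_cancel:
  fixes f g h :: "('n::finite, 'k::field) polys"
  assumes "h \<noteq> 0" "h * f = h * g" shows "f = g"
  using polys_no_zero_divisors[of h "f - g"] assms by (auto simp: algebra_simps)

lemma polys_power_nonzero:
  fixes f :: "('n::finite, 'k::field) polys"
  assumes "f \<noteq> 0" shows "f ^ n \<noteq> 0"
  by (induction n) (use assms polys_no_zero_divisors in auto)

lemma polys_prod_nonzero:
  fixes f :: "'a \<Rightarrow> ('n::finite, 'k::field) polys"
  assumes "\<And>x. x \<in> A \<Longrightarrow> f x \<noteq> 0" shows "prod f A \<noteq> 0"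
  using assms by (induction A rule: infinite_finite_induct) (use polys_no_zero_divisors in auto)

subsection \<open>Linear extension from monomials\<close>

text \<open>Substitutions and derivations are both the linear extension of a map \<open>L\<close> on monomials; the
  ring homomorphism law and the Leibniz rule only have to be checked for \<open>L\<close>.\<close>

definition monomial_extend ::
    "(('n \<Rightarrow>\<^sub>0 nat) \<Rightarrow> ('n, 'k::field) polys) \<Rightarrow> ('n, 'k) polys \<Rightarrow> ('n, 'k) polys" where
  "monomial_extend L p = (\<Sum>m\<in>Poly_Mapping.keys p. const_poly (Poly_Mapping.lookup p m) * L m)"

lemma monomial_extend_add: "monomial_extend L (p + q) = monomial_extend L p + monomial_extend L q"
  unfolding monomial_extend_def
  by (rule setsum_keys_plus_distrib) (auto simp: const_poly_add algebra_simps)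

lemma monomial_extend_single:
  "monomial_extend L (Poly_Mapping.single m c) = const_poly c * L m"
  by (simp add: monomial_extend_def)

lemma monomial_extend_const:
  "monomial_extend L (const_poly c * p) = const_poly c * monomial_extend L p"
  by (induction p rule: poly_mapping_induct_single)
     (auto simp: const_mult_single monomial_extend_single const_poly_mult monomial_extend_add algebra_simps)

lemma exists_substitution:
  fixes y :: "'n::finite \<Rightarrow> ('n, 'k::field) polys"
  obtains \<sigma> :: "('n, 'k) polys \<Rightarrow> ('n, 'k) polys"
  where "\<And>f g. \<sigma> (f + g) = \<sigma> f + \<sigma> g" "\<And>f g. \<sigma> (f * g) = \<sigma> f * \<sigma> g"
    "\<And>c. \<sigma> (const_poly c) = const_poly c" "\<And>i. \<sigma> (var_poly i) = y i"
proof -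
  define L where "L m = (\<Prod>i\<in>UNIV. y i ^ Poly_Mapping.lookup m i)" for m
  have L_add: "L (m + n) = L m * L n" for m n
    by (simp add: L_def lookup_add power_add prod.distrib)
  have L_0: "L 0 = 1" by (simp add: L_def)
  have L_var: "L (Poly_Mapping.single i 1) = y i" for i
  proof -
    have "L (Poly_Mapping.single i 1) = (\<Prod>j\<in>UNIV. if j = i then y j else 1)"
      unfolding L_def by (rule prod.cong) (auto simp: lookup_single when_def)
    then show ?thesis by simp
  qed
  have single_mult: "monomial_extend L (Poly_Mapping.single m c * q) =
      monomial_extend L (Poly_Mapping.single m c) * monomial_extend L q" for m c q
    by (induction q rule: poly_mapping_induct_single)
       (auto simp: mult_single monomial_extend_single const_poly_mult L_add distrib_left monomial_extend_add algebra_simps)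
  have "monomial_extend L (p * q) = monomial_extend L p * monomial_extend L q" for p q
    by (induction p rule: poly_mapping_induct_single)
       (auto simp: single_mult distrib_right monomial_extend_add)
  then show thesis
    by (intro that[of "monomial_extend L"])
       (auto simp: monomial_extend_add const_poly_def var_poly_def monomial_extend_single L_0 L_var[simplified])
qed

subsection \<open>Derivations\<close>

lemma DerivationsD:
  assumes "\<theta> \<in> Derivations"
  shows "\<theta> (f + g) = \<theta> f + \<theta> g" "\<theta> (const_poly c * f) = const_poly c * \<theta> f"
    "\<theta> (f * g) = \<theta> f * g + f * \<theta> g"
  using assms by (auto simp: Derivations_def)

lemma derivation_const:
  assumes "\<theta> \<in> Derivations" shows "\<theta> (const_poly c) = 0"
proof -
  have "\<theta> (1 * 1) = \<theta> 1 * 1 + 1 * \<theta> 1" by (rule DerivationsD(3)[OF assms])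
  then have "\<theta> 1 = 0" by simp
  then show ?thesis using DerivationsD(2)[OF assms, of c 1] by simp
qed

lemma derivation_sum:
  assumes "\<theta> \<in> Derivations" shows "\<theta> (sum f A) = (\<Sum>x\<in>A. \<theta> (f x))"
  by (induction A rule: infinite_finite_induct)
     (use derivation_const[OF assms, of 0] DerivationsD(1)[OF assms] in auto)

lemma derivation_eqI:
  fixes \<theta> \<eta> :: "('n::finite, 'k::field) polys \<Rightarrow> ('n, 'k) polys"
  assumes "\<theta> \<in> Derivations" "\<eta> \<in> Derivations" "\<And>i. \<theta> (var_poly i) = \<eta> (var_poly i)"
  shows "\<theta> = \<eta>"
proof
  fix p :: "('n, 'k) polys"
  show "\<theta> p = \<eta> p"
    by (induction p rule: poly_induct)
       (use assms in \<open>auto simp: DerivationsD derivation_const\<close>)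
qed

text \<open>The polynomial ring is free on its variables, so the values \<open>y i\<close> of a derivation on the variables
  can be prescribed. The derivation is \<open>\<Sum>\<^sub>i y\<^sub>i \<partial>\<^sub>i\<close>, and \<open>L\<close> is its value on monomials.\<close>

lemma exists_derivation:
  fixes y :: "'n::finite \<Rightarrow> ('n, 'k::field) polys"
  shows "\<exists>\<theta>\<in>Derivations. \<forall>i. \<theta> (var_poly i) = y i"
proof -
  define L where "L m = (\<Sum>i\<in>UNIV. Poly_Mapping.single (m - Poly_Mapping.single i 1)
      (of_nat (Poly_Mapping.lookup m i)) * y i)" for m
  \<comment> \<open>The subtraction of exponents truncates when the variable does not occur in \<open>m\<close>, but then the
    coefficient vanishes.\<close>
  have exponent: "Poly_Mapping.single (m + n - Poly_Mapping.single i 1) (of_nat (Poly_Mapping.lookup m i)) =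
      Poly_Mapping.single (m - Poly_Mapping.single i 1) (of_nat (Poly_Mapping.lookup m i)) *
      Poly_Mapping.single n (1::'k)" for m n i
  proof (cases "Poly_Mapping.lookup m i = 0")
    case False
    have "m + n - Poly_Mapping.single i 1 = m - Poly_Mapping.single i 1 + n"
      by (rule poly_mapping_eqI) (use False in \<open>auto simp: lookup_add lookup_minus lookup_single when_def\<close>)
    then show ?thesis by (simp add: mult_single)
  qed simp
  have L_add: "L (m + n) = L m * Poly_Mapping.single n 1 + Poly_Mapping.single m 1 * L n" for m n
  proof -
    have "L (m + n) = (\<Sum>i\<in>UNIV.
        Poly_Mapping.single (m + n - Poly_Mapping.single i 1) (of_nat (Poly_Mapping.lookup m i)) * y i +
        Poly_Mapping.single (n + m - Poly_Mapping.single i 1) (of_nat (Poly_Mapping.lookup n i)) * y i)"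
      unfolding L_def
      by (intro sum.cong refl) (simp add: lookup_add single_add add.commute distrib_right)
    also have "\<dots> = L m * Poly_Mapping.single n 1 + Poly_Mapping.single m 1 * L n"
      unfolding exponent L_def by (simp add: sum.distrib sum_distrib_left sum_distrib_right mult_ac)
    finally show ?thesis .
  qed
  have L_var: "L (Poly_Mapping.single i 1) = y i" for i
  proof -
    have "L (Poly_Mapping.single i 1) = (\<Sum>j\<in>UNIV. if j = i then y j else 0)"
      unfolding L_def by (rule sum.cong) (auto simp: lookup_single when_def)
    then show ?thesis by simp
  qed
  let ?D = "monomial_extend L"
  have single_mult: "?D (Poly_Mapping.single m c * q) = ?D (Poly_Mapping.single m c) * q + Poly_Mapping.single m c * ?D q"
    for m c q
  proof (induction q rule: poly_mapping_induct_single)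
    case (single n d)
    have "?D (Poly_Mapping.single m c * Poly_Mapping.single n d) =
       const_poly c * const_poly d * (L m * Poly_Mapping.single n 1 + Poly_Mapping.single m 1 * L n)"
      by (simp add: mult_single monomial_extend_single const_poly_mult L_add)
    also have "\<dots> = const_poly c * L m * (const_poly d * Poly_Mapping.single n 1) +
        (const_poly c * Poly_Mapping.single m 1) * (const_poly d * L n)"
      by (simp add: algebra_simps)
    finally show ?case by (simp add: monomial_extend_single const_mult_single)
  qed (simp add: distrib_left monomial_extend_add algebra_simps)
  have "?D (p * q) = ?D p * q + p * ?D q" for p q
    by (induction p rule: poly_mapping_induct_single)
       (simp_all add: single_mult monomial_extend_add distrib_right add_ac)
  then have "?D \<in> Derivations"
    by (simp add: Derivations_def monomial_extend_add monomial_extend_const)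
  moreover have "?D (var_poly i) = y i" for i
    using L_var[of i] by (simp add: var_poly_def monomial_extend_single)
  ultimately show ?thesis by blast
qed

lemma derivation_add:
  assumes "\<theta> \<in> Derivations" "\<eta> \<in> Derivations" shows "\<theta> + \<eta> \<in> Derivations"
  unfolding Derivations_def plus_fun_def mem_Collect_eq assms[THEN DerivationsD(1)]
    assms[THEN DerivationsD(2)] assms[THEN DerivationsD(3)]
  by (simp add: algebra_simps derivation_const[OF assms(1)] derivation_const[OF assms(2)])

lemma derivation_diff:
  assumes "\<theta> \<in> Derivations" "\<eta> \<in> Derivations" shows "\<theta> - \<eta> \<in> Derivations"
  unfolding Derivations_def fun_diff_def mem_Collect_eq assms[THEN DerivationsD(1)]
    assms[THEN DerivationsD(2)] assms[THEN DerivationsD(3)]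
  by (simp add: algebra_simps derivation_const[OF assms(1)] derivation_const[OF assms(2)])

lemma derivation_scale:
  assumes "\<theta> \<in> Derivations" shows "der_scale f \<theta> \<in> Derivations"
  unfolding Derivations_def der_scale_def mem_Collect_eq DerivationsD(1)[OF assms]
    DerivationsD(2)[OF assms] DerivationsD(3)[OF assms]
  by (simp add: algebra_simps derivation_const[OF assms])

lemma der_scale_apply: "der_scale c \<theta> f = c * \<theta> f"
  by (simp add: der_scale_def)

lemma derivation_zero: "0 \<in> Derivations"
  by (simp add: Derivations_def)

lemma derivation_lincomb:
  "(\<And>x. x \<in> A \<Longrightarrow> \<theta> x \<in> Derivations) \<Longrightarrow> (\<Sum>x\<in>A. der_scale (c x) (\<theta> x)) \<in> Derivations"
  by (induction A rule: infinite_finite_induct)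
     (auto simp: derivation_zero derivation_add derivation_scale simp del: plus_fun_apply)

lemma lincomb_apply: "(\<Sum>x\<in>A. der_scale (c x) (\<theta> x)) f = (\<Sum>x\<in>A. c x * \<theta> x f)"
  by (induction A rule: infinite_finite_induct) (auto simp: der_scale_def)

section \<open>Linear forms as primes of the polynomial ring\<close>

text \<open>A vector space together with the basis whose dual basis provides the variables of the polynomial
  ring.\<close>

locale coordinatized_space = finite_dimensional_vector_space scale "range b"
  for scale :: "'k::field \<Rightarrow> 'v::ab_group_add \<Rightarrow> 'v" (infixr \<open>*s\<close> 75) and b :: "'n::finite \<Rightarrow> 'v" +
  assumes inj_b: "inj b"
begin

abbreviation linear_form :: "('v \<Rightarrow> 'k) \<Rightarrow> bool" where
  "linear_form a \<equiv> Vector_Spaces.linear scale (*) a"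

lemma linear_formD:
  assumes "linear_form a"
  shows "a (v + w) = a v + a w" "a (c *s v) = c * a v" "a 0 = 0" "a (v - w) = a v - a w"
    "a (sum f A) = (\<Sum>x\<in>A. a (f x))"
proof -
  interpret a: Vector_Spaces.linear scale "(*)" a by fact
  show "a (v + w) = a v + a w" "a (c *s v) = c * a v" "a 0 = 0" "a (v - w) = a v - a w"
    "a (sum f A) = (\<Sum>x\<in>A. a (f x))"
    by (auto simp: a.add a.scale a.zero a.diff a.sum)
qed

lemma linear_formI:
  assumes "\<And>v w. a (v + w) = a v + a w" "\<And>c v. a (c *s v) = c * a v"
  shows "linear_form a"
proof -
  have "vector_space ((*) :: 'k \<Rightarrow> 'k \<Rightarrow> 'k)"
    by unfold_locales (auto simp: algebra_simps)
  then show ?thesis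
    unfolding Vector_Spaces.linear_iff using assms vector_space_axioms by auto
qed

lemma linear_form_basis_expansion:
  assumes "linear_form a"
  shows "a v = (\<Sum>i\<in>UNIV. representation (range b) v (b i) * a (b i))"
proof -
  have "v = (\<Sum>x\<in>range b. representation (range b) v x *s x)"
    by (rule sum_representation_eq[symmetric]) (auto simp: independent_Basis span_Basis)
  also have "\<dots> = (\<Sum>i\<in>UNIV. representation (range b) v (b i) *s b i)"
    using inj_b by (simp add: sum.reindex)
  finally have "a v = a (\<Sum>i\<in>UNIV. representation (range b) v (b i) *s b i)" by simp
  then show ?thesis by (simp add: linear_formD[OF assms])
qed

lemma form_poly_sum:
  "form_poly b (\<lambda>v. \<Sum>x\<in>A. c x * a x v) = (\<Sum>x\<in>A. const_poly (c x) * form_poly b (a x))"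
proof -
  have "form_poly b (\<lambda>v. \<Sum>x\<in>A. c x * a x v)
    = (\<Sum>i\<in>UNIV. \<Sum>x\<in>A. const_poly (c x) * (const_poly (a x (b i)) * var_poly i))"
    by (simp add: form_poly_def const_poly_sum const_poly_mult sum_distrib_right mult.assoc)
  also have "\<dots> = (\<Sum>x\<in>A. const_poly (c x) * form_poly b (a x))"
    by (subst sum.swap) (simp add: form_poly_def sum_distrib_left)
  finally show ?thesis .
qed

lemma derivation_form:
  assumes "\<theta> \<in> Derivations"
  shows "\<theta> (form_poly b a) = (\<Sum>i\<in>UNIV. const_poly (a (b i)) * \<theta> (var_poly i))"
  by (simp add: form_poly_def derivation_sum[OF assms] DerivationsD(2)[OF assms])

lemma derivation_form_sum:
  assumes "\<theta> \<in> Derivations" "\<And>v. f v = (\<Sum>x\<in>A. c x * a x v)"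
  shows "\<theta> (form_poly b f) = (\<Sum>x\<in>A. const_poly (c x) * \<theta> (form_poly b (a x)))"
proof -
  have "f = (\<lambda>v. \<Sum>x\<in>A. c x * a x v)" using assms(2) by auto
  then show ?thesis
    by (simp add: form_poly_sum derivation_sum[OF assms(1)] DerivationsD(2)[OF assms(1)])
qed

lemma exists_directional_derivative:
  "\<exists>\<theta>\<in>Derivations. \<forall>a. linear_form a \<longrightarrow> \<theta> (form_poly b a) = const_poly (a v)"
proof -
  obtain \<theta> :: "('n, 'k) polys \<Rightarrow> ('n, 'k) polys" where \<theta>: "\<theta> \<in> Derivations"
      "\<And>i. \<theta> (var_poly i) = const_poly (representation (range b) v (b i))"
    using exists_derivation[of "\<lambda>i. const_poly (representation (range b) v (b i))"] by blast
  have "\<theta> (form_poly b a) = const_poly (a v)" if "linear_form a" for a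
    by (subst linear_form_basis_expansion[OF that, of v])
       (simp add: derivation_form[OF \<theta>(1)] \<theta>(2) const_poly_sum const_poly_mult mult.commute)
  then show ?thesis using \<theta>(1) by blast
qed

text \<open>The derivative in the direction of a vector, i.e. the constant vector field \<open>v\<close>. It pairs with linear
  forms by evaluation, which lets it read off values of a form from the associated polynomial.\<close>

definition directional :: "'v \<Rightarrow> ('n, 'k) polys \<Rightarrow> ('n, 'k) polys" where
  "directional v = (SOME \<theta>. \<theta> \<in> Derivations \<and>
     (\<forall>a. linear_form a \<longrightarrow> \<theta> (form_poly b a) = const_poly (a v)))"

lemma directional:
  "directional v \<in> Derivations"
  "linear_form a \<Longrightarrow> directional v (form_poly b a) = const_poly (a v)"
  using someI_ex[of "\<lambda>\<theta>. \<theta> \<in> Derivations \<and>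
     (\<forall>a. linear_form a \<longrightarrow> \<theta> (form_poly b a) = const_poly (a v))"]
    exists_directional_derivative[of v]
  by (auto simp: directional_def)

lemma form_poly_eq_0:
  assumes "linear_form a" "form_poly b a = 0" shows "a v = 0"
  using directional(1)[of v] directional(2)[OF assms(1), of v] assms(2) derivation_const[of "directional v" 0] by simp

text \<open>Projecting along \<open>e\<close> onto the hyperplane \<open>a = 0\<close>, where \<open>a e = 1\<close>, induces a retraction of the
  polynomial ring: it sends a form \<open>\<xi>\<close> to \<open>\<xi> - \<xi>(e) a\<close>, and its kernel is the ideal generated by \<open>a\<close>.
  As the polynomial ring has no zero divisors, this makes \<open>a\<close> a prime element.\<close>

definition retraction_along :: "('v \<Rightarrow> 'k) \<Rightarrow> 'v \<Rightarrow> (('n, 'k) polys \<Rightarrow> ('n, 'k) polys) \<Rightarrow> bool" where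
  "retraction_along a e \<sigma> \<longleftrightarrow>
     (\<forall>f g. \<sigma> (f + g) = \<sigma> f + \<sigma> g) \<and> (\<forall>f g. \<sigma> (f * g) = \<sigma> f * \<sigma> g) \<and>
     (\<forall>\<xi>. linear_form \<xi> \<longrightarrow> \<sigma> (form_poly b \<xi>) = form_poly b \<xi> - const_poly (\<xi> e) * form_poly b a) \<and>
     (\<forall>f. form_poly b a dvd f - \<sigma> f) \<and> (\<forall>f. form_poly b a dvd f \<longleftrightarrow> \<sigma> f = 0)"

lemma retraction_alongD:
  assumes "retraction_along a e \<sigma>"
  shows "\<sigma> (f + g) = \<sigma> f + \<sigma> g" "\<sigma> (f * g) = \<sigma> f * \<sigma> g"
    "linear_form \<xi> \<Longrightarrow> \<sigma> (form_poly b \<xi>) = form_poly b \<xi> - const_poly (\<xi> e) * form_poly b a"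
    "form_poly b a dvd f - \<sigma> f" "form_poly b a dvd f \<longleftrightarrow> \<sigma> f = 0"
  using assms by (auto simp: retraction_along_def)

lemma exists_retraction_along:
  assumes "linear_form a" "a e = 1"
  shows "\<exists>\<sigma>. retraction_along a e \<sigma>"
proof -
  obtain \<sigma> :: "('n, 'k) polys \<Rightarrow> ('n, 'k) polys" where
    \<sigma>_add: "\<And>f g. \<sigma> (f + g) = \<sigma> f + \<sigma> g" and \<sigma>_mult: "\<And>f g. \<sigma> (f * g) = \<sigma> f * \<sigma> g" and
    const: "\<And>c. \<sigma> (const_poly c) = const_poly c" and
    var: "\<And>i. \<sigma> (var_poly i) = var_poly i - const_poly (representation (range b) e (b i)) * form_poly b a"
    using exists_substitution[of "\<lambda>i. var_poly i - const_poly (representation (range b) e (b i)) * form_poly b a"]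
    by blast
  have zero: "\<sigma> 0 = 0" using const[of 0] by simp
  have sum: "\<sigma> (sum f A) = (\<Sum>x\<in>A. \<sigma> (f x))" for f :: "'n \<Rightarrow> ('n, 'k) polys" and A
    by (induction A rule: infinite_finite_induct) (auto simp: \<sigma>_add zero)
  have form: "\<sigma> (form_poly b \<xi>) = form_poly b \<xi> - const_poly (\<xi> e) * form_poly b a"
    if "linear_form \<xi>" for \<xi>
  proof -
    have "\<sigma> (form_poly b \<xi>) = (\<Sum>i\<in>UNIV. const_poly (\<xi> (b i)) *
        (var_poly i - const_poly (representation (range b) e (b i)) * form_poly b a))"
      by (subst form_poly_def) (simp add: sum \<sigma>_mult const var)
    also have "\<dots> = form_poly b \<xi> - (\<Sum>i\<in>UNIV. const_poly (representation (range b) e (b i) * \<xi> (b i))) * form_poly b a"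
      by (simp add: form_poly_def[of b \<xi>] right_diff_distrib sum_subtractf sum_distrib_left sum_distrib_right
          const_poly_mult mult_ac)
    also have "\<dots> = form_poly b \<xi> - const_poly (\<xi> e) * form_poly b a"
      by (simp add: linear_form_basis_expansion[OF that, of e] const_poly_sum)
    finally show ?thesis .
  qed
  \<comment> \<open>The polynomials that \<open>\<sigma>\<close> fixes modulo \<open>a\<close> form a subring containing the constants and the
    variables.\<close>
  have dvd: "form_poly b a dvd f - \<sigma> f" for f
  proof (induction f rule: poly_induct)
    case (add p q)
    then show ?case using dvd_add[OF add] by (simp add: assms \<sigma>_add algebra_simps)
  next
    case (mult p q)
    have "p * q - \<sigma> (p * q) = (p - \<sigma> p) * q + \<sigma> p * (q - \<sigma> q)"
      by (simp add: \<sigma>_mult algebra_simps)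
    then show ?case using mult by auto
  qed (auto simp: const var)
  have "form_poly b a dvd f \<longleftrightarrow> \<sigma> f = 0" for f
  proof
    assume "form_poly b a dvd f"
    then obtain g where "f = form_poly b a * g" by blast
    moreover have "\<sigma> (form_poly b a) = 0" using form[OF assms(1)] assms(2) by simp
    ultimately show "\<sigma> f = 0" by (simp add: \<sigma>_mult)
  next
    assume "\<sigma> f = 0"
    then show "form_poly b a dvd f" using dvd[of f] by simp
  qed
  with \<sigma>_add \<sigma>_mult form dvd have "retraction_along a e \<sigma>" by (simp add: retraction_along_def)
  then show ?thesis by blast
qed

lemma linear_form_normalize:
  assumes "linear_form a" "a e \<noteq> 0" shows "a (inverse (a e) *s e) = 1"
  using assms by (simp add: linear_formD)

lemma form_prime:
  assumes "linear_form a" "a e \<noteq> 0" "form_poly b a dvd f * g"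
  shows "form_poly b a dvd f \<or> form_poly b a dvd g"
proof -
  obtain \<sigma> where \<sigma>: "retraction_along a (inverse (a e) *s e) \<sigma>"
    using exists_retraction_along[OF assms(1) linear_form_normalize[OF assms(1,2)]] by blast
  have "\<sigma> f * \<sigma> g = 0" using assms(3) retraction_alongD(2,5)[OF \<sigma>] by simp
  then show ?thesis using polys_no_zero_divisors retraction_alongD(5)[OF \<sigma>] by blast
qed

text \<open>A form divides another one only if it is proportional to it; the conclusion states proportionality
  without division.\<close>

lemma form_dvd_form:
  assumes "linear_form a" "a e \<noteq> 0" "linear_form \<xi>" "form_poly b a dvd form_poly b \<xi>"
  shows "a e * \<xi> v = \<xi> e * a v"
proof -
  define e' where "e' = inverse (a e) *s e"
  obtain \<sigma> where \<sigma>: "retraction_along a e' \<sigma>"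
    using exists_retraction_along[OF assms(1) linear_form_normalize[OF assms(1,2)]] unfolding e'_def by blast
  have eq: "form_poly b \<xi> = const_poly (\<xi> e') * form_poly b a"
    using retraction_alongD(3)[OF \<sigma> assms(3)] assms(4) retraction_alongD(5)[OF \<sigma>] by simp
  have "const_poly (\<xi> v) = (const_poly (\<xi> e' * a v) :: ('n, 'k) polys)"
    using directional(2)[OF assms(3), of v] directional(2)[OF assms(1), of v]
    by (simp add: eq DerivationsD(2)[OF directional(1)] const_poly_mult)
  then have "const_poly (\<xi> v - \<xi> e' * a v) = (0 :: ('n, 'k) polys)" by (simp add: const_poly_diff)
  then have "\<xi> v = \<xi> e' * a v" by simp
  moreover have "\<xi> e' = inverse (a e) * \<xi> e" by (simp add: e'_def linear_formD[OF assms(3)])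
  ultimately show ?thesis using assms(2) by simp
qed

lemma form_power_dvd_cancel:
  assumes "linear_form a" "a e \<noteq> 0" "\<not> form_poly b a dvd x" "form_poly b a ^ m dvd x * f"
  shows "form_poly b a ^ m dvd f"
  using assms(4)
proof (induction m arbitrary: f)
  case (Suc m)
  have nz: "form_poly b a \<noteq> 0" using form_poly_eq_0 assms(1,2) by blast
  have "form_poly b a dvd x * f" using Suc.prems by (meson dvd_power dvd_trans zero_less_Suc)
  then obtain g where g: "f = form_poly b a * g"
    using form_prime[OF assms(1,2)] assms(3) by blast
  obtain h where "x * f = form_poly b a ^ Suc m * h" using Suc.prems by blast
  then have "form_poly b a * (x * g) = form_poly b a * (form_poly b a ^ m * h)"
    by (simp add: g mult_ac)
  then have "x * g = form_poly b a ^ m * h" by (rule polys_cancel[OF nz])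
  then have "form_poly b a ^ m dvd g" using Suc.IH by simp
  then show ?case by (simp add: g mult_dvd_mono)
qed simp

lemma form_not_dvd_power:
  assumes "linear_form a" "a e \<noteq> 0" "\<not> form_poly b a dvd x" shows "\<not> form_poly b a dvd x ^ n"
proof (induction n)
  case 0
  have "\<not> form_poly b a dvd 1" using assms(3) one_dvd dvd_trans by blast
  then show ?case by simp
next
  case (Suc n)
  then show ?case using form_prime[OF assms(1,2)] assms(3) by auto
qed

end

section \<open>A Koszul obstruction to freeness\<close>

text \<open>The two properties of a regular sequence \<open>X, Y, Z\<close> that make a Koszul cycle a boundary: \<open>X\<close> and \<open>Y\<close>
  have only the trivial syzygy, and \<open>Z\<close> is not a zero divisor modulo \<open>(X, Y)\<close>.\<close>

definition regular_triple :: "'a::comm_ring_1 \<Rightarrow> 'a \<Rightarrow> 'a \<Rightarrow> bool" where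
  "regular_triple Z X Y \<longleftrightarrow>
     (\<forall>f g. X * f = Y * g \<longrightarrow> (\<exists>h. f = Y * h \<and> g = X * h)) \<and>
     (\<forall>p f g. Z * p = X * f + Y * g \<longrightarrow> (\<exists>f' g'. p = X * f' + Y * g'))"

text \<open>Being a non-zero-divisor modulo \<open>(U, V)\<close> and modulo \<open>(X, V)\<close> passes to \<open>(U X, V)\<close>, because \<open>(U, V) / (U X, V)\<close>
  is isomorphic to the quotient of the ring by \<open>(X, V)\<close>: reduce modulo \<open>(U, V)\<close> first, then divide by \<open>U\<close>.\<close>

lemma nonzerodivisor_modulo_mult:
  fixes Z U X V :: "'a::comm_ring_1"
  assumes cop: "\<And>f g. U * f = V * g \<Longrightarrow> \<exists>h. f = V * h"
    and U: "\<And>p f g. Z * p = U * f + V * g \<Longrightarrow> \<exists>f' g'. p = U * f' + V * g'"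
    and X: "\<And>p f g. Z * p = X * f + V * g \<Longrightarrow> \<exists>f' g'. p = X * f' + V * g'"
    and eq: "Z * p = U * X * f + V * g"
  shows "\<exists>f' g'. p = U * X * f' + V * g'"
proof -
  have "Z * p = U * (X * f) + V * g" using eq by (simp add: mult_ac)
  from U[OF this] obtain p' p'' where p: "p = U * p' + V * p''" by blast
  have "U * (Z * p' - X * f) = V * (g - Z * p'')"
    using eq unfolding p by (simp add: algebra_simps)
  from cop[OF this] obtain c where "Z * p' - X * f = V * c" by blast
  then have "Z * p' = X * f + V * c" by (simp add: algebra_simps)
  from X[OF this] obtain q r where "p' = X * q + V * r" by blast
  then have "p = U * X * q + V * (U * r + p'')" unfolding p by (simp add: algebra_simps)
  then show ?thesis by blast
qed

text \<open>Regularity of \<open>x, y, z\<close> is raised to powers one factor at a time, first for \<open>x\<close>, then for \<open>y\<close>,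
  then for \<open>z\<close>.\<close>

lemma regular_triple_powers:
  fixes x y z :: "'a::comm_ring_1"
  assumes cop: "\<And>i j f g. x ^ i * f = y ^ j * g \<Longrightarrow> \<exists>h. f = y ^ j * h \<and> g = x ^ i * h"
    and base: "\<And>p f g. z * p = x * f + y * g \<Longrightarrow> \<exists>f' g'. p = x * f' + y * g'"
  shows "regular_triple (z ^ k) (x ^ Suc i) (y ^ Suc j)"
proof -
  have x: "\<exists>f' g'. p = x ^ Suc i * f' + y * g'" if "z * p = x ^ Suc i * f + y * g" for i p f g
    using that
  proof (induction i arbitrary: p f g)
    case 0
    then show ?case using base by simp
  next
    case (Suc i)
    have "z * p = x ^ Suc i * x * f + y * g" using Suc.prems by (simp add: mult_ac)
    moreover have "\<exists>h. f = y * h" if "x ^ Suc i * f = y * g" for f g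
      using cop[of "Suc i" f 1 g] that by auto
    ultimately have "\<exists>f' g'. p = x ^ Suc i * x * f' + y * g'"
      using nonzerodivisor_modulo_mult[of "x ^ Suc i" y z x p f g] Suc.IH base by blast
    then show ?case by (simp add: mult_ac)
  qed
  have xy: "\<exists>f' g'. p = x ^ Suc i * f' + y ^ Suc j * g'" if "z * p = x ^ Suc i * f + y ^ Suc j * g"
    for j p f g
    using that
  proof (induction j arbitrary: p f g)
    case 0
    then show ?case using x by simp
  next
    case (Suc j)
    have swap: "\<exists>f' g'. p = u * f' + v * g'" if "\<exists>f' g'. p = v * f' + u * g'" for p u v :: 'a
      using that by (metis add.commute)
    have "\<exists>f' g'. p = y ^ Suc j * y * f' + x ^ Suc i * g'"
    proof (rule nonzerodivisor_modulo_mult)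
      show "\<exists>h. f = x ^ Suc i * h" if "y ^ Suc j * f = x ^ Suc i * g" for f g
        using cop[of "Suc i" g "Suc j" f] that by auto
      show "\<exists>f' g'. p = y ^ Suc j * f' + x ^ Suc i * g'" if "z * p = y ^ Suc j * f + x ^ Suc i * g" for p f g
        by (rule swap, rule Suc.IH[of p g f]) (simp only: that add.commute)
      show "\<exists>f' g'. p = y * f' + x ^ Suc i * g'" if "z * p = y * f + x ^ Suc i * g" for p f g
        by (rule swap, rule x[of p i g f]) (simp only: that add.commute)
      show "z * p = y ^ Suc j * y * g + x ^ Suc i * f" using Suc.prems by (simp add: mult_ac add_ac)
    qed
    then have "\<exists>f' g'. p = x ^ Suc i * f' + y ^ Suc j * y * g'" by (rule swap)
    then show ?case by (simp add: mult_ac)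
  qed
  have "\<exists>f' g'. p = x ^ Suc i * f' + y ^ Suc j * g'" if "z ^ k * p = x ^ Suc i * f + y ^ Suc j * g" for p f g
    using that
  proof (induction k arbitrary: p f g)
    case 0
    then show ?case by auto
  next
    case (Suc k)
    have "z * (z ^ k * p) = x ^ Suc i * f + y ^ Suc j * g" using Suc.prems by (simp add: mult_ac)
    then obtain f' g' where "z ^ k * p = x ^ Suc i * f' + y ^ Suc j * g'" using xy by blast
    then show ?case by (rule Suc.IH)
  qed
  then show ?thesis unfolding regular_triple_def using cop by blast
qed

interpretation der: module der_scale by (rule module_der_scale)

text \<open>Regularity is a statement about the ring. A free module inherits it by comparing coefficients with
  respect to a basis: each coefficient of \<open>d1\<close> lies in the ideal \<open>(X, Y)\<close>.\<close>

lemma free_Koszul_exact: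
  fixes X Y Z :: "('n::finite, 'k::field) polys"
  assumes "free_submodule D" "regular_triple Z X Y" "d1 \<in> D" "d2 \<in> D" "d3 \<in> D"
    and rel: "der_scale Z d1 + der_scale X d2 + der_scale Y d3 = 0"
  shows "\<exists>a\<in>D. \<exists>c\<in>D. d1 = der_scale Y a - der_scale X c"
proof -
  obtain B where B: "\<not> der.dependent B" "der.span B = D"
    using assms(1) by (auto simp: free_submodule_def)
  let ?r = "der.representation B"
  have coeff: "\<exists>f g. ?r d1 t = Y * f - X * g" for t
  proof -
    have in_span: "d1 \<in> der.span B" "d2 \<in> der.span B" "d3 \<in> der.span B"
      using assms B by auto
    have "?r (der_scale Z d1 + der_scale X d2 + der_scale Y d3) t = 0"
      by (simp add: rel der.representation_zero)
    then have "Z * ?r d1 t + X * ?r d2 t + Y * ?r d3 t = 0"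
      using B(1) in_span
      by (simp add: der.representation_add der.representation_scale der.span_add der.span_scale del: plus_fun_apply)
    then have "Z * ?r d1 t = X * (- ?r d2 t) + Y * (- ?r d3 t)"
      by (simp add: algebra_simps eq_neg_iff_add_eq_0)
    then obtain f g where "?r d1 t = X * f + Y * g"
      using assms(2) unfolding regular_triple_def by blast
    then have "?r d1 t = Y * g - X * (- f)" by simp
    then show ?thesis by blast
  qed
  define f where "f t = (SOME f. \<exists>g. ?r d1 t = Y * f - X * g)" for t
  have f: "\<exists>g. ?r d1 t = Y * f t - X * g" for t
    unfolding f_def by (rule someI_ex) (rule coeff)
  define g where "g t = (SOME g. ?r d1 t = Y * f t - X * g)" for t
  have g: "?r d1 t = Y * f t - X * g t" for t
    unfolding g_def by (rule someI_ex) (rule f)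
  let ?T = "{t. ?r d1 t \<noteq> 0}"
  have T: "t \<in> B" if "t \<in> ?T" for t using that der.representation_ne_zero by blast
  have in_D: "(\<Sum>t\<in>?T. der_scale (f t) t) \<in> D" for f
    unfolding B(2)[symmetric] by (intro der.span_sum der.span_scale der.span_base T)
  have "d1 = (\<Sum>t\<in>?T. der_scale (?r d1 t) t)"
    using der.sum_nonzero_representation_eq[OF B(1)] B(2) assms(3) by simp
  also have "\<dots> = (\<Sum>t\<in>?T. der_scale Y (der_scale (f t) t) - der_scale X (der_scale (g t) t))"
    by (intro sum.cong refl) (simp add: der.scale_left_diff_distrib g del: fun_diff_def)
  also have "\<dots> = der_scale Y (\<Sum>t\<in>?T. der_scale (f t) t) - der_scale X (\<Sum>t\<in>?T. der_scale (g t) t)"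
    by (simp only: sum_subtractf der.scale_sum_right)
  finally show ?thesis using in_D by blast
qed

lemma derivation_quotient:
  fixes X :: "('n::finite, 'k::field) polys"
  assumes "X \<noteq> 0" "u \<in> Derivations" "\<And>f. u f = X * h f"
  shows "h \<in> Derivations"
proof -
  have "X * h (f + g) = X * (h f + h g)" for f g
    unfolding distrib_left assms(3)[symmetric] by (rule DerivationsD(1)[OF assms(2)])
  moreover have "X * h (const_poly c * f) = X * (const_poly c * h f)" for c f
    using DerivationsD(2)[OF assms(2), of c f] unfolding assms(3) by (simp add: mult_ac)
  moreover have "X * h (f * g) = X * (h f * g + f * h g)" for f g
    using DerivationsD(3)[OF assms(2), of f g] unfolding assms(3) by (simp add: algebra_simps)
  ultimately show ?thesis unfolding Derivations_def using polys_cancel[OF assms(1)] by blast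
qed

text \<open>This lifting principle is the source of all non-freeness in this theory. Consider the congruences
  \<open>\<theta> (\<alpha>\<^sub>H) \<equiv> g\<^sub>H\<close> modulo \<open>\<alpha>\<^sub>H\<^sup>m\<close> as a linear system for \<open>\<theta>\<close>. If \<open>X g\<close>, \<open>Y g\<close> and \<open>Z g\<close> are solvable by
  \<open>u\<close>, \<open>v\<close> and \<open>w\<close>, then \<open>Y u - X v\<close>, \<open>Z v - Y w\<close>, \<open>X w - Z u\<close> are logarithmic and form a Koszul cycle. Freeness
  of the module of logarithmic derivations makes it a boundary, which allows \<open>u\<close> and \<open>v\<close> to be corrected by logarithmic derivations so that they become
  \<open>X h\<close> and \<open>Y h\<close> for a common \<open>h\<close>, and \<open>h\<close> solves the system for \<open>g\<close>.\<close>

lemma (in coordinatized_space) free_lifting: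
  fixes X Y Z :: "('n, 'k) polys"
  assumes free: "free_multiarrangement b \<alpha> \<A> m" and reg: "regular_triple Z X Y"
    and nz: "X \<noteq> 0" "Y \<noteq> 0"
    and der: "u \<in> Derivations" "v \<in> Derivations" "w \<in> Derivations"
    and u: "\<And>H. H \<in> \<A> \<Longrightarrow> form_poly b (\<alpha> H) ^ m H dvd u (form_poly b (\<alpha> H)) - X * g H"
    and v: "\<And>H. H \<in> \<A> \<Longrightarrow> form_poly b (\<alpha> H) ^ m H dvd v (form_poly b (\<alpha> H)) - Y * g H"
    and w: "\<And>H. H \<in> \<A> \<Longrightarrow> form_poly b (\<alpha> H) ^ m H dvd w (form_poly b (\<alpha> H)) - Z * g H"
    and cancel: "\<And>H f. H \<in> \<A> \<Longrightarrow> form_poly b (\<alpha> H) ^ m H dvd X * f \<Longrightarrow>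
        form_poly b (\<alpha> H) ^ m H dvd Y * f \<Longrightarrow> form_poly b (\<alpha> H) ^ m H dvd f"
  shows "\<exists>h\<in>Derivations. \<forall>H\<in>\<A>. form_poly b (\<alpha> H) ^ m H dvd h (form_poly b (\<alpha> H)) - g H"
proof -
  let ?D = "log_derivations b \<alpha> \<A> m"
  have cross: "der_scale Y' u' - der_scale X' v' \<in> ?D"
    if "u' \<in> Derivations" "v' \<in> Derivations"
      and u': "\<And>H. H \<in> \<A> \<Longrightarrow> form_poly b (\<alpha> H) ^ m H dvd u' (form_poly b (\<alpha> H)) - X' * g H"
      and v': "\<And>H. H \<in> \<A> \<Longrightarrow> form_poly b (\<alpha> H) ^ m H dvd v' (form_poly b (\<alpha> H)) - Y' * g H"
    for u' v' X' Y'
  proof -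
    have "form_poly b (\<alpha> H) ^ m H dvd Y' * u' (form_poly b (\<alpha> H)) - X' * v' (form_poly b (\<alpha> H))"
      if "H \<in> \<A>" for H
    proof -
      have "Y' * u' (form_poly b (\<alpha> H)) - X' * v' (form_poly b (\<alpha> H)) =
          Y' * (u' (form_poly b (\<alpha> H)) - X' * g H) - X' * (v' (form_poly b (\<alpha> H)) - Y' * g H)"
        by (simp add: algebra_simps)
      then show ?thesis using dvd_diff[OF dvd_mult[OF u'[OF that]] dvd_mult[OF v'[OF that]]] by simp
    qed
    moreover have "der_scale Y' u' - der_scale X' v' \<in> Derivations"
      by (intro derivation_diff derivation_scale that)
    moreover have "(der_scale Y' u' - der_scale X' v') f = Y' * u' f - X' * v' f" for f
      by (simp add: der_scale_def)
    ultimately show ?thesis by (simp add: log_derivations_def)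
  qed
  have rel: "der_scale Z (der_scale Y u - der_scale X v) + der_scale X (der_scale Z v - der_scale Y w)
     + der_scale Y (der_scale X w - der_scale Z u) = 0"
    by (rule ext) (simp add: der_scale_def algebra_simps)
  have d1: "der_scale Y u - der_scale X v \<in> ?D"
    by (rule cross[OF der(1,2)]) (erule u, erule v)
  have d2: "der_scale Z v - der_scale Y w \<in> ?D"
    by (rule cross[OF der(2,3)]) (erule v, erule w)
  have d3: "der_scale X w - der_scale Z u \<in> ?D"
    by (rule cross[OF der(3,1)]) (erule w, erule u)
  obtain a c where ac: "a \<in> ?D" "c \<in> ?D"
    and eq: "der_scale Y u - der_scale X v = der_scale Y a - der_scale X c"
    using free_Koszul_exact[OF free[unfolded free_multiarrangement_def] reg d1 d2 d3 rel] by (elim bexE)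
  have "X * (v - c) f = Y * (u - a) f" for f
    using fun_cong[OF eq, of f] by (simp add: der_scale_def algebra_simps)
  then have "\<exists>h. (v - c) f = Y * h \<and> (u - a) f = X * h" for f
    using reg unfolding regular_triple_def by blast
  then have "\<exists>h. \<forall>f. (v - c) f = Y * h f \<and> (u - a) f = X * h f" by (intro choice allI)
  then obtain h where h: "\<And>f. (v - c) f = Y * h f" "\<And>f. (u - a) f = X * h f" by (elim exE) simp
  have D: "a \<in> Derivations" "c \<in> Derivations"
    and log: "\<And>H. H \<in> \<A> \<Longrightarrow> form_poly b (\<alpha> H) ^ m H dvd a (form_poly b (\<alpha> H))"
      "\<And>H. H \<in> \<A> \<Longrightarrow> form_poly b (\<alpha> H) ^ m H dvd c (form_poly b (\<alpha> H))"
    using ac by (auto simp: log_derivations_def)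
  show ?thesis
  proof (intro bexI ballI)
    show "h \<in> Derivations"
      using derivation_quotient[OF nz(1) derivation_diff[OF der(1) D(1)] h(2)] .
    fix H assume H: "H \<in> \<A>"
    have eqX: "X * (h (form_poly b (\<alpha> H)) - g H) = (u (form_poly b (\<alpha> H)) - X * g H) - a (form_poly b (\<alpha> H))"
      using h(2)[of "form_poly b (\<alpha> H)"] by (simp add: algebra_simps)
    have eqY: "Y * (h (form_poly b (\<alpha> H)) - g H) = (v (form_poly b (\<alpha> H)) - Y * g H) - c (form_poly b (\<alpha> H))"
      using h(1)[of "form_poly b (\<alpha> H)"] by (simp add: algebra_simps)
    show "form_poly b (\<alpha> H) ^ m H dvd h (form_poly b (\<alpha> H)) - g H"
      by (rule cancel[OF H]) (simp_all only: eqX eqY dvd_diff u v log H)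
  qed
qed

subsection \<open>Order of vanishing at the origin\<close>

definition monomial_degree :: "('n::finite \<Rightarrow>\<^sub>0 nat) \<Rightarrow> nat" where
  "monomial_degree \<mu> = (\<Sum>i\<in>UNIV. Poly_Mapping.lookup \<mu> i)"

text \<open>Membership in the \<open>N\<close>-th power of the ideal generated by the variables.\<close>

definition vanishes_to_order :: "nat \<Rightarrow> ('n::finite, 'k::field) polys \<Rightarrow> bool" where
  "vanishes_to_order N p \<longleftrightarrow> (\<forall>\<mu>\<in>Poly_Mapping.keys p. N \<le> monomial_degree \<mu>)"

lemma vanishes_to_order_add:
  "vanishes_to_order N p \<Longrightarrow> vanishes_to_order N q \<Longrightarrow> vanishes_to_order N (p + q)"
  using keys_add[of p q] by (auto simp: vanishes_to_order_def)

lemma vanishes_to_order_mult: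
  assumes "vanishes_to_order N p" "vanishes_to_order M q" shows "vanishes_to_order (N + M) (p * q)"
proof -
  have "monomial_degree (\<mu> + \<nu>) = monomial_degree \<mu> + monomial_degree \<nu>" for \<mu> \<nu> :: "'a \<Rightarrow>\<^sub>0 nat"
    by (simp add: monomial_degree_def lookup_add sum.distrib)
  then show ?thesis using keys_mult[of p q] assms by (fastforce simp: vanishes_to_order_def intro: add_mono)
qed

lemma vanishes_to_order_0: "vanishes_to_order 0 p"
  by (simp add: vanishes_to_order_def)

lemma vanishes_to_order_sum:
  "(\<And>x. x \<in> A \<Longrightarrow> vanishes_to_order N (p x)) \<Longrightarrow> vanishes_to_order N (sum p A)"
  by (induction A rule: infinite_finite_induct)
     (auto simp: vanishes_to_order_add, auto simp: vanishes_to_order_def)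

lemma vanishes_to_order_form:
  fixes a :: "'v \<Rightarrow> 'k::field" and b :: "'n::finite \<Rightarrow> 'v"
  shows "vanishes_to_order 1 (form_poly b a)"
  unfolding form_poly_def
proof (rule vanishes_to_order_sum)
  fix i :: 'n
  have "monomial_degree (Poly_Mapping.single i 1) = 1"
    by (simp add: monomial_degree_def lookup_single when_def)
  then have "vanishes_to_order 1 (var_poly i :: ('n, 'k) polys)"
    by (simp add: vanishes_to_order_def var_poly_def)
  then show "vanishes_to_order 1 (const_poly (a (b i)) * var_poly i)"
    using vanishes_to_order_mult[OF vanishes_to_order_0] by fastforce
qed

lemma vanishes_to_order_form_power:
  assumes "N \<le> k" "form_poly b a ^ k dvd p" shows "vanishes_to_order N p"
proof -
  have "vanishes_to_order k (form_poly b a ^ k)"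
    by (induction k) (use vanishes_to_order_0 vanishes_to_order_mult[OF vanishes_to_order_form] in auto)
  moreover obtain q where "p = form_poly b a ^ k * q" using assms(2) by blast
  ultimately have "vanishes_to_order (k + 0) p" using vanishes_to_order_mult vanishes_to_order_0 by metis
  then show ?thesis using assms(1) by (auto simp: vanishes_to_order_def)
qed

context coordinatized_space
begin

lemma dual_forms_not_dvd:
  assumes "linear_form x" "linear_form y" "y e \<noteq> 0" "x e = 0" "x e' \<noteq> 0"
  shows "\<not> form_poly b y dvd form_poly b x"
  using form_dvd_form[OF assms(2,3,1), of e'] assms by auto

lemma dual_forms_coprime:
  assumes "linear_form x" "linear_form y" "x e1 = 1" "y e1 = 0" "x e2 = 0" "y e2 = 1"
    and eq: "form_poly b x ^ i * f = form_poly b y ^ j * g"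
  shows "\<exists>h. f = form_poly b y ^ j * h \<and> g = form_poly b x ^ i * h"
proof -
  have y2: "y e2 \<noteq> 0" using assms by simp
  have "\<not> form_poly b y dvd form_poly b x"
    using dual_forms_not_dvd[of x y e2 e1] assms by simp
  then have "\<not> form_poly b y dvd form_poly b x ^ i"
    by (rule form_not_dvd_power[OF assms(2) y2])
  moreover have "form_poly b y ^ j dvd form_poly b x ^ i * f" by (simp add: eq)
  ultimately have "form_poly b y ^ j dvd f"
    by (rule form_power_dvd_cancel[OF assms(2) y2])
  then obtain h where h: "f = form_poly b y ^ j * h" by blast
  have "form_poly b y \<noteq> 0" using form_poly_eq_0[OF assms(2)] y2 by blast
  then have "form_poly b y ^ j \<noteq> 0" by (rule polys_power_nonzero)
  moreover have "form_poly b y ^ j * g = form_poly b y ^ j * (form_poly b x ^ i * h)"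
    using eq by (simp add: h mult_ac)
  ultimately have "g = form_poly b x ^ i * h" by (rule polys_cancel)
  with h show ?thesis by blast
qed

text \<open>Linear forms with a dual system of vectors form a regular sequence: the retraction along \<open>e1\<close> kills \<open>x\<close> and
  fixes \<open>y\<close> and \<open>z\<close>, so a relation modulo \<open>(x, y)\<close> becomes one modulo the prime \<open>y\<close>.\<close>

lemma dual_forms_regular:
  assumes "linear_form x" "linear_form y" "linear_form z"
    and "x e1 = 1" "y e1 = 0" "z e1 = 0" "x e2 = 0" "y e2 = 1" "z e2 = 0" "z e3 = 1"
  shows "regular_triple (form_poly b z ^ k) (form_poly b x ^ Suc i) (form_poly b y ^ Suc j)"
proof (rule regular_triple_powers)
  show "\<exists>h. f = form_poly b y ^ j * h \<and> g = form_poly b x ^ i * h"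
    if "form_poly b x ^ i * f = form_poly b y ^ j * g" for i j f g
    by (rule dual_forms_coprime[OF assms(1,2,4,5,7,8) that])
  fix p f g assume eq: "form_poly b z * p = form_poly b x * f + form_poly b y * g"
  obtain \<sigma> where "retraction_along x e1 \<sigma>"
    using exists_retraction_along[OF assms(1,4)] by blast
  note \<sigma> = retraction_alongD[OF this]
  have "\<sigma> (form_poly b x) = 0" "\<sigma> (form_poly b y) = form_poly b y" "\<sigma> (form_poly b z) = form_poly b z"
    using assms by (simp_all add: \<sigma>(3))
  then have "form_poly b z * \<sigma> p = form_poly b y * \<sigma> g"
    using arg_cong[OF eq, of \<sigma>] unfolding \<sigma>(1,2) by simp
  then have "form_poly b y dvd form_poly b z * \<sigma> p" by simp
  moreover have "\<not> form_poly b y dvd form_poly b z"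
    using dual_forms_not_dvd[of z y e2 e3] assms by simp
  ultimately obtain q where q: "\<sigma> p = form_poly b y * q"
    using form_prime[OF assms(2), of e2 "form_poly b z" "\<sigma> p"] assms by auto
  obtain r where "p - \<sigma> p = form_poly b x * r" using \<sigma>(4)[of p] by blast
  then have "p = form_poly b x * r + form_poly b y * q" using q by (simp add: algebra_simps)
  then show "\<exists>f' g'. p = form_poly b x * f' + form_poly b y * g'" by blast
qed

text \<open>Let \<open>\<alpha>\<^sub>0 = \<Sum>\<^sub>T c\<^sub>H \<alpha>\<^sub>H\<close> be a linear relation with at least three nonzero coefficients, at members of \<open>T\<close>
  that have dual vectors, and let \<open>Q\<close> be the product of the \<open>\<alpha>\<^sub>H\<^sup>m\<close> over the hyperplanes outside the relation.
  Prescribe the value \<open>Q\<close> at \<open>\<alpha>\<^sub>0\<close> and \<open>0\<close> at all other hyperplanes. Multiplied by any of the three powers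
  \<open>X = \<alpha>\<^sub>h\<^sup>m\<close> this system is solvable, by a multiple of the derivative in the dual direction of \<open>h\<close>. If
  the arrangement were free, the system itself would be solvable, and the relation would put \<open>Q\<close> into the ideal
  generated by the \<open>\<alpha>\<^sub>H\<^sup>m\<close> for \<open>H\<close> in the relation. This is impossible as soon as their multiplicities exceed
  the degree of some monomial \<open>\<mu>\<close> of \<open>Q\<close>.\<close>

theorem not_free_of_dual_vectors:
  fixes \<alpha> :: "'v set \<Rightarrow> 'v \<Rightarrow> 'k" and m :: "'v set \<Rightarrow> nat"
  assumes fin: "finite \<A>" and lin: "\<And>H. H \<in> \<A> \<Longrightarrow> linear_form (\<alpha> H)"
    and nz: "\<And>H. H \<in> \<A> \<Longrightarrow> \<exists>v. \<alpha> H v \<noteq> 0"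
    and T: "T \<subseteq> \<A>" "H0 \<in> \<A>" "H0 \<notin> T" "h1 \<in> T" "h2 \<in> T" "h3 \<in> T"
    and distinct: "h1 \<noteq> h2" "h1 \<noteq> h3" "h2 \<noteq> h3"
    and dep: "\<And>v. \<alpha> H0 v = (\<Sum>H\<in>T. c H * \<alpha> H v)"
    and dual: "\<And>H. H \<in> T \<Longrightarrow> \<alpha> H e1 = (if H = h1 then 1 else 0)"
      "\<And>H. H \<in> T \<Longrightarrow> \<alpha> H e2 = (if H = h2 then 1 else 0)"
      "\<And>H. H \<in> T \<Longrightarrow> \<alpha> H e3 = (if H = h3 then 1 else 0)"
    and c: "c h1 \<noteq> 0" "c h2 \<noteq> 0" "c h3 \<noteq> 0"
    and \<mu>: "\<mu> \<in> Poly_Mapping.keys (\<Prod>H\<in>\<A> - insert H0 T. form_poly b (\<alpha> H) ^ m H)"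
    and large: "\<And>H. H \<in> insert H0 T \<Longrightarrow> monomial_degree \<mu> < m H"
  shows "\<not> free_multiarrangement b \<alpha> \<A> m"
proof
  assume free: "free_multiarrangement b \<alpha> \<A> m"
  define Q where "Q = (\<Prod>H\<in>\<A> - insert H0 T. form_poly b (\<alpha> H) ^ m H)"
  define X where "X h = form_poly b (\<alpha> h) ^ m h" for h
  \<comment> \<open>\<open>\<partial>\<^sub>e \<alpha>\<^sub>0 = c\<^sub>h\<close>, whence the inverse coefficient; the factor \<open>Q\<close> takes care of the hyperplanes
    outside the relation.\<close>
  define u where "u h e = der_scale (Q * X h * const_poly (inverse (c h))) (directional e)" for h e
  define g where "g H = (if H = H0 then Q else 0)" for H
  have finT: "finite T" using fin T(1) finite_subset by blast
  have hA: "h1 \<in> \<A>" "h2 \<in> \<A>" "h3 \<in> \<A>" using T by auto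
  have u: "form_poly b (\<alpha> H) ^ m H dvd u h e (form_poly b (\<alpha> H)) - X h * g H"
    if H: "H \<in> \<A>" and h: "h \<in> T" "c h \<noteq> 0"
      and e: "\<And>H. H \<in> T \<Longrightarrow> \<alpha> H e = (if H = h then 1 else 0)" for H h e
  proof -
    have u_eq: "u h e (form_poly b (\<alpha> H)) = Q * X h * const_poly (inverse (c h) * \<alpha> H e)"
      by (simp add: u_def der_scale_def directional(2)[OF lin[OF H]] const_poly_mult mult.assoc)
    consider "H = H0" | "H \<in> T" | "H \<in> \<A> - insert H0 T" using H by blast
    then show ?thesis
    proof cases
      case 1
      have "\<alpha> H0 e = (\<Sum>H\<in>T. if H = h then c h else 0)"
        unfolding dep by (intro sum.cong refl) (simp add: e)
      also have "\<dots> = c h" using finT h by simp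
      finally have "u h e (form_poly b (\<alpha> H)) = Q * X h" using h u_eq 1 by simp
      then show ?thesis by (simp add: 1 g_def mult.commute)
    next
      case 2
      then have "H \<noteq> H0" using T by blast
      then show ?thesis using 2 by (auto simp: u_eq g_def e X_def)
    next
      case 3
      then have "form_poly b (\<alpha> H) ^ m H dvd Q"
        unfolding Q_def using fin by (intro dvd_prodI) auto
      then show ?thesis using 3 by (auto simp: u_eq g_def intro: dvd_mult2)
    qed
  qed
  have lin123: "linear_form (\<alpha> h1)" "linear_form (\<alpha> h2)" "linear_form (\<alpha> h3)"
    using lin hA by auto
  have Suc: "\<exists>k. m h = Suc k" if "h \<in> T" for h
    using large[of h] that by (cases "m h") auto
  obtain k1 k2 where k: "m h1 = Suc k1" "m h2 = Suc k2" using Suc T by metis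
  have regular: "regular_triple (X h3) (X h1) (X h2)"
    unfolding X_def k using distinct T
    by (intro dual_forms_regular[OF lin123, of e1 e2 e3]) (simp_all add: dual)
  have X_nz: "X h \<noteq> 0" if "h \<in> T" for h
    unfolding X_def using that T nz[of h] form_poly_eq_0[OF lin[of h]]
    by (intro polys_power_nonzero) auto
  have cancel: "form_poly b (\<alpha> H) ^ m H dvd f"
    if H: "H \<in> \<A>" and dvd: "form_poly b (\<alpha> H) ^ m H dvd X h1 * f" "form_poly b (\<alpha> H) ^ m H dvd X h2 * f" for H f
  proof -
    obtain w where w: "\<alpha> H w \<noteq> 0" using nz[OF H] by blast
    \<comment> \<open>The forms at \<open>h1\<close> and \<open>h2\<close> are not proportional, so \<open>\<alpha>\<^sub>H\<close> is coprime to one of them.\<close>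
    have "\<not> (form_poly b (\<alpha> H) dvd form_poly b (\<alpha> h1) \<and> form_poly b (\<alpha> H) dvd form_poly b (\<alpha> h2))"
    proof
      assume *: "form_poly b (\<alpha> H) dvd form_poly b (\<alpha> h1) \<and> form_poly b (\<alpha> H) dvd form_poly b (\<alpha> h2)"
      then have 1: "\<alpha> H w * \<alpha> h1 v = \<alpha> h1 w * \<alpha> H v" and 2: "\<alpha> H w * \<alpha> h2 v = \<alpha> h2 w * \<alpha> H v" for v
        using form_dvd_form[OF lin[OF H] w] lin123 by auto
      have vals: "\<alpha> h1 e1 = 1" "\<alpha> h2 e1 = 0" "\<alpha> h2 e2 = 1"
        using T distinct by (simp_all add: dual)
      have "\<alpha> H e1 \<noteq> 0" using 1[of e1] w unfolding vals by auto
      then have "\<alpha> h2 w = 0" using 2[of e1] unfolding vals by auto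
      then show False using 2[of e2] w unfolding vals by auto
    qed
    then obtain h where "h \<in> {h1, h2}" "\<not> form_poly b (\<alpha> H) dvd form_poly b (\<alpha> h)" by blast
    then have "form_poly b (\<alpha> H) ^ m H dvd X h * f" "\<not> form_poly b (\<alpha> H) dvd X h"
      using dvd form_not_dvd_power[OF lin[OF H] w] unfolding X_def by auto
    then show ?thesis by (rule form_power_dvd_cancel[OF lin[OF H] w, rotated])
  qed
  have der: "u h e \<in> Derivations" for h e
    unfolding u_def by (intro derivation_scale directional)
  note u1 = u[OF _ T(4) c(1)] and u2 = u[OF _ T(5) c(2)] and u3 = u[OF _ T(6) c(3)]
  have cong1: "form_poly b (\<alpha> H) ^ m H dvd u h1 e1 (form_poly b (\<alpha> H)) - X h1 * g H" if "H \<in> \<A>" for H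
    by (rule u1[OF that]) (rule dual(1))
  have cong2: "form_poly b (\<alpha> H) ^ m H dvd u h2 e2 (form_poly b (\<alpha> H)) - X h2 * g H" if "H \<in> \<A>" for H
    by (rule u2[OF that]) (rule dual(2))
  have cong3: "form_poly b (\<alpha> H) ^ m H dvd u h3 e3 (form_poly b (\<alpha> H)) - X h3 * g H" if "H \<in> \<A>" for H
    by (rule u3[OF that]) (rule dual(3))
  have "\<exists>h\<in>Derivations. \<forall>H\<in>\<A>. form_poly b (\<alpha> H) ^ m H dvd h (form_poly b (\<alpha> H)) - g H"
    by (rule free_lifting[OF free regular X_nz[OF T(4)] X_nz[OF T(5)] der[of h1 e1] der[of h2 e2] der[of h3 e3],
        where g = g])
       (erule cong1, erule cong2, erule cong3, erule (2) cancel)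
  then obtain h where h: "h \<in> Derivations"
    "\<And>H. H \<in> \<A> \<Longrightarrow> form_poly b (\<alpha> H) ^ m H dvd h (form_poly b (\<alpha> H)) - g H" by auto
  let ?N = "Suc (monomial_degree \<mu>)"
  have "vanishes_to_order ?N (h (form_poly b (\<alpha> H)))" if H: "H \<in> T" for H
  proof -
    have "H \<in> \<A>" "H \<noteq> H0" using H T by auto
    then have "form_poly b (\<alpha> H) ^ m H dvd h (form_poly b (\<alpha> H))" using h(2)[of H] by (simp add: g_def)
    then show ?thesis using large[of H] H by (intro vanishes_to_order_form_power[of ?N "m H"]) auto
  qed
  then have "vanishes_to_order (0 + ?N) (const_poly (c H) * h (form_poly b (\<alpha> H)))" if "H \<in> T" for H
    using that by (intro vanishes_to_order_mult vanishes_to_order_0)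
  then have 1: "vanishes_to_order ?N (h (form_poly b (\<alpha> H0)))"
    unfolding derivation_form_sum[OF h(1) dep] by (intro vanishes_to_order_sum) simp
  have "form_poly b (\<alpha> H0) ^ m H0 dvd Q - h (form_poly b (\<alpha> H0))"
    using h(2)[OF T(2)] dvd_minus_iff[of "form_poly b (\<alpha> H0) ^ m H0" "h (form_poly b (\<alpha> H0)) - Q"]
    by (simp add: g_def)
  then have 2: "vanishes_to_order ?N (Q - h (form_poly b (\<alpha> H0)))"
    using large[of H0] by (intro vanishes_to_order_form_power[of ?N "m H0"]) auto
  have "vanishes_to_order ?N Q" using vanishes_to_order_add[OF 2 1] by simp
  then show False using \<mu> by (auto simp: vanishes_to_order_def Q_def)
qed


section \<open>Long dependencies and block bases\<close>

text \<open>A relation \<open>\<alpha>\<^sub>0 = \<Sum>\<^sub>T c\<^sub>H \<alpha>\<^sub>H\<close> in which three members of \<open>T\<close> have a nonzero coefficient and a vector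
  dual to them relative to \<open>T\<close>. When \<open>T\<close> is independent, \<open>\<alpha>\<^sub>0\<close> and the forms with a nonzero coefficient are
  a circuit of length at least four.\<close>

definition long_dependency ::
    "('h \<Rightarrow> 'v \<Rightarrow> 'k) \<Rightarrow> 'h set \<Rightarrow> 'h set \<Rightarrow> 'h \<Rightarrow> bool" where
  "long_dependency \<alpha> \<A> T H0 \<longleftrightarrow> T \<subseteq> \<A> \<and> H0 \<in> \<A> \<and> H0 \<notin> T \<and>
     (\<exists>c h e. (\<forall>v. \<alpha> H0 v = (\<Sum>H\<in>T. c H * \<alpha> H v)) \<and>
        inj_on h {..<3::nat} \<and>
        (\<forall>i<3. h i \<in> T \<and> c (h i) \<noteq> 0 \<and> (\<forall>H\<in>T. \<alpha> H (e i) = (if H = h i then 1 else 0))))"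

lemma long_dependencyI:
  assumes "T \<subseteq> \<A>" "H0 \<in> \<A>" "H0 \<notin> T" "\<And>v. \<alpha> H0 v = (\<Sum>H\<in>T. c H * \<alpha> H v)"
    "h1 \<noteq> h2" "h1 \<noteq> h3" "h2 \<noteq> h3" "h1 \<in> T" "h2 \<in> T" "h3 \<in> T"
    "c h1 \<noteq> 0" "c h2 \<noteq> 0" "c h3 \<noteq> 0"
    "\<And>H. H \<in> T \<Longrightarrow> \<alpha> H e1 = (if H = h1 then 1 else 0)"
    "\<And>H. H \<in> T \<Longrightarrow> \<alpha> H e2 = (if H = h2 then 1 else 0)"
    "\<And>H. H \<in> T \<Longrightarrow> \<alpha> H e3 = (if H = h3 then 1 else 0)"
  shows "long_dependency \<alpha> \<A> T H0"
proof -
  let ?h = "\<lambda>i::nat. if i = 0 then h1 else if i = 1 then h2 else h3"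
  let ?e = "\<lambda>i::nat. if i = 0 then e1 else if i = 1 then e2 else e3"
  have inj: "inj_on ?h {..<3}"
    by (rule inj_onI) (use assms(5-7) in \<open>auto split: if_splits\<close>)
  have indices: "?h i \<in> T \<and> c (?h i) \<noteq> 0 \<and> (\<forall>H\<in>T. \<alpha> H (?e i) = (if H = ?h i then 1 else 0))" for i
    by (cases "i = 0"; cases "i = 1") (simp_all add: assms(8-16))
  show ?thesis
    unfolding long_dependency_def
    by (intro conjI exI[of _ c] exI[of _ ?h] exI[of _ ?e] allI impI assms(1-4) inj indices)
qed

text \<open>The coordinate version of a decomposition into factors of dimension one and two: a basis \<open>E\<close> of the
  space, partitioned into blocks of size one or two, such that every hyperplane is defined by a form in the
  coordinates of a single block.\<close>

definition block_basis ::
    "('h \<Rightarrow> 'v \<Rightarrow> 'k) \<Rightarrow> 'h set \<Rightarrow> 'v set \<Rightarrow> 'v set set \<Rightarrow> bool" where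
  "block_basis \<alpha> \<A> E P \<longleftrightarrow> independent E \<and> span E = UNIV \<and> \<Union>P = E \<and>
     pairwise disjnt P \<and> (\<forall>B\<in>P. card B \<in> {1, 2}) \<and>
     (\<forall>H\<in>\<A>. \<exists>B\<in>P. \<forall>e\<in>E - B. \<alpha> H e = 0)"

text \<open>\<open>T\<close> is a maximal independent family of forms, described by a system of dual vectors. If some form were not
  the expected combination of \<open>T\<close>, it would not vanish on a vector \<open>w\<close> killed by \<open>T\<close>, and a multiple of \<open>w\<close>
  would extend the dual system.\<close>

lemma exists_dual_family:
  fixes \<alpha> :: "'h \<Rightarrow> 'v \<Rightarrow> 'k"
  assumes fin: "finite \<A>" and lin': "\<forall>H\<in>\<A>. linear_form (\<alpha> H)"
  shows "\<exists>T e. T \<subseteq> \<A> \<and> (\<forall>H\<in>T. \<forall>H'\<in>T. \<alpha> H (e H') = (if H = H' then 1 else 0)) \<and>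
    (\<forall>H\<in>\<A>. \<forall>v. \<alpha> H v = (\<Sum>H'\<in>T. \<alpha> H (e H') * \<alpha> H' v))"
proof -
  have lin: "\<And>H. H \<in> \<A> \<Longrightarrow> linear_form (\<alpha> H)" using lin' by blast
  define dual where "dual T e \<longleftrightarrow> T \<subseteq> \<A> \<and>
    (\<forall>H\<in>T. \<forall>H'\<in>T. \<alpha> H (e H') = (if H = H' then 1 else 0))" for T and e :: "'h \<Rightarrow> 'v"
  have 1: "\<exists>e. dual {} e" by (simp add: dual_def)
  have 2: "\<forall>T. (\<exists>e. dual T e) \<longrightarrow> card T < Suc (card \<A>)"
    using card_mono[OF fin] by (simp add: dual_def less_Suc_eq_le)
  obtain T where T: "(\<exists>e. dual T e) \<and> (\<forall>T'. (\<exists>e. dual T' e) \<longrightarrow> card T' \<le> card T)"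
    using ex_has_greatest_nat[of "\<lambda>T. \<exists>e. dual T e", OF 1 2] by (rule exE)
  then obtain e where dual_e: "dual T e" by (elim conjE exE)
  have e: "T \<subseteq> \<A>"
      "\<And>H H'. H \<in> T \<Longrightarrow> H' \<in> T \<Longrightarrow> \<alpha> H (e H') = (if H = H' then 1 else 0)"
    using dual_e by (simp_all add: dual_def)
  have finT: "finite T" using fin e(1) finite_subset by blast
  have linT: "\<And>H. H \<in> T \<Longrightarrow> linear_form (\<alpha> H)" using lin e(1) by blast
  have expand: "\<alpha> H v = (\<Sum>H'\<in>T. \<alpha> H (e H') * \<alpha> H' v)" if H: "H \<in> \<A>" for H v
  proof (rule ccontr)
    assume neq: "\<alpha> H v \<noteq> (\<Sum>H'\<in>T. \<alpha> H (e H') * \<alpha> H' v)"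
    define w where "w = v - (\<Sum>H'\<in>T. \<alpha> H' v *s e H')"
    have w_eq: "\<alpha> G w = \<alpha> G v - (\<Sum>H'\<in>T. \<alpha> G (e H') * \<alpha> H' v)" if "G \<in> \<A>" for G
      by (simp add: w_def linear_formD[OF lin[OF that]] mult.commute)
    have w_T: "\<alpha> G w = 0" if "G \<in> T" for G
    proof -
      have "(\<Sum>H'\<in>T. \<alpha> G (e H') * \<alpha> H' v) = (\<Sum>H'\<in>T. if G = H' then \<alpha> H' v else 0)"
        using e(2)[OF that] by (intro sum.cong) auto
      also have "\<dots> = \<alpha> G v" using finT that by simp
      finally show ?thesis using w_eq[of G] that e(1) by auto
    qed
    have w_H: "\<alpha> H w \<noteq> 0" using w_eq[OF H] neq by simp
    then have "H \<notin> T" using w_T by blast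
    define e0 where "e0 = inverse (\<alpha> H w) *s w"
    have e0: "\<alpha> H e0 = 1" "\<And>G. G \<in> T \<Longrightarrow> \<alpha> G e0 = 0"
      using w_H w_T linear_formD(2)[OF lin[OF H]] linear_formD(2)[OF linT] by (auto simp: e0_def)
    define e' where "e' G = (if G = H then e0 else e G - \<alpha> H (e G) *s e0)" for G
    have "dual (insert H T) e'"
      unfolding dual_def
    proof (intro conjI ballI)
      show "insert H T \<subseteq> \<A>" using H e(1) by blast
      fix G G' assume G: "G \<in> insert H T" "G' \<in> insert H T"
      then have "linear_form (\<alpha> G)" using linT lin[OF H] by blast
      note G_lin = linear_formD[OF this]
      have "\<alpha> G (e' G') = (if G' = H then \<alpha> G e0 else \<alpha> G (e G') - \<alpha> H (e G') * \<alpha> G e0)"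
        by (simp add: e'_def G_lin)
      moreover have "\<alpha> G e0 = (if G = H then 1 else 0)" using G e0 by auto
      moreover have "\<alpha> G (e G') = (if G = G' then 1 else 0)" if "G \<noteq> H" "G' \<noteq> H"
        using e(2)[of G G'] G that by simp
      ultimately show "\<alpha> G (e' G') = (if G = G' then 1 else 0)" by (cases "G = H"; cases "G' = H") simp_all
    qed
    then have "card (insert H T) \<le> card T" using T by blast
    then show False using finT \<open>H \<notin> T\<close> by simp
  qed
  show ?thesis
    by (intro exI[of _ T] exI[of _ e] conjI ballI allI e expand)
qed

text \<open>The dual vectors of \<open>T\<close> together with a basis of the common kernel \<open>K\<close> of \<open>T\<close> form a basis of the space. All
  forms vanish on \<open>K\<close>, so each basis vector of \<open>K\<close> becomes a block of its own.\<close>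

lemma block_basis_from_matching:
  fixes \<alpha> :: "'h \<Rightarrow> 'v \<Rightarrow> 'k"
  assumes fin: "finite \<A>" and lin: "\<And>H. H \<in> \<A> \<Longrightarrow> linear_form (\<alpha> H)"
    and T: "T \<subseteq> \<A>" "\<And>H H'. H \<in> T \<Longrightarrow> H' \<in> T \<Longrightarrow> \<alpha> H (e H') = (if H = H' then 1 else 0)"
    and expand: "\<And>H v. H \<in> \<A> \<Longrightarrow> \<alpha> H v = (\<Sum>H'\<in>T. \<alpha> H (e H') * \<alpha> H' v)"
    and Q: "\<Union>Q = T" "pairwise disjnt Q" "\<And>B. B \<in> Q \<Longrightarrow> card B \<in> {1, 2}"
    and supp: "\<And>H. H \<in> \<A> \<Longrightarrow> \<exists>B\<in>Q. \<forall>H'\<in>T - B. \<alpha> H (e H') = 0"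
  shows "\<exists>E P. block_basis \<alpha> \<A> E P"
proof -
  have finT: "finite T" using fin T(1) finite_subset by blast
  have linT: "\<And>H. H \<in> T \<Longrightarrow> linear_form (\<alpha> H)" using lin T(1) by blast
  have inj: "inj_on e T"
  proof (rule inj_onI)
    fix H H' assume "H \<in> T" "H' \<in> T" "e H = e H'"
    then show "H = H'" using T(2)[of H H'] T(2)[of H H] by (simp split: if_splits)
  qed
  define K where "K = {v. \<forall>H\<in>T. \<alpha> H v = 0}"
  have "subspace K"
    by (simp add: K_def subspace_def linear_formD[OF linT])
  obtain K0 where K0: "K0 \<subseteq> K" "independent K0" "K \<subseteq> span K0"
    by (rule basis_exists[of K])
  then have finK0: "finite K0" using finiteI_independent by blast
  have disj: "e ` T \<inter> K0 = {}" 
  proof -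
    have "e H \<notin> K0" if "H \<in> T" for H
      using K0(1) T(2)[OF that that] that by (auto simp: K_def)
    then show ?thesis by blast
  qed
  let ?E = "e ` T \<union> K0"
  have "independent ?E"
  proof (rule independent_if_scalars_zero)
    show "finite ?E" using finT finK0 by simp
    fix f x assume sum: "(\<Sum>x\<in>?E. f x *s x) = 0" and x: "x \<in> ?E"
    have split: "(\<Sum>H\<in>T. f (e H) *s e H) + (\<Sum>x\<in>K0. f x *s x) = 0"
      using sum sum.union_disjoint[OF finite_imageI[OF finT] finK0 disj, of "\<lambda>x. f x *s x"]
      by (simp add: sum.reindex[OF inj])
    have zero: "f (e H) = 0" if H: "H \<in> T" for H
    proof -
      note H_lin = linear_formD[OF linT[OF H]]
      have "\<alpha> H (\<Sum>x\<in>K0. f x *s x) = 0"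
        unfolding H_lin(5) by (rule sum.neutral) (use K0(1) H in \<open>auto simp: H_lin(2) K_def\<close>)
      moreover have "\<alpha> H (\<Sum>H'\<in>T. f (e H') *s e H') = (\<Sum>H'\<in>T. if H = H' then f (e H') else 0)"
        unfolding H_lin(5) by (rule sum.cong) (simp_all add: H_lin(2) T(2)[OF H])
      ultimately show ?thesis
        using arg_cong[OF split, of "\<alpha> H"] finT H by (simp add: H_lin(1,3))
    qed
    then have sum0: "(\<Sum>x\<in>K0. f x *s x) = 0" using split by simp
    have "f x = 0" if "x \<in> K0" by (rule independentD[OF K0(2) finK0 order.refl sum0 that])
    with zero x show "f x = 0" by auto
  qed
  moreover have "v \<in> span ?E" for v
  proof -
    let ?s = "\<Sum>H\<in>T. \<alpha> H v *s e H"
    have "v - ?s \<in> K"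
      unfolding K_def
    proof (intro CollectI ballI)
      fix H assume H: "H \<in> T"
      note H_lin = linear_formD[OF linT[OF H]]
      have "\<alpha> H ?s = (\<Sum>H'\<in>T. if H = H' then \<alpha> H' v else 0)"
        unfolding H_lin(5) by (rule sum.cong) (simp_all add: H_lin(2) T(2)[OF H])
      then show "\<alpha> H (v - ?s) = 0" using finT H by (simp add: H_lin(4))
    qed
    then have "v - ?s \<in> span ?E" using K0(3) span_mono[of K0 ?E] by blast
    moreover have "?s \<in> span ?E" by (intro span_sum span_scale span_base) blast
    ultimately show ?thesis using span_add[of "v - ?s" ?E ?s] by simp
  qed
  moreover define P where "P = (`) e ` Q \<union> (\<lambda>k. {k}) ` K0"
  have "\<Union>P = ?E" using Q(1) by (auto simp: P_def)
  moreover have "pairwise disjnt P"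
  proof (rule pairwiseI)
    have Q_T: "B \<subseteq> T" if "B \<in> Q" for B using that Q(1) by blast
    have P_cases: "(\<exists>B\<in>Q. X = e ` B) \<or> (\<exists>k\<in>K0. X = {k})" if "X \<in> P" for X
      using that by (auto simp: P_def)
    fix X Y assume XY: "X \<in> P" "Y \<in> P" "X \<noteq> Y"
    consider "\<exists>B\<in>Q. X = e ` B" "\<exists>B\<in>Q. Y = e ` B" | "\<exists>B\<in>Q. X = e ` B" "\<exists>k\<in>K0. Y = {k}"
      | "\<exists>k\<in>K0. X = {k}" "\<exists>B\<in>Q. Y = e ` B" | "\<exists>k\<in>K0. X = {k}" "\<exists>k\<in>K0. Y = {k}"
      using P_cases[OF XY(1)] P_cases[OF XY(2)] by argo
    then show "disjnt X Y"
    proof cases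
      case 1
      then obtain B C where BC: "B \<in> Q" "X = e ` B" "C \<in> Q" "Y = e ` C" by (elim bexE)
      then have "B \<noteq> C" using XY(3) by auto
      then have "B \<inter> C = {}" using pairwiseD[OF Q(2) BC(1,3)] by (simp add: disjnt_def)
      then show ?thesis
        using inj_on_image_Int[OF inj Q_T[OF BC(1)] Q_T[OF BC(3)]] BC(2,4) by (simp add: disjnt_def)
    next
      case 2
      then have "X \<subseteq> e ` T" "Y \<subseteq> K0" using Q_T by auto
      then show ?thesis using disj by (auto simp: disjnt_def)
    next
      case 3
      then have "X \<subseteq> K0" "Y \<subseteq> e ` T" using Q_T by auto
      then show ?thesis using disj by (auto simp: disjnt_def)
    next
      case 4
      then show ?thesis using XY(3) by (auto simp: disjnt_def)
    qed
  qed
  moreover have "\<forall>B\<in>P. card B \<in> {1, 2}"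
  proof
    fix X assume "X \<in> P"
    then consider B where "B \<in> Q" "X = e ` B" | k where "X = {k}" unfolding P_def by blast
    then show "card X \<in> {1, 2}"
    proof cases
      case 1
      then have "inj_on e B" using inj Q(1) by (auto intro: inj_on_subset)
      then show ?thesis using Q(3)[OF 1(1)] 1(2) by (simp add: card_image)
    qed simp
  qed
  moreover have "\<forall>H\<in>\<A>. \<exists>B\<in>P. \<forall>x\<in>?E - B. \<alpha> H x = 0"
  proof
    fix H assume H: "H \<in> \<A>"
    obtain B where B: "B \<in> Q" "\<forall>H'\<in>T - B. \<alpha> H (e H') = 0" using supp[OF H] by blast
    have "\<alpha> H x = 0" if "x \<in> K0" for x
      using that K0(1) expand[OF H, of x] by (auto simp: K_def intro!: sum.neutral)
    then have "\<forall>x\<in>?E - e ` B. \<alpha> H x = 0" using B(2) by blast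
    then show "\<exists>B\<in>P. \<forall>x\<in>?E - B. \<alpha> H x = 0" using B(1) by (auto simp: P_def)
  qed
  ultimately have "block_basis \<alpha> \<A> ?E P" unfolding block_basis_def by blast
  then show ?thesis by blast
qed


lemma doubleton_other: "card A = 2 \<Longrightarrow> q \<in> A \<Longrightarrow> \<exists>p. A = {p, q} \<and> p \<noteq> q"
  unfolding card_2_iff by (elim exE conjE) (metis insert_commute insertE singletonD)

text \<open>Expand every form in a maximal independent family \<open>T\<close>. A support with three or more elements is a long dependency. So is
  a pair of overlapping supports \<open>{p, q}\<close> and \<open>{q, r}\<close>, after exchanging \<open>q\<close> for the form with support \<open>{p, q}\<close>.
  Otherwise the supports of size two are pairwise equal or disjoint, and they are the blocks of size two.\<close>

theorem block_basis_or_long_dependency: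
  fixes \<alpha> :: "'h \<Rightarrow> 'v \<Rightarrow> 'k"
  assumes fin: "finite \<A>" and lin: "\<And>H. H \<in> \<A> \<Longrightarrow> linear_form (\<alpha> H)"
    and nz: "\<And>H. H \<in> \<A> \<Longrightarrow> \<exists>v. \<alpha> H v \<noteq> 0"
    and no_dep: "\<And>T H0. \<not> long_dependency \<alpha> \<A> T H0"
  shows "\<exists>E P. block_basis \<alpha> \<A> E P"
proof -
  have "\<forall>H\<in>\<A>. linear_form (\<alpha> H)" using lin by blast
  from exists_dual_family[OF fin this] obtain T e where T: "T \<subseteq> \<A>"
    and dual': "\<forall>H\<in>T. \<forall>H'\<in>T. \<alpha> H (e H') = (if H = H' then 1 else 0)"
    and expand': "\<forall>H\<in>\<A>. \<forall>v. \<alpha> H v = (\<Sum>H'\<in>T. \<alpha> H (e H') * \<alpha> H' v)"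
    by (elim exE conjE)
  have dual: "\<And>H H'. H \<in> T \<Longrightarrow> H' \<in> T \<Longrightarrow> \<alpha> H (e H') = (if H = H' then 1 else 0)"
    by (rule dual'[rule_format])
  have expand: "\<And>H v. H \<in> \<A> \<Longrightarrow> \<alpha> H v = (\<Sum>H'\<in>T. \<alpha> H (e H') * \<alpha> H' v)"
    by (rule expand'[rule_format])
  have finT: "finite T" using fin T finite_subset by blast
  have linT: "\<And>H. H \<in> T \<Longrightarrow> linear_form (\<alpha> H)" using lin T by blast
  define supp where "supp H = {H'\<in>T. \<alpha> H (e H') \<noteq> 0}" for H
  have supp_T: "supp H = {H}" if "H \<in> T" for H 
    using that by (auto simp: supp_def dual split: if_splits)
  have supp_sub: "supp H \<subseteq> T" "finite (supp H)" for H using finT by (auto simp: supp_def)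
  have expand_supp: "\<alpha> H v = (\<Sum>H'\<in>supp H. \<alpha> H (e H') * \<alpha> H' v)" if "H \<in> \<A>" for H v
    unfolding expand[OF that, of v] supp_def using finT by (intro sum.mono_neutral_right) auto
  have supp_ne: "supp H \<noteq> {}" if "H \<in> \<A>" for H
    using nz[OF that] expand_supp[OF that] by force
  have supp_card: "card (supp H) \<le> 2" if H: "H \<in> \<A>" for H
  proof (rule ccontr)
    assume "\<not> card (supp H) \<le> 2"
    then have "3 \<le> card (supp H)" by simp
    then obtain S where S: "S \<subseteq> supp H" "card S = 3" by (rule obtain_subset_with_card_n)
    then obtain p q r where "S = {p, q, r}" and ne: "p \<noteq> q" "p \<noteq> r" "q \<noteq> r"
      by (auto simp: card_3_iff)
    then have pqr: "p \<noteq> q" "p \<noteq> r" "q \<noteq> r" "p \<in> supp H" "q \<in> supp H" "r \<in> supp H"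
      using S(1) by auto
    have "H \<notin> T" using supp_T[of H] pqr by auto
    have "long_dependency \<alpha> \<A> T H"
      by (rule long_dependencyI[OF T H \<open>H \<notin> T\<close> expand[OF H] pqr(1,2,3), where ?e1.0 = "e p" and ?e2.0 = "e q" and ?e3.0 = "e r"])
         (use pqr in \<open>simp_all add: supp_def dual\<close>)
    with no_dep show False by blast
  qed
  have matching: "supp H = supp H'"
    if H: "H \<in> \<A>" "H' \<in> \<A>" "card (supp H) = 2" "card (supp H') = 2" "supp H \<inter> supp H' \<noteq> {}" for H H'
  proof (rule ccontr)
    assume neq: "supp H \<noteq> supp H'"
    obtain q where q: "q \<in> supp H" "q \<in> supp H'" using H(5) by blast
    obtain p where p: "supp H = {p, q}" "p \<noteq> q"
      using doubleton_other[OF H(3) q(1)] by (elim exE conjE)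
    obtain r where "supp H' = {r, q}" "r \<noteq> q"
      using doubleton_other[OF H(4) q(2)] by (elim exE conjE)
    then have r: "supp H' = {q, r}" "q \<noteq> r" by (simp_all add: insert_commute)
    have "p \<noteq> r" using p r neq by auto
    have in_T: "p \<in> T" "q \<in> T" "r \<in> T" using p r supp_sub by auto
    then have dual_pqr: "\<alpha> p (e p) = 1" "\<alpha> p (e q) = 0" "\<alpha> p (e r) = 0"
        "\<alpha> q (e p) = 0" "\<alpha> q (e q) = 1" "\<alpha> q (e r) = 0"
        "\<alpha> r (e p) = 0" "\<alpha> r (e q) = 0" "\<alpha> r (e r) = 1"
      using p(2) r(2) \<open>p \<noteq> r\<close> by (simp_all add: dual in_T)
    define a b' c d where "a = \<alpha> H (e p)" and "b' = \<alpha> H (e q)" and "c = \<alpha> H' (e q)" and "d = \<alpha> H' (e r)"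
    have nz: "a \<noteq> 0" "b' \<noteq> 0" "c \<noteq> 0" "d \<noteq> 0"
      using p(1) r(1) by (auto simp: supp_def a_def b'_def c_def d_def)
    have \<alpha>H: "\<alpha> H v = a * \<alpha> p v + b' * \<alpha> q v" for v
      using expand_supp[OF H(1), of v] p by (simp add: a_def b'_def)
    have \<alpha>H': "\<alpha> H' v = c * \<alpha> q v + d * \<alpha> r v" for v
      using expand_supp[OF H(2), of v] r by (simp add: c_def d_def)
    have distinct: "H \<noteq> p" "H \<noteq> r" "H' \<noteq> p" "H' \<noteq> r" "H \<noteq> H'"
      using supp_T[OF in_T(1)] supp_T[OF in_T(3)] p r neq by auto
    note lins = linear_formD[OF linT[OF in_T(1)]] linear_formD[OF linT[OF in_T(3)]] linear_formD[OF linT[OF in_T(2)]]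
    \<comment> \<open>Solving \<open>\<alpha>\<^sub>H = a \<alpha>\<^sub>p + b' \<alpha>\<^sub>q\<close> for \<open>\<alpha>\<^sub>q\<close> and substituting into \<open>\<alpha>\<^sub>H\<^sub>' = c \<alpha>\<^sub>q + d \<alpha>\<^sub>r\<close> gives the coefficients;
      the dual vectors are changed accordingly.\<close>
    have "long_dependency \<alpha> \<A> {p, H, r} H'"
    proof (rule long_dependencyI)
      let ?c = "\<lambda>X. if X = p then - (c * a / b') else if X = H then c / b' else d"
      show "{p, H, r} \<subseteq> \<A>" "H' \<in> \<A>" "H' \<notin> {p, H, r}" using in_T T H distinct by auto
      show "\<alpha> H' v = (\<Sum>X\<in>{p, H, r}. ?c X * \<alpha> X v)" for v
        using distinct \<open>p \<noteq> r\<close> nz by (simp add: \<alpha>H \<alpha>H' field_simps)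
      show "?c p \<noteq> 0" "?c H \<noteq> 0" "?c r \<noteq> 0" using nz distinct \<open>p \<noteq> r\<close> by auto
      show "\<alpha> X (e p - (a / b') *s e q) = (if X = p then 1 else 0)" if "X \<in> {p, H, r}" for X
        using that distinct \<open>p \<noteq> r\<close> nz by (auto simp: \<alpha>H lins dual_pqr)
      show "\<alpha> X (inverse b' *s e q) = (if X = H then 1 else 0)" if "X \<in> {p, H, r}" for X
        using that distinct \<open>p \<noteq> r\<close> nz by (auto simp: \<alpha>H lins dual_pqr)
      show "\<alpha> X (e r) = (if X = r then 1 else 0)" if "X \<in> {p, H, r}" for X
        using that distinct \<open>p \<noteq> r\<close> nz by (auto simp: \<alpha>H lins dual_pqr)
    qed (use distinct \<open>p \<noteq> r\<close> in auto)
    with no_dep show False by blast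
  qed
  define Q2 where "Q2 = {supp H | H. H \<in> \<A> \<and> card (supp H) = 2}"
  define Q where "Q = Q2 \<union> {{t} | t. t \<in> T - \<Union>Q2}"
  show ?thesis
  proof (rule block_basis_from_matching[OF fin lin T dual expand])
    have "\<Union>Q2 \<subseteq> T" using supp_sub(1) by (auto simp: Q2_def)
    moreover have "\<Union>Q = \<Union>Q2 \<union> (T - \<Union>Q2)" by (auto simp: Q_def)
    ultimately show "\<Union>Q = T" by blast
    show "pairwise disjnt Q"
    proof (rule pairwiseI)
      fix X Y assume XY: "X \<in> Q" "Y \<in> Q" "X \<noteq> Y"
      show "disjnt X Y"
      proof (cases "X \<in> Q2 \<and> Y \<in> Q2")
        case True
        then show ?thesis using matching XY(3) by (auto simp: Q2_def disjnt_def)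
      next
        case False
        then show ?thesis using XY by (auto simp: Q_def disjnt_def)
      qed
    qed
    show "card B \<in> {1, 2}" if "B \<in> Q" for B using that by (auto simp: Q_def Q2_def)
    show "\<exists>B\<in>Q. \<forall>H'\<in>T - B. \<alpha> H (e H') = 0" if H: "H \<in> \<A>" for H
    proof -
      have "card (supp H) \<noteq> 0" using supp_ne[OF H] supp_sub(2) by simp
      then consider "card (supp H) = 2" | "card (supp H) = 1" using supp_card[OF H] by linarith
      then have "\<exists>B\<in>Q. supp H \<subseteq> B"
      proof cases
        case 1
        then show ?thesis using H by (auto simp: Q_def Q2_def)
      next
        case 2
        then obtain t where "supp H = {t}" by (auto simp: card_1_singleton_iff)
        moreover have "t \<in> T" using calculation supp_sub(1)[of H] by auto
        ultimately show ?thesis by (cases "t \<in> \<Union>Q2") (auto simp: Q_def)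
      qed
      then show ?thesis by (auto simp: supp_def)
    qed
  qed
qed

end

section \<open>Block bases make every multiplicity free\<close>

subsection \<open>Bases of modules of derivations\<close>

text \<open>A basis of a module of derivations, as an indexed family and with all identities stated pointwise.\<close>

definition derivation_basis ::
    "'e set \<Rightarrow> (('n, 'k::field) polys \<Rightarrow> ('n, 'k) polys) set \<Rightarrow>
      ('e \<Rightarrow> ('n, 'k) polys \<Rightarrow> ('n, 'k) polys) \<Rightarrow> bool" where
  "derivation_basis E D \<Theta> \<longleftrightarrow> (\<forall>e\<in>E. \<Theta> e \<in> D) \<and>
     (\<forall>\<theta>\<in>D. \<exists>c. \<forall>f. \<theta> f = (\<Sum>e\<in>E. c e * \<Theta> e f)) \<and>
     (\<forall>c. (\<forall>f. (\<Sum>e\<in>E. c e * \<Theta> e f) = 0) \<longrightarrow> (\<forall>e\<in>E. c e = 0))"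

lemma derivation_basisD:
  assumes "derivation_basis E D \<Theta>"
  shows "e \<in> E \<Longrightarrow> \<Theta> e \<in> D"
    and "\<theta> \<in> D \<Longrightarrow> \<exists>c. \<forall>f. \<theta> f = (\<Sum>e\<in>E. c e * \<Theta> e f)"
    and "\<forall>f. (\<Sum>e\<in>E. c e * \<Theta> e f) = 0 \<Longrightarrow> e \<in> E \<Longrightarrow> c e = 0"
proof -
  note * = assms[unfolded derivation_basis_def]
  show "e \<in> E \<Longrightarrow> \<Theta> e \<in> D" using *[THEN conjunct1] by (rule bspec)
  show "\<theta> \<in> D \<Longrightarrow> \<exists>c. \<forall>f. \<theta> f = (\<Sum>e\<in>E. c e * \<Theta> e f)"
    using *[THEN conjunct2, THEN conjunct1] by (rule bspec)
  assume "\<forall>f. (\<Sum>e\<in>E. c e * \<Theta> e f) = 0" "e \<in> E"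
  then show "c e = 0"
    using *[THEN conjunct2, THEN conjunct2, THEN spec, of c] by (elim impE bspec)
qed

lemma derivation_basis_imp_free:
  fixes \<Theta> :: "'e \<Rightarrow> ('n::finite, 'k::field) polys \<Rightarrow> ('n, 'k) polys"
  assumes "finite E" "derivation_basis E D \<Theta>" "der.subspace D"
  shows "free_submodule D"
proof -
  note in_D = derivation_basisD(1)[OF assms(2)] and gen = derivation_basisD(2)[OF assms(2)]
    and indep = derivation_basisD(3)[OF assms(2)]
  have inj: "inj_on \<Theta> E"
  proof (rule inj_onI, rule ccontr)
    fix e e' assume e: "e \<in> E" "e' \<in> E" "\<Theta> e = \<Theta> e'" "e \<noteq> e'"
    define c where "c x = (if x = e then 1 else if x = e' then -1 else 0 :: ('n, 'k) polys)" for x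
    have "(\<Sum>x\<in>E. c x * \<Theta> x f) = 0" for f
    proof -
      have "(\<Sum>x\<in>E. c x * \<Theta> x f) = (\<Sum>x\<in>E. (if x = e then \<Theta> x f else 0) - (if x = e' then \<Theta> x f else 0))"
        by (rule sum.cong[OF refl]) (simp add: c_def e(4))
      also have "\<dots> = \<Theta> e f - \<Theta> e' f"
        by (simp only: sum_subtractf sum.delta[OF assms(1)] e(1,2) if_True)
      also have "\<dots> = 0" unfolding e(3) by simp
      finally show ?thesis .
    qed
    then have "\<forall>f. (\<Sum>x\<in>E. c x * \<Theta> x f) = 0" ..
    from indep[OF this e(1)] have "c e = 0" .
    then show False by (simp add: c_def)
  qed
  have lincomb: "(\<Sum>\<theta>\<in>\<Theta> ` E. der_scale (u \<theta>) \<theta>) f = (\<Sum>e\<in>E. u (\<Theta> e) * \<Theta> e f)" for u f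
    by (simp only: sum.reindex[OF inj] o_def lincomb_apply)
  have "\<not> der.dependent (\<Theta> ` E)"
  proof
    assume "der.dependent (\<Theta> ` E)"
    then obtain u e where u: "e \<in> E" "u (\<Theta> e) \<noteq> 0" "(\<Sum>\<theta>\<in>\<Theta> ` E. der_scale (u \<theta>) \<theta>) = 0"
      unfolding der.dependent_finite[OF finite_imageI[OF assms(1)]] by auto
    have "\<forall>f. (\<Sum>e\<in>E. u (\<Theta> e) * \<Theta> e f) = 0"
      unfolding lincomb[symmetric] u(3) by simp
    from indep[OF this u(1)] u(2) show False by simp
  qed
  moreover have "der.span (\<Theta> ` E) = D"
  proof
    show "der.span (\<Theta> ` E) \<subseteq> D" using in_D assms(3) by (intro der.span_minimal) auto
    show "D \<subseteq> der.span (\<Theta> ` E)"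
    proof
      fix \<theta> assume "\<theta> \<in> D"
      from gen[OF this] obtain c where c: "\<forall>f. \<theta> f = (\<Sum>e\<in>E. c e * \<Theta> e f)" ..
      have "\<theta> = (\<Sum>e\<in>E. der_scale (c e) (\<Theta> e))"
        by (rule ext) (simp only: c[THEN spec] lincomb_apply)
      also have "\<dots> \<in> der.span (\<Theta> ` E)"
        by (intro der.span_sum der.span_scale der.span_base imageI)
      finally show "\<theta> \<in> der.span (\<Theta> ` E)" .
    qed
  qed
  ultimately show ?thesis unfolding free_submodule_def by blast
qed

text \<open>An elementary base change. The elements of \<open>D'\<close> are elements of \<open>D\<close> whose value at \<open>f\<close> is divisible by one more
  power of the prime \<open>a\<close>. If the pivot \<open>g k\<close> generates all \<open>g e\<close> modulo \<open>a\<close>, subtracting multiples of \<open>\<Theta> k\<close>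
  makes the values of the other basis elements divisible by this power. In a combination lying in \<open>D'\<close> the coefficient of the pivot is
  then divisible by \<open>a\<close>, so it suffices to replace \<open>\<Theta> k\<close> by \<open>a \<Theta> k\<close>.\<close>

lemma derivation_basis_pivot:
  fixes \<Theta> :: "'e \<Rightarrow> ('n::finite, 'k::field) polys \<Rightarrow> ('n, 'k) polys"
  assumes fin: "finite E" and k: "k \<in> E" and basis: "derivation_basis E D \<Theta>"
    and a: "a \<noteq> 0" "\<And>p q. a dvd p * q \<Longrightarrow> a dvd p \<or> a dvd q"
    and g: "\<And>e. e \<in> E \<Longrightarrow> \<Theta> e f = a ^ N * g e" "\<not> a dvd g k"
    and r: "\<And>e. e \<in> E \<Longrightarrow> e \<noteq> k \<Longrightarrow> g e = r e * g k + a * s e"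
    and D': "D' \<subseteq> D" "\<And>\<theta>. \<theta> \<in> D' \<Longrightarrow> a ^ Suc N dvd \<theta> f"
    and \<Theta>': "\<And>e. e \<in> E \<Longrightarrow> \<Theta>' e \<in> D'" "\<And>h. \<Theta>' k h = a * \<Theta> k h"
      "\<And>e h. e \<in> E \<Longrightarrow> e \<noteq> k \<Longrightarrow> \<Theta>' e h = \<Theta> e h - r e * \<Theta> k h"
  shows "derivation_basis E D' \<Theta>'"
proof -
  let ?E = "E - {k}"
  have split: "(\<Sum>e\<in>E. F e) = F k + (\<Sum>e\<in>?E. F e)" for F :: "'e \<Rightarrow> ('n, 'k) polys"
    using fin k by (simp add: sum.remove)
  have lincomb': "(\<Sum>e\<in>E. c e * \<Theta>' e h) = (\<Sum>e\<in>?E. c e * \<Theta> e h) + (a * c k - (\<Sum>e\<in>?E. c e * r e)) * \<Theta> k h"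
    for c h
  proof -
    have "(\<Sum>e\<in>?E. c e * \<Theta>' e h) = (\<Sum>e\<in>?E. c e * \<Theta> e h) - (\<Sum>e\<in>?E. c e * r e) * \<Theta> k h"
      unfolding sum_distrib_right sum_subtractf[symmetric]
      by (rule sum.cong) (simp_all add: \<Theta>'(3) algebra_simps)
    then show ?thesis by (simp add: split \<Theta>'(2) algebra_simps)
  qed
  have gen: "\<exists>c. \<forall>h. \<theta> h = (\<Sum>e\<in>E. c e * \<Theta>' e h)" if \<theta>: "\<theta> \<in> D'" for \<theta>
  proof -
    obtain c where "\<forall>h. \<theta> h = (\<Sum>e\<in>E. c e * \<Theta> e h)"
      using derivation_basisD(2)[OF basis subsetD[OF D'(1) \<theta>]] ..
    note c = this[THEN spec]
    let ?q = "c k + (\<Sum>e\<in>?E. c e * r e)"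
    have "\<theta> f = a ^ N * (\<Sum>e\<in>E. c e * g e)"
      unfolding c sum_distrib_left by (rule sum.cong) (simp_all add: g(1) mult_ac)
    moreover obtain w where "\<theta> f = a ^ Suc N * w" using D'(2)[OF \<theta>] by blast
    ultimately have "a ^ N * (\<Sum>e\<in>E. c e * g e) = a ^ N * (a * w)" by (simp add: mult_ac)
    then have w: "(\<Sum>e\<in>E. c e * g e) = a * w" by (rule polys_cancel[OF polys_power_nonzero[OF a(1)]])
    have "(\<Sum>e\<in>?E. c e * g e) = (\<Sum>e\<in>?E. c e * r e * g k + a * (c e * s e))"
      by (rule sum.cong) (simp_all add: r algebra_simps)
    then have "(\<Sum>e\<in>E. c e * g e) = ?q * g k + a * (\<Sum>e\<in>?E. c e * s e)"
      by (simp add: split sum.distrib sum_distrib_left sum_distrib_right algebra_simps)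
    then have "?q * g k = a * (w - (\<Sum>e\<in>?E. c e * s e))" unfolding w by (simp add: algebra_simps)
    then have "a dvd ?q * g k" by simp
    then obtain c' where c': "?q = a * c'" using a(2) g(2) by blast
    define c2 where "c2 = c(k := c')"
    have "(\<Sum>e\<in>?E. c2 e * \<Theta> e h) = (\<Sum>e\<in>?E. c e * \<Theta> e h)" "(\<Sum>e\<in>?E. c2 e * r e) = (\<Sum>e\<in>?E. c e * r e)" for h
      by (auto simp: c2_def intro!: sum.cong)
    then have "(\<Sum>e\<in>E. c2 e * \<Theta>' e h) = (\<Sum>e\<in>?E. c e * \<Theta> e h) + (?q - (\<Sum>e\<in>?E. c e * r e)) * \<Theta> k h" for h
      unfolding lincomb' c' by (simp add: c2_def)
    then have "\<theta> h = (\<Sum>e\<in>E. c2 e * \<Theta>' e h)" for h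
      by (simp add: c split)
    then show ?thesis by blast
  qed
  have indep: "\<forall>e\<in>E. c e = 0" if zero: "\<forall>h. (\<Sum>e\<in>E. c e * \<Theta>' e h) = 0" for c
  proof -
    define c2 where "c2 = c(k := a * c k - (\<Sum>e\<in>?E. c e * r e))"
    have "(\<Sum>e\<in>?E. c2 e * \<Theta> e h) = (\<Sum>e\<in>?E. c e * \<Theta> e h)" for h
      by (auto simp: c2_def intro!: sum.cong)
    then have "(\<Sum>e\<in>E. c2 e * \<Theta> e h) = (\<Sum>e\<in>E. c e * \<Theta>' e h)" for h
      unfolding lincomb' by (simp add: split c2_def)
    then have "\<forall>h. (\<Sum>e\<in>E. c2 e * \<Theta> e h) = 0" using zero by simp
    from derivation_basisD(3)[OF basis this] have c2: "\<forall>e\<in>E. c2 e = 0" ..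
    have others: "c e = 0" if "e \<in> ?E" for e
      using c2[THEN bspec, of e] that by (simp add: c2_def)
    then have "(\<Sum>e\<in>?E. c e * r e) = 0" by (intro sum.neutral) simp
    then have "a * c k = 0" using c2[THEN bspec, OF k] by (simp add: c2_def)
    then have "c k = 0" using polys_no_zero_divisors[OF a(1)] by blast
    then show ?thesis using others by auto
  qed
  show ?thesis
    unfolding derivation_basis_def
  proof (intro conjI ballI allI impI \<Theta>'(1) gen)
    fix c e assume "\<forall>f. (\<Sum>e\<in>E. c e * \<Theta>' e f) = 0" "e \<in> E"
    from indep[OF this(1)] this(2) show "c e = 0" by (rule bspec)
  qed
qed

subsection \<open>Homogeneous polynomials in one block of variables\<close>

text \<open>Homogeneous polynomials of degree \<open>d\<close> in the elements of \<open>G\<close>. The degree is an integer because dividing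
  by \<open>\<alpha>\<^sup>m\<close> lowers it by \<open>m\<close>; in negative degree only \<open>0\<close> is homogeneous.\<close>

inductive homogeneous_in :: "('n::finite, 'k::field) polys set \<Rightarrow> int \<Rightarrow> ('n, 'k) polys \<Rightarrow> bool"
  for G where
  zero: "homogeneous_in G d 0"
| const: "homogeneous_in G 0 (const_poly c)"
| add: "homogeneous_in G d p \<Longrightarrow> homogeneous_in G d q \<Longrightarrow> homogeneous_in G d (p + q)"
| mult: "x \<in> G \<Longrightarrow> homogeneous_in G d p \<Longrightarrow> homogeneous_in G (d + 1) (x * p)"

lemma homogeneous_in_const_mult: "homogeneous_in G d p \<Longrightarrow> homogeneous_in G d (const_poly c * p)"
proof (induction rule: homogeneous_in.induct)
  case (zero d)
  then show ?case by (simp add: homogeneous_in.zero)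
next
  case (const c')
  then show ?case using homogeneous_in.const[of G "c * c'"] by (simp add: const_poly_mult)
next
  case (add d p q)
  then show ?case using homogeneous_in.add[OF add.IH] by (simp add: distrib_left)
next
  case (mult x d p)
  then show ?case using homogeneous_in.mult[OF mult.hyps(1) mult.IH] by (simp add: mult_ac)
qed

lemma homogeneous_in_mult:
  "homogeneous_in G d p \<Longrightarrow> homogeneous_in G d' q \<Longrightarrow> homogeneous_in G (d + d') (p * q)"
proof (induction rule: homogeneous_in.induct)
  case (zero d)
  then show ?case by (simp add: homogeneous_in.zero)
next
  case (const c)
  then show ?case using homogeneous_in_const_mult by simp
next
  case (add d p r)
  then show ?case using homogeneous_in.add[OF add.IH] by (simp add: distrib_right)
next
  case (mult x d p)
  then show ?case using homogeneous_in.mult[OF mult.hyps(1) mult.IH] by (simp add: mult_ac add_ac)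
qed

lemma homogeneous_in_diff:
  assumes "homogeneous_in G d p" "homogeneous_in G d q" shows "homogeneous_in G d (p - q)"
  using homogeneous_in.add[OF assms(1) homogeneous_in_const_mult[OF assms(2), of "-1"]]
  by (simp add: const_poly_uminus)

lemma homogeneous_in_generator: "x \<in> G \<Longrightarrow> homogeneous_in G 1 x"
  using homogeneous_in.mult[OF _ homogeneous_in.const[of G 1], of x] by simp

lemma homogeneous_in_power: "homogeneous_in G 1 x \<Longrightarrow> homogeneous_in G (int k) (x ^ k)"
proof (induction k)
  case 0
  then show ?case using homogeneous_in.const[of G 1] by simp
next
  case (Suc k)
  then show ?case using homogeneous_in_mult[OF Suc.prems Suc.IH] by simp
qed

lemma homogeneous_in_sum:
  "(\<And>x. x \<in> A \<Longrightarrow> homogeneous_in G d (f x)) \<Longrightarrow> homogeneous_in G d (sum f A)"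
  by (induction A rule: infinite_finite_induct) (auto intro: homogeneous_in.zero homogeneous_in.add)

text \<open>Modulo a linear form \<open>a x + c y\<close> with \<open>a \<noteq> 0\<close>, the binary forms of degree \<open>d\<close> are multiples of
  \<open>y\<^sup>d\<close>. For a block with a single variable \<open>x\<close>, take \<open>y = 0\<close>.\<close>

lemma homogeneous_in_modulo_form:
  fixes x y :: "('n::finite, 'k::field) polys"
  assumes l: "l = const_poly a * x + const_poly c * y" "a \<noteq> 0" and G: "G \<subseteq> {x, y}" "x \<in> G" "y \<in> G \<or> y = 0"
    and hom: "homogeneous_in G d p"
  shows "\<exists>k q. p = const_poly k * y ^ nat d + l * q \<and> homogeneous_in G (d - 1) q \<and> (d < 0 \<longrightarrow> k = 0)"
  using hom
proof (induction rule: homogeneous_in.induct)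
  case (zero d)
  show ?case by (intro exI[of _ 0]) (simp add: homogeneous_in.zero)
next
  case (const e)
  show ?case by (intro exI[of _ e] exI[of _ 0]) (simp add: homogeneous_in.zero)
next
  case (add d p q)
  from add.IH(1) obtain k1 q1 where 1: "p = const_poly k1 * y ^ nat d + l * q1" "homogeneous_in G (d - 1) q1"
    "d < 0 \<longrightarrow> k1 = 0" by (elim exE conjE)
  from add.IH(2) obtain k2 q2 where 2: "q = const_poly k2 * y ^ nat d + l * q2" "homogeneous_in G (d - 1) q2"
    "d < 0 \<longrightarrow> k2 = 0" by (elim exE conjE)
  have "p + q = const_poly (k1 + k2) * y ^ nat d + l * (q1 + q2)"
    by (simp add: 1(1) 2(1) const_poly_add algebra_simps)
  then show ?case using homogeneous_in.add[OF 1(2) 2(2)] 1(3) 2(3)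
    by (intro exI[of _ "k1 + k2"] exI[of _ "q1 + q2"]) auto
next
  case (mult z d p)
  from mult.IH obtain k q where p: "p = const_poly k * y ^ nat d + l * q" and q: "homogeneous_in G (d - 1) q"
    and k: "d < 0 \<longrightarrow> k = 0" by (elim exE conjE)
  have q': "homogeneous_in G d (z * q)" using homogeneous_in.mult[OF mult.hyps(1) q] by simp
  have y_pow: "const_poly k' * y ^ nat (d + 1) = const_poly k' * y * y ^ nat d" if "k = 0 \<longrightarrow> k' = 0" for k'
  proof (cases "d < 0")
    case True
    then show ?thesis using k that by simp
  next
    case False
    then have "nat (d + 1) = Suc (nat d)" by simp
    then show ?thesis by (simp add: mult_ac)
  qed
  show ?case
  proof (cases "z = y")
    case True
    have "z * p = const_poly k * y * y ^ nat d + l * (z * q)"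
      by (simp add: p True algebra_simps)
    also have "const_poly k * y * y ^ nat d = const_poly k * y ^ nat (d + 1)"
      by (rule y_pow[symmetric]) simp
    finally show ?thesis using q' k by (intro exI[of _ k] exI[of _ "z * q"]) simp
  next
    case False
    then have "z = x" using mult.hyps(1) G(1) by blast
    have "const_poly (inverse a) * l = (const_poly a * const_poly (inverse a)) * x + const_poly (inverse a * c) * y"
      by (simp add: l(1) const_poly_mult algebra_simps)
    then have "const_poly (inverse a) * l = x + const_poly (inverse a * c) * y"
      unfolding const_poly_inverse[OF l(2)] by simp
    then have x: "x = const_poly (inverse a) * l - const_poly (inverse a * c) * y" by simp
    have y_hom: "homogeneous_in G d (const_poly (inverse a * k) * y ^ nat d)"
    proof (cases "d < 0")
      case True
      then show ?thesis using k by (simp add: homogeneous_in.zero)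
    next
      case False
      have "homogeneous_in G 1 y" using G(3) homogeneous_in_generator homogeneous_in.zero by blast
      from homogeneous_in_power[OF this, of "nat d"] False show ?thesis
        by (intro homogeneous_in_const_mult) simp
    qed
    have "x * p = x * (const_poly k * y ^ nat d) + l * (x * q)" by (simp add: p algebra_simps)
    also have "x * (const_poly k * y ^ nat d) =
        l * (const_poly (inverse a * k) * y ^ nat d) + const_poly (- (inverse a * c * k)) * y * y ^ nat d"
      by (subst x) (simp add: const_poly_mult const_poly_uminus algebra_simps)
    also have "const_poly (- (inverse a * c * k)) * y * y ^ nat d = const_poly (- (inverse a * c * k)) * y ^ nat (d + 1)"
      by (rule y_pow[symmetric]) simp
    finally have "z * p = const_poly (- (inverse a * c * k)) * y ^ nat (d + 1)
        + l * (const_poly (inverse a * k) * y ^ nat d + x * q)"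
      by (simp add: \<open>z = x\<close> algebra_simps)
    moreover have "homogeneous_in G d (const_poly (inverse a * k) * y ^ nat d + x * q)"
      using y_hom q' unfolding \<open>z = x\<close> by (rule homogeneous_in.add)
    ultimately show ?thesis
      using k by (intro exI[of _ "- (inverse a * c * k)"] exI[of _ "const_poly (inverse a * k) * y ^ nat d + x * q"]) simp
  qed
qed

context coordinatized_space
begin

lemma form_not_dvd_1: "\<not> form_poly b a dvd (1 :: ('n, 'k) polys)"
proof
  assume "form_poly b a dvd (1 :: ('n, 'k) polys)"
  then have "vanishes_to_order 1 (1 :: ('n, 'k) polys)"
    using vanishes_to_order_form_power[of 1 1] by simp
  then show False by (simp add: vanishes_to_order_def monomial_degree_def)
qed

lemma form_not_dvd_const: "c \<noteq> 0 \<Longrightarrow> \<not> form_poly b a dvd (const_poly c :: ('n, 'k) polys)"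
  using form_not_dvd_1[of a] const_poly_inverse[of c] by (metis dvd_mult2)

definition coordinate_form :: "'v set \<Rightarrow> 'v \<Rightarrow> 'v \<Rightarrow> 'k" where
  "coordinate_form E e v = representation E v e"

definition coordinate :: "'v set \<Rightarrow> 'v \<Rightarrow> ('n, 'k) polys" where
  "coordinate E e = form_poly b (coordinate_form E e)"

lemma coordinate_form:
  assumes "independent E" "span E = UNIV"
  shows "linear_form (coordinate_form E e)"
    and "e \<in> E \<Longrightarrow> e' \<in> E \<Longrightarrow> coordinate_form E e e' = (if e = e' then 1 else 0)"
    and "linear_form a \<Longrightarrow> a v = (\<Sum>e\<in>E. a e * coordinate_form E e v)"
proof -
  show "linear_form (coordinate_form E e)"
    using assms by (intro linear_formI) (simp_all add: coordinate_form_def representation_add representation_scale)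
  show "coordinate_form E e e' = (if e = e' then 1 else 0)" if "e \<in> E" "e' \<in> E"
    using representation_basis[OF assms(1) that(2)] by (simp add: coordinate_form_def)
  assume a: "linear_form a"
  have "v = (\<Sum>e\<in>E. representation E v e *s e)"
    using assms finiteI_independent[OF assms(1)] by (intro sum_representation_eq[symmetric]) auto
  then have "a v = a (\<Sum>e\<in>E. representation E v e *s e)" by simp
  then show "a v = (\<Sum>e\<in>E. a e * coordinate_form E e v)"
    by (simp add: linear_formD[OF a] coordinate_form_def mult.commute)
qed

lemma form_poly_in_block:
  assumes E: "independent E" "span E = UNIV" and B: "B \<subseteq> E" "\<And>e. e \<in> E - B \<Longrightarrow> a e = 0"
    and a: "linear_form a"
  shows "form_poly b a = (\<Sum>e\<in>B. const_poly (a e) * coordinate E e)"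
proof -
  have "a = (\<lambda>v. \<Sum>e\<in>E. a e * coordinate_form E e v)"
    by (rule ext) (rule coordinate_form(3)[OF E a])
  then have "form_poly b a = form_poly b (\<lambda>v. \<Sum>e\<in>E. a e * coordinate_form E e v)"
    by (rule arg_cong)
  also have "\<dots> = (\<Sum>e\<in>E. const_poly (a e) * coordinate E e)"
    by (simp only: form_poly_sum coordinate_def)
  also have "\<dots> = (\<Sum>e\<in>B. const_poly (a e) * coordinate E e)"
    using B finiteI_independent[OF E(1)] by (intro sum.mono_neutral_right) auto
  finally show ?thesis .
qed

lemma form_homogeneous_in_block:
  assumes E: "independent E" "span E = UNIV" and B: "B \<subseteq> E" "\<And>e. e \<in> E - B \<Longrightarrow> a e = 0"
    and a: "linear_form a"
  shows "homogeneous_in (coordinate E ` B) 1 (form_poly b a)"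
proof -
  have "homogeneous_in (coordinate E ` B) 1 (\<Sum>e\<in>B. const_poly (a e) * coordinate E e)"
    by (intro homogeneous_in_sum homogeneous_in_const_mult homogeneous_in_generator imageI)
  moreover have "form_poly b a = (\<Sum>e\<in>B. const_poly (a e) * coordinate E e)"
    by (rule form_poly_in_block[OF E B a])
  ultimately show ?thesis by simp
qed

text \<open>Modulo the form of a hyperplane, the homogeneous polynomials of degree \<open>d\<close> in the coordinates of its block are
  the multiples of a single power \<open>t\<^sup>d\<close>. In a block of size two, \<open>t\<close> is a coordinate not divisible by the form; in
  a block of size one, where the form is a multiple of the only coordinate, \<open>t\<close> is zero and only constants (\<open>0\<^sup>0 = 1\<close>)
  survive.\<close>

lemma homogeneous_in_block_modulo_form:
  assumes E: "independent E" "span E = UNIV" and B: "B \<subseteq> E" "card B \<in> {1, 2}"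
    and a: "linear_form a" "\<forall>e\<in>E - B. a e = 0" "a v \<noteq> 0"
  shows "\<exists>t. homogeneous_in (coordinate E ` B) 1 t \<and>
    (\<forall>d p. homogeneous_in (coordinate E ` B) d p \<longrightarrow>
      (\<exists>k q. p = const_poly k * t ^ nat d + form_poly b a * q \<and> homogeneous_in (coordinate E ` B) (d - 1) q \<and>
         (d < 0 \<longrightarrow> k = 0) \<and> (form_poly b a dvd p \<longrightarrow> p = form_poly b a * q)))"
proof -
  let ?G = "coordinate E ` B" and ?l = "form_poly b a"
  have "\<exists>e\<in>B. a e \<noteq> 0"
  proof (rule ccontr)
    assume "\<not> (\<exists>e\<in>B. a e \<noteq> 0)"
    then have "\<forall>e\<in>E. a e = 0" using a(2) by blast
    then have "a v = 0" unfolding coordinate_form(3)[OF E a(1), of v] by (intro sum.neutral) simp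
    then show False using a(3) by simp
  qed
  then obtain e where e: "e \<in> B" "a e \<noteq> 0" by blast
  have l_eq: "?l = (\<Sum>e\<in>B. const_poly (a e) * coordinate E e)"
    using a(2) by (intro form_poly_in_block[OF E B(1) _ a(1)]) blast
  obtain y c where y: "?l = const_poly (a e) * coordinate E e + const_poly c * y"
    "?G \<subseteq> {coordinate E e, y}" "y \<in> ?G \<or> y = 0" "y = 0 \<or> \<not> ?l dvd y"
  proof (cases "card B = 1")
    case True
    then have "B = {e}" using e(1) by (auto simp: card_1_singleton_iff)
    then show thesis by (intro that[of 0 0]) (simp_all add: l_eq)
  next
    case False
    then have "card B = 2" using B(2) by simp
    then obtain e' where e': "B = {e, e'}" "e' \<noteq> e"
      unfolding card_2_iff using e(1) by (metis insert_commute insertE singletonD)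
    have in_E: "e \<in> E" "e' \<in> E" using e' B(1) by auto
    have "\<not> ?l dvd coordinate E e'"
    proof
      assume "?l dvd coordinate E e'"
      then have "a e * coordinate_form E e' e' = coordinate_form E e' e * a e'"
        unfolding coordinate_def by (rule form_dvd_form[OF a(1) e(2) coordinate_form(1)[OF E]])
      then show False using e(2) e'(2) coordinate_form(2)[OF E] in_E by simp
    qed
    then show thesis
      by (intro that[of "a e'" "coordinate E e'"]) (use e' in \<open>simp_all add: l_eq\<close>)
  qed
  have t: "homogeneous_in ?G 1 y"
    using y(3) homogeneous_in_generator homogeneous_in.zero by blast
  have "\<exists>k q. p = const_poly k * y ^ nat d + ?l * q \<and> homogeneous_in ?G (d - 1) q \<and>
         (d < 0 \<longrightarrow> k = 0) \<and> (?l dvd p \<longrightarrow> p = ?l * q)" if hom: "homogeneous_in ?G d p" for d p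
  proof -
    obtain k q where kq: "p = const_poly k * y ^ nat d + ?l * q" "homogeneous_in ?G (d - 1) q" "d < 0 \<longrightarrow> k = 0"
      using homogeneous_in_modulo_form[OF y(1) e(2) y(2) imageI[OF e(1)] y(3) hom] by (elim exE conjE)
    have "p = ?l * q" if "?l dvd p"
    proof -
      have "?l dvd p - ?l * q" using that by (simp add: dvd_diff)
      then have "?l dvd const_poly k * y ^ nat d" by (simp add: kq(1))
      then have dvd: "?l dvd const_poly k \<or> ?l dvd y ^ nat d" by (rule form_prime[OF a(1,3)])
      have "const_poly k * y ^ nat d = 0"
      proof (cases "k = 0")
        case False
        then have "?l dvd y ^ nat d" using dvd form_not_dvd_const by blast
        then have "y = 0" using y(4) form_not_dvd_power[OF a(1,3)] by blast
        moreover have "nat d \<noteq> 0" using \<open>?l dvd y ^ nat d\<close> form_not_dvd_1[of a] by (intro notI) simp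
        ultimately show ?thesis by (simp add: power_0_left)
      qed simp
      then show ?thesis using kq(1) by simp
    qed
    then show ?thesis using kq by (intro exI[of _ k] exI[of _ q]) simp
  qed
  then show ?thesis using t by (intro exI[of _ y]) simp
qed

lemma log_derivations_subspace: "der.subspace (log_derivations b \<alpha> \<A> m)"
proof (rule der.subspaceI)
  show "0 \<in> log_derivations b \<alpha> \<A> m" by (simp add: log_derivations_def derivation_zero)
next
  fix \<theta> \<eta> assume "\<theta> \<in> log_derivations b \<alpha> \<A> m" "\<eta> \<in> log_derivations b \<alpha> \<A> m"
  then show "\<theta> + \<eta> \<in> log_derivations b \<alpha> \<A> m"
    unfolding log_derivations_def by (auto intro: derivation_add)
next
  fix c \<theta> assume "\<theta> \<in> log_derivations b \<alpha> \<A> m"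
  then show "der_scale c \<theta> \<in> log_derivations b \<alpha> \<A> m"
    unfolding log_derivations_def by (auto simp: derivation_scale der_scale_apply)
qed

text \<open>A basis of the logarithmic derivations indexed by the basis \<open>E\<close> of the space, such that each member kills the forms
  of the other blocks and is homogeneous on its own block: its value at \<open>\<alpha>\<^sub>H\<close> is \<open>\<alpha>\<^sub>H\<^sup>m\<close> times a polynomial of degree
  \<open>d - m\<close> in the coordinates of the block.\<close>

definition adapted_basis where
  "adapted_basis \<alpha> \<A> E P m \<Theta> d \<longleftrightarrow> derivation_basis E (log_derivations b \<alpha> \<A> m) \<Theta> \<and>
     (\<forall>B\<in>P. \<forall>H\<in>\<A>. (\<forall>e\<in>E - B. \<alpha> H e = 0) \<longrightarrow>
        (\<forall>e\<in>E - B. \<Theta> e (form_poly b (\<alpha> H)) = 0) \<and>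
        (\<forall>e\<in>B. \<exists>g. \<Theta> e (form_poly b (\<alpha> H)) = form_poly b (\<alpha> H) ^ m H * g \<and>
           homogeneous_in (coordinate E ` B) (d e - int (m H)) g))"

text \<open>For the multiplicity zero all derivations are logarithmic, and the partial derivatives form a basis.\<close>

lemma adapted_basis_directional:
  assumes E: "independent E" "span E = UNIV" and P: "\<Union>P = E"
    and lin: "\<And>H. H \<in> \<A> \<Longrightarrow> linear_form (\<alpha> H)" and m: "\<And>H. H \<in> \<A> \<Longrightarrow> m H = 0"
  shows "adapted_basis \<alpha> \<A> E P m directional (\<lambda>_. 0)"
proof -
  have D: "log_derivations b \<alpha> \<A> m = Derivations"
    by (auto simp: log_derivations_def m)
  have finE: "finite E" using finiteI_independent E(1) by blast
  have "\<exists>c. \<forall>f. \<theta> f = (\<Sum>e\<in>E. c e * directional e f)" if \<theta>: "\<theta> \<in> Derivations" for \<theta>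
  proof -
    let ?\<eta> = "\<Sum>e\<in>E. der_scale (\<theta> (coordinate E e)) (directional e)"
    have \<eta>: "?\<eta> \<in> Derivations" by (intro derivation_lincomb directional)
    have "\<theta> (var_poly i) = ?\<eta> (var_poly i)" for i
    proof -
      have i: "linear_form (\<lambda>v. representation (range b) v (b i))"
        using independent_Basis span_Basis
        by (intro linear_formI) (simp_all add: representation_add representation_scale)
      have "representation (range b) (b j) (b i) = (if j = i then 1 else 0)" for j
        using representation_basis[OF independent_Basis, of "b j"] inj_b by (auto simp: inj_eq)
      then have var: "var_poly i = form_poly b (\<lambda>v. representation (range b) v (b i))"
        by (simp add: form_poly_def if_distrib[of const_poly] if_distrib[of "\<lambda>x. x * _"] cong: if_cong)
      have "\<theta> (var_poly i) = (\<Sum>e\<in>E. const_poly (representation (range b) e (b i)) * \<theta> (coordinate E e))"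
        unfolding var coordinate_def by (rule derivation_form_sum[OF \<theta> coordinate_form(3)[OF E i]])
      also have "\<dots> = ?\<eta> (var_poly i)"
        unfolding lincomb_apply var by (intro sum.cong refl) (simp add: directional(2)[OF i] mult.commute)
      finally show ?thesis .
    qed
    then have eq: "\<theta> = ?\<eta>" by (rule derivation_eqI[OF \<theta> \<eta>])
    have "\<forall>f. \<theta> f = (\<Sum>e\<in>E. \<theta> (coordinate E e) * directional e f)"
      by (intro allI trans[OF fun_cong[OF eq]] lincomb_apply)
    then show ?thesis by (rule exI[of _ "\<lambda>e. \<theta> (coordinate E e)"])
  qed
  moreover have "\<forall>e\<in>E. c e = 0" if zero: "\<forall>f. (\<Sum>e\<in>E. c e * directional e f) = 0" for c
  proof
    fix e assume e: "e \<in> E"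
    have "0 = (\<Sum>e'\<in>E. c e' * directional e' (coordinate E e))" using zero by simp
    also have "\<dots> = (\<Sum>e'\<in>E. if e' = e then c e' else 0)"
      by (intro sum.cong refl)
        (simp add: coordinate_def directional(2)[OF coordinate_form(1)[OF E]] coordinate_form(2)[OF E] e)
    also have "\<dots> = c e" using e finE by simp
    finally show "c e = 0" by simp
  qed
  ultimately have "derivation_basis E Derivations directional"
    unfolding derivation_basis_def by (intro conjI ballI allI impI directional(1)) auto
  moreover have "directional e (form_poly b (\<alpha> H)) = const_poly (\<alpha> H e)" if "H \<in> \<A>" for e H
    by (rule directional(2)[OF lin[OF that]])
  ultimately show ?thesis
    unfolding adapted_basis_def D by (auto simp: m intro: homogeneous_in.const)
qed


lemma adapted_basisD:
  assumes "adapted_basis \<alpha> \<A> E P m \<Theta> d"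
  shows "derivation_basis E (log_derivations b \<alpha> \<A> m) \<Theta>"
    and "B \<in> P \<Longrightarrow> H \<in> \<A> \<Longrightarrow> \<forall>e\<in>E - B. \<alpha> H e = 0 \<Longrightarrow> e \<in> E - B \<Longrightarrow> \<Theta> e (form_poly b (\<alpha> H)) = 0"
    and "B \<in> P \<Longrightarrow> H \<in> \<A> \<Longrightarrow> \<forall>e\<in>E - B. \<alpha> H e = 0 \<Longrightarrow> e \<in> B \<Longrightarrow>
      \<exists>g. \<Theta> e (form_poly b (\<alpha> H)) = form_poly b (\<alpha> H) ^ m H * g \<and>
           homogeneous_in (coordinate E ` B) (d e - int (m H)) g"
  using assms unfolding adapted_basis_def by (elim conjE; simp)+

lemma log_derivations_Suc:
  assumes "H0 \<in> \<A>"
  shows "\<theta> \<in> log_derivations b \<alpha> \<A> (m(H0 := Suc (m H0))) \<longleftrightarrow>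
    \<theta> \<in> log_derivations b \<alpha> \<A> m \<and> form_poly b (\<alpha> H0) ^ Suc (m H0) dvd \<theta> (form_poly b (\<alpha> H0))"
proof -
  have "form_poly b (\<alpha> H0) ^ m H0 dvd p" if "form_poly b (\<alpha> H0) ^ Suc (m H0) dvd p" for p
    using that by (rule power_le_dvd) simp
  then show ?thesis using assms by (auto simp: log_derivations_def)
qed

text \<open>Raising the multiplicity of \<open>H0\<close> by one. Only the members \<open>\<Theta> e\<close> with \<open>e\<close> in the block of \<open>H0\<close> are affected. Their
  cofactors \<open>g e\<close> are multiples of powers of a single \<open>t\<close> modulo \<open>\<alpha>\<close>. Among those not divisible by \<open>\<alpha>\<close>
  one of least degree is a pivot, since it divides the others modulo \<open>\<alpha>\<close>; the correcting coefficients \<open>r e\<close> are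
  homogeneous, so the new basis is adapted as well.\<close>

lemma adapted_basis_Suc:
  assumes block: "block_basis \<alpha> \<A> E P"
    and lin: "\<And>H. H \<in> \<A> \<Longrightarrow> linear_form (\<alpha> H)"
    and nz: "\<And>H. H \<in> \<A> \<Longrightarrow> \<exists>v. \<alpha> H v \<noteq> 0"
    and H0: "H0 \<in> \<A>" and basis: "adapted_basis \<alpha> \<A> E P m \<Theta> d"
  shows "\<exists>\<Theta>' d'. adapted_basis \<alpha> \<A> E P (m(H0 := Suc (m H0))) \<Theta>' d'"
proof -
  let ?m = "m(H0 := Suc (m H0))" and ?l = "form_poly b (\<alpha> H0)"
  have E: "independent E" "span E = UNIV" and P: "\<Union>P = E" "pairwise disjnt P" "\<And>B. B \<in> P \<Longrightarrow> card B \<in> {1, 2}"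
    using block by (simp_all add: block_basis_def)
  have finE: "finite E" using finiteI_independent E(1) by blast
  obtain B where B: "B \<in> P" and supp: "\<forall>e\<in>E - B. \<alpha> H0 e = 0"
    using block H0 unfolding block_basis_def by blast
  have BE: "B \<subseteq> E" using B P(1) by blast
  have finB: "finite B" using BE finE finite_subset by blast
  obtain v where v: "\<alpha> H0 v \<noteq> 0" using nz[OF H0] by blast
  have l: "linear_form (\<alpha> H0)" "?l \<noteq> 0"
    using lin[OF H0] form_poly_eq_0[OF lin[OF H0], of v] v by auto
  have only_B: "B' = B" if "B' \<in> P" "\<forall>e\<in>E - B'. \<alpha> H0 e = 0" for B'
  proof (rule ccontr)
    assume "B' \<noteq> B"
    then have "B' \<inter> B = {}" using pairwiseD[OF P(2) that(1) B] by (simp add: disjnt_def)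
    then have "\<forall>e\<in>E. \<alpha> H0 e = 0" using that(2) supp by blast
    then have "\<alpha> H0 v = 0" unfolding coordinate_form(3)[OF E l(1), of v] by (intro sum.neutral) simp
    then show False using v by simp
  qed
  let ?G = "coordinate E ` B"
  have dbasis: "derivation_basis E (log_derivations b \<alpha> \<A> m) \<Theta>"
    by (rule adapted_basisD(1)[OF basis])
  have "\<forall>e\<in>B. \<exists>g. \<Theta> e ?l = ?l ^ m H0 * g \<and> homogeneous_in ?G (d e - int (m H0)) g"
    using adapted_basisD(3)[OF basis B H0 supp] by (rule ballI)
  from bchoice[OF this] obtain g0 where g0: "\<forall>e\<in>B. \<Theta> e ?l = ?l ^ m H0 * g0 e \<and> homogeneous_in ?G (d e - int (m H0)) (g0 e)" ..
  define g where "g e = (if e \<in> B then g0 e else 0)" for e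
  have g: "\<Theta> e ?l = ?l ^ m H0 * g e" if "e \<in> E" for e
    using g0 adapted_basisD(2)[OF basis B H0 supp, of e] that by (simp add: g_def)
  have g_hom: "homogeneous_in ?G (d e - int (m H0)) (g e)" if "e \<in> B" for e
    using g0 that by (simp add: g_def)
  from homogeneous_in_block_modulo_form[OF E BE P(3)[OF B] l(1) supp v] obtain t where
    t: "homogeneous_in ?G 1 t" and mod_l: "\<forall>n p. homogeneous_in ?G n p \<longrightarrow>
      (\<exists>k q. p = const_poly k * t ^ nat n + ?l * q \<and> homogeneous_in ?G (n - 1) q \<and>
         (n < 0 \<longrightarrow> k = 0) \<and> (?l dvd p \<longrightarrow> p = ?l * q))" by (elim exE conjE)
  have "\<forall>e\<in>B. \<exists>kq. g e = const_poly (fst kq) * t ^ nat (d e - int (m H0)) + ?l * snd kq \<and>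
      homogeneous_in ?G (d e - int (m H0) - 1) (snd kq) \<and> (d e - int (m H0) < 0 \<longrightarrow> fst kq = 0) \<and>
      (?l dvd g e \<longrightarrow> g e = ?l * snd kq)"
  proof
    fix e assume "e \<in> B"
    from mod_l[rule_format, OF g_hom[OF this]] obtain k q where
      "g e = const_poly k * t ^ nat (d e - int (m H0)) + ?l * q \<and> homogeneous_in ?G (d e - int (m H0) - 1) q \<and>
         (d e - int (m H0) < 0 \<longrightarrow> k = 0) \<and> (?l dvd g e \<longrightarrow> g e = ?l * q)" by (elim exE)
    then show "\<exists>kq. g e = const_poly (fst kq) * t ^ nat (d e - int (m H0)) + ?l * snd kq \<and>
      homogeneous_in ?G (d e - int (m H0) - 1) (snd kq) \<and> (d e - int (m H0) < 0 \<longrightarrow> fst kq = 0) \<and>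
      (?l dvd g e \<longrightarrow> g e = ?l * snd kq)" by (intro exI[of _ "(k, q)"], unfold fst_conv snd_conv)
  qed
  from bchoice[OF this] obtain kq where kq: "\<forall>e\<in>B. g e = const_poly (fst (kq e)) * t ^ nat (d e - int (m H0)) + ?l * snd (kq e) \<and>
      homogeneous_in ?G (d e - int (m H0) - 1) (snd (kq e)) \<and> (d e - int (m H0) < 0 \<longrightarrow> fst (kq e) = 0) \<and>
      (?l dvd g e \<longrightarrow> g e = ?l * snd (kq e))" ..
  define \<kappa> q where "\<kappa> e = fst (kq e)" and "q e = snd (kq e)" for e
  note kq' = kq[folded \<kappa>_def q_def, rule_format]
  have g_eq: "g e = const_poly (\<kappa> e) * t ^ nat (d e - int (m H0)) + ?l * q e" if "e \<in> B" for e
    using kq'[OF that] by (elim conjE)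
  have q_hom: "homogeneous_in ?G (d e - int (m H0) - 1) (q e)" if "e \<in> B" for e
    using kq'[OF that] by (elim conjE)
  have neg: "d e - int (m H0) < 0 \<longrightarrow> \<kappa> e = 0" if "e \<in> B" for e
    using kq'[OF that] by (elim conjE)
  have g_dvd: "?l dvd g e \<longrightarrow> g e = ?l * q e" if "e \<in> B" for e
    using kq'[OF that] by (elim conjE)
  show ?thesis
  \<comment> \<open>Without a pivot, every logarithmic derivation already satisfies the stronger condition.\<close>
  proof (cases "\<forall>e\<in>B. ?l dvd g e")
    case True
    have "log_derivations b \<alpha> \<A> ?m = log_derivations b \<alpha> \<A> m"
    proof (intro set_eqI iffI)
      fix \<theta> assume \<theta>: "\<theta> \<in> log_derivations b \<alpha> \<A> m"
      obtain c where c: "\<forall>f. \<theta> f = (\<Sum>e\<in>E. c e * \<Theta> e f)" using derivation_basisD(2)[OF dbasis \<theta>] ..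
      have "?l ^ Suc (m H0) dvd \<Theta> e ?l" if e: "e \<in> E" for e
      proof -
        have "?l dvd g e" using True by (cases "e \<in> B") (simp_all add: g_def)
        then have "?l ^ m H0 * ?l dvd ?l ^ m H0 * g e" by (rule mult_dvd_mono[OF dvd_refl])
        then show ?thesis by (simp only: g[OF e] power_Suc2)
      qed
      then have "?l ^ Suc (m H0) dvd \<theta> ?l"
        unfolding c[THEN spec, of ?l] by (intro dvd_sum dvd_mult)
      then show "\<theta> \<in> log_derivations b \<alpha> \<A> ?m" unfolding log_derivations_Suc[OF H0] using \<theta> by simp
    qed (simp only: log_derivations_Suc[OF H0])
    then have "derivation_basis E (log_derivations b \<alpha> \<A> ?m) \<Theta>" using dbasis by simp
    moreover have "\<exists>g. \<Theta> e (form_poly b (\<alpha> H)) = form_poly b (\<alpha> H) ^ ?m H * g \<and>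
           homogeneous_in (coordinate E ` B') (d e - int (?m H)) g"
      if B': "B' \<in> P" "H \<in> \<A>" "\<forall>e\<in>E - B'. \<alpha> H e = 0" "e \<in> B'" for B' H e
    proof (cases "H = H0")
      case [simp]: True
      have [simp]: "B' = B" using only_B B' by simp
      have e: "e \<in> B" "e \<in> E" using B'(4) BE by auto
      have "\<Theta> e ?l = ?l ^ m H0 * (?l * q e)"
        using g_dvd[OF e(1)] \<open>\<forall>e\<in>B. ?l dvd g e\<close> e(1) g[OF e(2)] by simp
      then have "\<Theta> e ?l = ?l ^ Suc (m H0) * q e" by (simp add: mult_ac)
      moreover have "homogeneous_in ?G (d e - int (Suc (m H0))) (q e)"
        using q_hom[OF e(1)] by (simp add: algebra_simps)
      ultimately show ?thesis by (intro exI[of _ "q e"]) simp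
    next
      case False
      then show ?thesis using adapted_basisD(3)[OF basis B'] by simp
    qed
    ultimately have "adapted_basis \<alpha> \<A> E P ?m \<Theta> d"
      unfolding adapted_basis_def using adapted_basisD(2)[OF basis]
      by (intro conjI ballI impI) auto
    then show ?thesis by blast
  next
    case False
    let ?N = "{e \<in> B. \<not> ?l dvd g e}"
    have fin_N: "finite (d ` ?N)" and "d ` ?N \<noteq> {}" using finB False by auto
    from Min_in[OF this] obtain k where Min_k: "Min (d ` ?N) = d k" and "k \<in> ?N" by (rule imageE)
    then have k: "k \<in> B" "\<not> ?l dvd g k" by auto
    have k_min: "d k \<le> d e" if "e \<in> B" "\<not> ?l dvd g e" for e
      unfolding Min_k[symmetric] by (rule Min_le[OF fin_N]) (use that in blast)
    have kE: "k \<in> E" using k BE by blast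
    have \<kappa>: "\<kappa> e \<noteq> 0" if "e \<in> B" "\<not> ?l dvd g e" for e
      using g_eq[OF that(1)] that(2) by auto
    have d_ge: "int (m H0) \<le> d e" if "e \<in> B" "\<not> ?l dvd g e" for e
      using \<kappa>[OF that] neg[OF that(1)] by force
    define r where "r e = (if e \<in> B \<and> \<not> ?l dvd g e then const_poly (\<kappa> e / \<kappa> k) * t ^ nat (d e - d k) else 0)" for e
    define s where "s e = (if e \<in> B then q e - r e * q k else 0)" for e
    have r_out: "r e = 0" if "e \<notin> B" for e using that by (simp add: r_def)
    have r_hom: "homogeneous_in ?G (d e - d k) (r e)" for e
    proof (cases "e \<in> B \<and> \<not> ?l dvd g e")
      case True
      then have "homogeneous_in ?G (int (nat (d e - d k))) (const_poly (\<kappa> e / \<kappa> k) * t ^ nat (d e - d k))"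
        by (intro homogeneous_in_const_mult homogeneous_in_power t)
      then show ?thesis using True k_min[of e] by (simp add: r_def)
    next
      case False
      then have "r e = 0" by (simp only: r_def if_False)
      then show ?thesis by (simp add: homogeneous_in.zero)
    qed
    have rs: "g e = r e * g k + ?l * s e" if "e \<in> E" for e
    proof (cases "e \<in> B \<and> \<not> ?l dvd g e")
      case True
      then have e: "e \<in> B" "\<not> ?l dvd g e" by auto
      have "nat (d e - int (m H0)) = nat (d e - d k) + nat (d k - int (m H0))"
        using k_min[OF e] d_ge[OF k] by simp
      moreover have "const_poly (\<kappa> e) = const_poly (\<kappa> e / \<kappa> k) * (const_poly (\<kappa> k) :: ('n, 'k) polys)"
        using \<kappa>[OF k] by (simp flip: const_poly_mult)
      ultimately have "const_poly (\<kappa> e) * t ^ nat (d e - int (m H0)) = r e * (const_poly (\<kappa> k) * t ^ nat (d k - int (m H0)))"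
        using e by (simp add: r_def power_add mult_ac)
      then show ?thesis
        unfolding g_eq[OF e(1)] g_eq[OF k(1)] by (simp add: s_def e(1) algebra_simps)
    next
      case False
      then show ?thesis
        using g_dvd[of e] by (auto simp: r_def s_def g_def)
    qed
    have s_hom: "homogeneous_in ?G (d e - int (m H0) - 1) (s e)" if "e \<in> B" for e
    proof -
      have "homogeneous_in ?G ((d e - d k) + (d k - int (m H0) - 1)) (r e * q k)"
        by (rule homogeneous_in_mult[OF r_hom q_hom[OF k(1)]])
      then have "homogeneous_in ?G (d e - int (m H0) - 1) (r e * q k)" by (simp add: algebra_simps)
      then show ?thesis using homogeneous_in_diff[OF q_hom[OF that]] that by (simp add: s_def)
    qed
    define \<Theta>' where "\<Theta>' e = (if e = k then der_scale ?l (\<Theta> k) else \<Theta> e - der_scale (r e) (\<Theta> k))" for e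
    \<comment> \<open>Multiplying the pivot by the linear form raises its degree; the other degrees do not change.\<close>
    define d' where "d' = d(k := d k + 1)"
    have \<Theta>'_k: "\<Theta>' k h = ?l * \<Theta> k h" for h by (simp add: \<Theta>'_def der_scale_def)
    have \<Theta>'_e: "\<Theta>' e h = \<Theta> e h - r e * \<Theta> k h" if "e \<noteq> k" for e h
      using that by (simp add: \<Theta>'_def der_scale_def)
    have \<Theta>'_l: "\<Theta>' e ?l = ?l ^ Suc (m H0) * (if e = k then g k else s e)" if "e \<in> E" for e
    proof (cases "e = k")
      case True
      then show ?thesis by (simp add: \<Theta>'_k g[OF kE] mult_ac)
    next
      case False
      have "\<Theta>' e ?l = ?l ^ m H0 * (g e - r e * g k)"
        by (simp add: \<Theta>'_e[OF False] g[OF that] g[OF kE] algebra_simps)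
      also have "g e - r e * g k = ?l * s e" using rs[OF that] by simp
      finally show ?thesis using False by (simp add: mult_ac)
    qed
    have "derivation_basis E (log_derivations b \<alpha> \<A> ?m) \<Theta>'"
    proof (rule derivation_basis_pivot[OF finE kE dbasis l(2)])
      show "?l dvd p \<or> ?l dvd p'" if "?l dvd p * p'" for p p'
        using that by (rule form_prime[OF l(1) v])
      show "\<Theta> e ?l = ?l ^ m H0 * g e" if "e \<in> E" for e by (rule g[OF that])
      show "\<not> ?l dvd g k" by (rule k(2))
      show "g e = r e * g k + ?l * s e" if "e \<in> E" for e by (rule rs[OF that])
      show "log_derivations b \<alpha> \<A> ?m \<subseteq> log_derivations b \<alpha> \<A> m"
        by (rule subsetI) (simp only: log_derivations_Suc[OF H0])
      show "?l ^ Suc (m H0) dvd \<theta> ?l" if "\<theta> \<in> log_derivations b \<alpha> \<A> ?m" for \<theta>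
        using that by (simp only: log_derivations_Suc[OF H0])
      show "\<Theta>' e \<in> log_derivations b \<alpha> \<A> ?m" if "e \<in> E" for e
        unfolding log_derivations_Suc[OF H0] \<Theta>'_l[OF that]
        using derivation_basisD(1)[OF dbasis] that kE log_derivations_subspace
        by (auto simp: \<Theta>'_def intro!: der.subspace_diff der.subspace_scale)
      show "\<Theta>' k h = ?l * \<Theta> k h" for h by (rule \<Theta>'_k)
      show "\<Theta>' e h = \<Theta> e h - r e * \<Theta> k h" if "e \<noteq> k" for e h by (rule \<Theta>'_e[OF that])
    qed
    moreover have "\<Theta>' e (form_poly b (\<alpha> H)) = 0"
      if B': "B' \<in> P" "H \<in> \<A>" "\<forall>e\<in>E - B'. \<alpha> H e = 0" and e: "e \<in> E - B'" for B' H e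
    proof (cases "B' = B")
      case True
      then have "e \<noteq> k" "r e = 0" using e k(1) r_out by auto
      then show ?thesis using adapted_basisD(2)[OF basis B' e] by (simp add: \<Theta>'_e)
    next
      case False
      then have "k \<in> E - B'" using pairwiseD[OF P(2) B'(1) B False] k(1) kE by (auto simp: disjnt_def)
      then have "\<Theta> k (form_poly b (\<alpha> H)) = 0" by (rule adapted_basisD(2)[OF basis B'])
      then show ?thesis
        using adapted_basisD(2)[OF basis B' e] by (cases "e = k") (simp_all add: \<Theta>'_e \<Theta>'_k)
    qed
    moreover have "\<exists>g. \<Theta>' e (form_poly b (\<alpha> H)) = form_poly b (\<alpha> H) ^ ?m H * g \<and>
           homogeneous_in (coordinate E ` B') (d' e - int (?m H)) g"
      if B': "B' \<in> P" "H \<in> \<A>" "\<forall>e\<in>E - B'. \<alpha> H e = 0" and e: "e \<in> B'" for B' H e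
    proof (cases "B' = B")
      case False
      then have "e \<notin> B" using pairwiseD[OF P(2) B'(1) B False] e by (auto simp: disjnt_def)
      then have "e \<noteq> k" "r e = 0" using k(1) r_out by auto
      moreover have "H \<noteq> H0" using only_B[OF B'(1)] B'(3) False by blast
      ultimately show ?thesis
        using adapted_basisD(3)[OF basis B' e] by (simp add: \<Theta>'_e d'_def)
    next
      case [simp]: True
      have eB: "e \<in> B" "e \<in> E" using e BE by auto
      show ?thesis
      proof (cases "H = H0")
        case [simp]: True
        show ?thesis
        proof (cases "e = k")
          case [simp]: True
          have "homogeneous_in ?G (d' k - int (Suc (m H0))) (g k)"
            using g_hom[OF k(1)] by (simp add: d'_def)
          then show ?thesis using \<Theta>'_l[OF kE] by (intro exI[of _ "g k"]) simp
        next
          case False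
          have "homogeneous_in ?G (d' e - int (Suc (m H0))) (s e)"
            using s_hom[OF eB(1)] False by (simp add: d'_def algebra_simps)
          then show ?thesis using \<Theta>'_l[OF eB(2)] False by (intro exI[of _ "s e"]) simp
        qed
      next
        case False
        have B'2: "B \<in> P" "H \<in> \<A>" "\<forall>e\<in>E - B. \<alpha> H e = 0" using B' by simp_all
        obtain ge where ge: "\<Theta> e (form_poly b (\<alpha> H)) = form_poly b (\<alpha> H) ^ m H * ge"
          "homogeneous_in ?G (d e - int (m H)) ge"
          using adapted_basisD(3)[OF basis B'2 eB(1)] by (elim exE conjE)
        obtain gk where gk: "\<Theta> k (form_poly b (\<alpha> H)) = form_poly b (\<alpha> H) ^ m H * gk"
          "homogeneous_in ?G (d k - int (m H)) gk"
          using adapted_basisD(3)[OF basis B'2 k(1)] by (elim exE conjE)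
        show ?thesis
        proof (cases "e = k")
          case [simp]: True
          have "homogeneous_in ?G 1 ?l"
            using supp by (intro form_homogeneous_in_block[OF E BE _ l(1)]) blast
          from homogeneous_in_mult[OF this gk(2)]
          have "homogeneous_in ?G (d' k - int (m H)) (?l * gk)" by (simp add: d'_def algebra_simps)
          moreover have "\<Theta>' k (form_poly b (\<alpha> H)) = form_poly b (\<alpha> H) ^ m H * (?l * gk)"
            by (simp add: \<Theta>'_k gk(1) mult_ac)
          ultimately show ?thesis using False by (intro exI[of _ "?l * gk"]) simp
        next
          case e_k: False
          have "homogeneous_in ?G ((d e - d k) + (d k - int (m H))) (r e * gk)"
            by (rule homogeneous_in_mult[OF r_hom gk(2)])
          then have "homogeneous_in ?G (d e - int (m H)) (r e * gk)" by (simp add: algebra_simps)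
          from homogeneous_in_diff[OF ge(2) this]
          have "homogeneous_in ?G (d' e - int (m H)) (ge - r e * gk)" using e_k by (simp add: d'_def)
          moreover have "\<Theta>' e (form_poly b (\<alpha> H)) = form_poly b (\<alpha> H) ^ m H * (ge - r e * gk)"
            by (simp add: \<Theta>'_e[OF e_k] ge(1) gk(1) algebra_simps)
          ultimately show ?thesis using False by (intro exI[of _ "ge - r e * gk"]) simp
        qed
      qed
    qed
    ultimately have "adapted_basis \<alpha> \<A> E P ?m \<Theta>' d'"
      unfolding adapted_basis_def by (intro conjI ballI impI)
    then show ?thesis by blast
  qed
qed

theorem block_basis_imp_free:
  assumes block: "block_basis \<alpha> \<A> E P" and fin: "finite \<A>"
    and lin: "\<And>H. H \<in> \<A> \<Longrightarrow> linear_form (\<alpha> H)"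
    and nz: "\<And>H. H \<in> \<A> \<Longrightarrow> \<exists>v. \<alpha> H v \<noteq> 0"
  shows "free_multiarrangement b \<alpha> \<A> m"
proof -
  have E: "independent E" "span E = UNIV" "\<Union>P = E"
    using block by (simp_all add: block_basis_def)
  have "\<exists>\<Theta> d. adapted_basis \<alpha> \<A> E P m \<Theta> d"
  proof (induction "\<Sum>H\<in>\<A>. m H" arbitrary: m)
    case 0
    then have "m H = 0" if "H \<in> \<A>" for H using that fin by simp
    then have "adapted_basis \<alpha> \<A> E P m directional (\<lambda>_. 0)"
      by (intro adapted_basis_directional E lin)
    then show ?case by blast
  next
    case (Suc n)
    then have "(\<Sum>H\<in>\<A>. m H) \<noteq> 0" by simp
    then obtain H0 where H0: "H0 \<in> \<A>" "m H0 \<noteq> 0" using sum.neutral by metis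
    define m' where "m' = m(H0 := m H0 - 1)"
    have "(\<Sum>H\<in>\<A>. m H) = m H0 + (\<Sum>H\<in>\<A> - {H0}. m H)"
      "(\<Sum>H\<in>\<A>. m' H) = m' H0 + (\<Sum>H\<in>\<A> - {H0}. m' H)"
      using fin H0 by (simp_all add: sum.remove)
    moreover have "(\<Sum>H\<in>\<A> - {H0}. m' H) = (\<Sum>H\<in>\<A> - {H0}. m H)"
      by (rule sum.cong) (simp_all add: m'_def)
    ultimately have "n = (\<Sum>H\<in>\<A>. m' H)" using Suc.hyps(2) H0(2) by (simp add: m'_def)
    from Suc.hyps(1)[OF this] obtain \<Theta> d where "adapted_basis \<alpha> \<A> E P m' \<Theta> d" by blast
    from adapted_basis_Suc[OF block lin nz H0(1) this]
    have "\<exists>\<Theta> d. adapted_basis \<alpha> \<A> E P (m'(H0 := Suc (m' H0))) \<Theta> d" by blast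
    moreover have "m'(H0 := Suc (m' H0)) = m" using H0(2) by (auto simp: m'_def)
    ultimately show ?case by simp
  qed
  then obtain \<Theta> d where "adapted_basis \<alpha> \<A> E P m \<Theta> d" by blast
  then have "free_submodule (log_derivations b \<alpha> \<A> m)"
    using derivation_basis_imp_free[OF finiteI_independent[OF E(1)] adapted_basisD(1) log_derivations_subspace] by blast
  then show ?thesis by (simp add: free_multiarrangement_def)
qed

end

section \<open>Block bases and products\<close>

lemma sum_set_iff: "v \<in> sum_set X Y \<longleftrightarrow> (\<exists>x\<in>X. \<exists>y\<in>Y. v = x + y)"
  by (auto simp: sum_set_def)

lemma sum_list_index: "sum_list xs = (\<Sum>i<length xs. xs ! i)"
  by (simp add: sum_list_sum_nth atLeast0LessThan)

lemma foldr_sum_set: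
  "v \<in> foldr sum_set Ws {0} \<longleftrightarrow>
     (\<exists>x. (\<forall>i<length Ws. x i \<in> Ws ! i) \<and> v = (\<Sum>i<length Ws. x i))"
proof (induction Ws arbitrary: v)
  case Nil
  show ?case by simp
next
  case (Cons W Ws)
  have "v \<in> foldr sum_set (W # Ws) {0} \<longleftrightarrow>
      (\<exists>w\<in>W. \<exists>x. (\<forall>i<length Ws. x i \<in> Ws ! i) \<and> v = w + (\<Sum>i<length Ws. x i))"
  proof -
    have "v \<in> foldr sum_set (W # Ws) {0} \<longleftrightarrow> (\<exists>w\<in>W. \<exists>y. y \<in> foldr sum_set Ws {0} \<and> v = w + y)"
      by (auto simp: sum_set_iff)
    then show ?thesis unfolding Cons.IH by blast
  qed
  also have "\<dots> \<longleftrightarrow> (\<exists>x. (\<forall>i<length (W # Ws). x i \<in> (W # Ws) ! i) \<and> v = (\<Sum>i<length (W # Ws). x i))"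
  proof
    assume "\<exists>w\<in>W. \<exists>x. (\<forall>i<length Ws. x i \<in> Ws ! i) \<and> v = w + (\<Sum>i<length Ws. x i)"
    then obtain w x where wx: "w \<in> W" "\<forall>i<length Ws. x i \<in> Ws ! i" "v = w + (\<Sum>i<length Ws. x i)" by blast
    have "v = (\<Sum>i<length (W # Ws). case_nat w x i)"
      by (simp add: wx(3) sum.lessThan_Suc_shift del: sum.lessThan_Suc)
    moreover have "case_nat w x i \<in> (W # Ws) ! i" if "i < length (W # Ws)" for i
      using wx that by (cases i) simp_all
    ultimately show "\<exists>x. (\<forall>i<length (W # Ws). x i \<in> (W # Ws) ! i) \<and> v = (\<Sum>i<length (W # Ws). x i)"
      by (intro exI[of _ "case_nat w x"]) simp
  next
    assume "\<exists>x. (\<forall>i<length (W # Ws). x i \<in> (W # Ws) ! i) \<and> v = (\<Sum>i<length (W # Ws). x i)"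
    then obtain x where x: "\<forall>i<length (W # Ws). x i \<in> (W # Ws) ! i" "v = (\<Sum>i<length (W # Ws). x i)" by blast
    have "x 0 \<in> W" using x(1) by auto
    moreover have "\<forall>i<length Ws. x (Suc i) \<in> Ws ! i" using x(1) by auto
    moreover have "v = x 0 + (\<Sum>i<length Ws. x (Suc i))" by (simp add: x(2) sum.lessThan_Suc_shift del: sum.lessThan_Suc)
    ultimately show "\<exists>w\<in>W. \<exists>x. (\<forall>i<length Ws. x i \<in> Ws ! i) \<and> v = w + (\<Sum>i<length Ws. x i)"
      by (intro bexI[of _ "x 0"] exI[of _ "\<lambda>i. x (Suc i)"] conjI)
  qed
  finally show ?case .
qed

text \<open>A hyperplane of an iterated product arises by replacing one of the factors of the direct sum by one of its
  hyperplanes.\<close>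

lemma arr_product_list_eq:
  "arr_product_list Fs = (foldr sum_set (map fst Fs) {0},
     {foldr sum_set ((map fst Fs)[i := H]) {0} | i H. i < length Fs \<and> H \<in> snd (Fs ! i)})"
proof (induction Fs)
  case Nil
  show ?case by (simp add: arr_product_list_def)
next
  case (Cons F Fs)
  obtain W \<B> where F: "F = (W, \<B>)" by (cases F)
  let ?S = "\<lambda>Fs. {foldr sum_set ((map fst Fs)[i := H]) {0} | i H. i < length Fs \<and> H \<in> snd (Fs ! i)}"
  have "?S (F # Fs) = {sum_set H (foldr sum_set (map fst Fs) {0}) | H. H \<in> \<B>} \<union> {sum_set W K | K. K \<in> ?S Fs}"
  proof (intro equalityI subsetI)
    fix X assume "X \<in> ?S (F # Fs)"
    then obtain i H where iH: "i < Suc (length Fs)" "H \<in> snd ((F # Fs) ! i)"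
      "X = foldr sum_set ((map fst (F # Fs))[i := H]) {0}" by auto
    show "X \<in> {sum_set H (foldr sum_set (map fst Fs) {0}) | H. H \<in> \<B>} \<union> {sum_set W K | K. K \<in> ?S Fs}"
    proof (cases i)
      case 0
      then show ?thesis using iH by (auto simp: F)
    next
      case (Suc j)
      have "foldr sum_set ((map fst Fs)[j := H]) {0} \<in> ?S Fs" using iH Suc by auto
      moreover have "X = sum_set W (foldr sum_set ((map fst Fs)[j := H]) {0})" using iH Suc by (simp add: F)
      ultimately show ?thesis by blast
    qed
  next
    fix X assume "X \<in> {sum_set H (foldr sum_set (map fst Fs) {0}) | H. H \<in> \<B>} \<union> {sum_set W K | K. K \<in> ?S Fs}"
    then consider H where "H \<in> \<B>" "X = sum_set H (foldr sum_set (map fst Fs) {0})"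
      | j H where "j < length Fs" "H \<in> snd (Fs ! j)" "X = sum_set W (foldr sum_set ((map fst Fs)[j := H]) {0})"
      by blast
    then show "X \<in> ?S (F # Fs)"
    proof cases
      case (1 H)
      then have "0 < length (F # Fs)" "H \<in> snd ((F # Fs) ! 0)" "X = foldr sum_set ((map fst (F # Fs))[0 := H]) {0}"
        by (simp_all add: F)
      then show ?thesis by blast
    next
      case (2 j H)
      then have "Suc j < length (F # Fs)" "H \<in> snd ((F # Fs) ! Suc j)"
        "X = foldr sum_set ((map fst (F # Fs))[Suc j := H]) {0}"
        by (simp_all add: F)
      then show ?thesis by blast
    qed
  qed
  moreover have "arr_product_list (F # Fs) = arr_product F (arr_product_list Fs)"
    by (simp add: arr_product_list_def)
  ultimately show ?case by (simp add: Cons.IH F)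
qed

context coordinatized_space
begin

lemma direct_sum_decomposition_iff:
  "direct_sum_decomposition scale Ws \<longleftrightarrow> (\<forall>W\<in>set Ws. subspace W) \<and>
     foldr sum_set Ws {0} = UNIV \<and>
     (\<forall>x. (\<forall>i<length Ws. x i \<in> Ws ! i) \<longrightarrow> (\<Sum>i<length Ws. x i) = 0 \<longrightarrow> (\<forall>i<length Ws. x i = 0))"
  (is "_ \<longleftrightarrow> ?sub \<and> ?span \<and> ?indep")
proof (cases "\<forall>W\<in>set Ws. subspace W")
  case sub: True
  let ?n = "length Ws"
  let ?L = "\<lambda>v xs. length xs = ?n \<and> (\<forall>i<?n. xs ! i \<in> Ws ! i) \<and> sum_list xs = v"
  have ex: "(\<exists>xs. ?L v xs) \<longleftrightarrow> v \<in> foldr sum_set Ws {0}" for v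
  proof
    assume "\<exists>xs. ?L v xs"
    then obtain xs where "?L v xs" by blast
    then show "v \<in> foldr sum_set Ws {0}"
      unfolding foldr_sum_set by (intro exI[of _ "(!) xs"]) (auto simp: sum_list_index)
  next
    assume "v \<in> foldr sum_set Ws {0}"
    then obtain x where x: "\<forall>i<?n. x i \<in> Ws ! i" "v = (\<Sum>i<?n. x i)" unfolding foldr_sum_set by blast
    then show "\<exists>xs. ?L v xs" by (intro exI[of _ "map x [0..<?n]"]) (simp add: sum_list_index)
  qed
  have core: "(\<forall>v. \<exists>!xs. ?L v xs) \<longleftrightarrow> ?span \<and> ?indep"
  proof (intro iffI conjI)
    assume uniq: "\<forall>v. \<exists>!xs. ?L v xs"
    then have "v \<in> foldr sum_set Ws {0}" for v using ex[of v] by blast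
    then show ?span by blast
    show ?indep
    proof (intro allI impI)
      fix x i assume x: "\<forall>i<?n. x i \<in> Ws ! i" "(\<Sum>i<?n. x i) = 0" and i: "i < ?n"
      have 1: "?L 0 (map x [0..<?n])" using x by (simp add: sum_list_index)
      have 2: "?L 0 (replicate ?n 0)" using sub by (simp add: sum_list_index subspace_0)
      from uniq[THEN spec, of 0] obtain zs where "\<forall>ys. ?L 0 ys \<longrightarrow> ys = zs" by (elim ex1E)
      then have "map x [0..<?n] = replicate ?n 0" using 1 2 by metis
      then have "map x [0..<?n] ! i = replicate ?n 0 ! i" by (rule arg_cong)
      then show "x i = 0" using i by simp
    qed
  next
    assume *: "?span \<and> ?indep"
    show "\<forall>v. \<exists>!xs. ?L v xs"
    proof (intro allI ex_ex1I)
      fix v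
      show "\<exists>xs. ?L v xs" using ex[of v] * by blast
      fix xs ys assume xy: "?L v xs" "?L v ys"
      have len: "length xs = ?n" "length ys = ?n" and total: "sum_list xs = v" "sum_list ys = v"
        using xy by simp_all
      have mem: "\<forall>i<?n. xs ! i - ys ! i \<in> Ws ! i" using xy sub by (simp add: subspace_diff)
      have "(\<Sum>i<?n. xs ! i) = (\<Sum>i<?n. ys ! i)"
        using total unfolding sum_list_index len by (rule trans[OF _ sym])
      then have diff: "(\<Sum>i<?n. xs ! i - ys ! i) = 0" unfolding sum_subtractf by simp
      have eq: "\<forall>i<?n. xs ! i - ys ! i = 0"
        using *[THEN conjunct2, THEN spec, THEN mp, THEN mp, OF mem diff] .
      show "xs = ys"
      proof (rule nth_equalityI)
        show "length xs = length ys" by (simp only: len)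
        show "xs ! i = ys ! i" if "i < length xs" for i using eq that len by simp
      qed
    qed
  qed
  show ?thesis
    unfolding direct_sum_decomposition_def by (rule conj_cong[OF refl core])
next
  case False
  show ?thesis
    unfolding direct_sum_decomposition_def by (simp only: False simp_thms)
qed

lemma sum_single_component:
  fixes i n :: nat
  assumes "i < n" shows "(\<Sum>j<n. if j = i then y else 0) = (y :: 'v)"
  using assms by simp

text \<open>Bases of the factors are the blocks. A hyperplane coming from the \<open>i\<close>-th factor contains all other factors, so its
  form vanishes on the basis vectors outside the \<open>i\<close>-th block.\<close>

lemma block_basis_of_product:
  assumes prod: "is_product_decomposition scale \<A> Fs"
    and dims: "\<forall>(W, \<B>)\<in>set Fs. dim W \<in> {1, 2}"
    and forms: "defining_forms scale \<A> \<alpha>"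
  shows "\<exists>E P. block_basis \<alpha> \<A> E P"
proof -
  let ?n = "length Fs" and ?W = "\<lambda>i. fst (Fs ! i)"
  have sub: "subspace (?W i)" if "i < ?n" for i
    using prod that unfolding is_product_decomposition_def direct_sum_decomposition_iff by (simp add: nth_mem)
  have span: "\<exists>x. (\<forall>i<?n. x i \<in> ?W i) \<and> v = (\<Sum>i<?n. x i)" for v
  proof -
    have "v \<in> foldr sum_set (map fst Fs) {0}"
      using prod unfolding is_product_decomposition_def direct_sum_decomposition_iff by simp
    then show ?thesis unfolding foldr_sum_set by simp
  qed
  have indep: "x i = 0" if "\<And>i. i < ?n \<Longrightarrow> x i \<in> ?W i" "(\<Sum>i<?n. x i) = 0" "i < ?n" for x i
    using prod that unfolding is_product_decomposition_def direct_sum_decomposition_iff by simp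
  have dim: "dim (?W i) \<in> {1, 2}" if "i < ?n" for i
    using dims nth_mem[OF that] by (cases "Fs ! i") auto
  have "\<forall>i. \<exists>B. B \<subseteq> ?W i \<and> independent B \<and> ?W i \<subseteq> local.span B \<and> card B = dim (?W i)"
    using basis_exists by metis
  then obtain f where f: "\<And>i. f i \<subseteq> ?W i" "\<And>i. independent (f i)" "\<And>i. ?W i \<subseteq> local.span (f i)"
    "\<And>i. card (f i) = dim (?W i)" by metis
  have fin: "finite (f i)" for i using finiteI_independent f(2) by blast
  have disj: "f i \<inter> f j = {}" if ij: "i < ?n" "j < ?n" "i \<noteq> j" for i j
  proof (rule ccontr)
    assume "f i \<inter> f j \<noteq> {}"
    then obtain y where y: "y \<in> f i" "y \<in> f j" by blast
    \<comment> \<open>A common element of two bases would decompose zero as \<open>y + (- y)\<close>.\<close>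
    let ?x = "\<lambda>k. (if k = i then y else 0) - (if k = j then y else 0)"
    have mem: "?x k \<in> ?W k" if "k < ?n" for k
      using y f(1)[of i] f(1)[of j] sub[OF that] by (auto simp: subspace_0 subspace_neg)
    have "(\<Sum>k<?n. ?x k) = y - y"
      unfolding sum_subtractf sum_single_component[OF ij(1)] sum_single_component[OF ij(2)] ..
    then have "?x i = 0" by (intro indep[OF mem _ ij(1)]) simp_all
    then have "y = 0" using ij(3) by simp
    then show False using y(1) f(2)[of i] dependent_zero by blast
  qed
  define E where "E = (\<Union>i<?n. f i)"
  define P where "P = f ` {..<?n}"
  have sum_E: "(\<Sum>y\<in>E. g y) = (\<Sum>i<?n. \<Sum>y\<in>f i. g y)" for g :: "'v \<Rightarrow> 'v"
    unfolding E_def using fin disj by (intro sum.UNION_disjoint) auto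
  have "independent E"
  proof (rule independent_if_scalars_zero)
    show "finite E" using fin by (simp add: E_def)
    fix u y assume zero: "(\<Sum>y\<in>E. u y *s y) = 0" and y: "y \<in> E"
    obtain i where i: "i < ?n" "y \<in> f i" using y by (auto simp: E_def)
    have "(\<Sum>y\<in>f i. u y *s y) = 0"
    proof (rule indep[of "\<lambda>i. \<Sum>y\<in>f i. u y *s y", OF _ _ i(1)])
      show "(\<Sum>y\<in>f i. u y *s y) \<in> ?W i" if "i < ?n" for i
        using f(1) by (intro subspace_sum subspace_scale sub[OF that]) blast
      show "(\<Sum>i<?n. \<Sum>y\<in>f i. u y *s y) = 0" using zero unfolding sum_E .
    qed
    then show "u y = 0" by (rule independentD[OF f(2) fin order.refl _ i(2)])
  qed
  moreover have "local.span E = UNIV"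
  proof (intro equalityI subsetI UNIV_I)
    fix v
    obtain x where x: "\<forall>i<?n. x i \<in> ?W i" "v = (\<Sum>i<?n. x i)" using span[of v] by blast
    have "x i \<in> local.span E" if "i < ?n" for i
    proof -
      have "f i \<subseteq> E" using that by (auto simp: E_def)
      then show ?thesis using x(1) that f(3)[of i] span_mono by blast
    qed
    then show "v \<in> local.span E" unfolding x(2) by (intro span_sum) simp
  qed
  moreover have "\<Union>P = E" by (auto simp: P_def E_def)
  moreover have "pairwise disjnt P"
  proof (rule pairwiseI)
    fix X Y assume "X \<in> P" "Y \<in> P" "X \<noteq> Y"
    then obtain i j where "i < ?n" "j < ?n" "X = f i" "Y = f j" "i \<noteq> j" by (auto simp: P_def)
    then show "disjnt X Y" using disj by (simp add: disjnt_def)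
  qed
  moreover have "\<forall>B\<in>P. card B \<in> {1, 2}"
  proof
    fix B assume "B \<in> P"
    then obtain i where "i < ?n" "B = f i" by (auto simp: P_def)
    then show "card B \<in> {1, 2}" using dim[of i] f(4)[of i] by simp
  qed
  moreover have "\<forall>H\<in>\<A>. \<exists>B\<in>P. \<forall>e\<in>E - B. \<alpha> H e = 0"
  proof
    fix H assume H: "H \<in> \<A>"
    have "\<A> = snd (arr_product_list Fs)" using prod by (simp add: is_product_decomposition_def)
    then have "H \<in> {foldr sum_set ((map fst Fs)[i := H]) {0} | i H. i < ?n \<and> H \<in> snd (Fs ! i)}"
      using H unfolding arr_product_list_eq by simp
    then obtain i H' where iH: "i < ?n" "H' \<in> snd (Fs ! i)" "H = foldr sum_set ((map fst Fs)[i := H']) {0}"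
      by blast
    have "central_arrangement scale (fst (Fs ! i)) (snd (Fs ! i))"
      using prod nth_mem[OF iH(1)] unfolding is_product_decomposition_def by (cases "Fs ! i") auto
    then have "subspace H'" using iH(2) by (simp add: central_arrangement_def hyperplane_in_def)
    have "\<alpha> H e = 0" if e: "e \<in> E - f i" for e
    proof -
      obtain j where j: "j < ?n" "e \<in> f j" "j \<noteq> i" using e by (auto simp: E_def)
      have "e \<in> H"
        unfolding iH(3) foldr_sum_set
      proof (intro exI[of _ "\<lambda>k. if k = j then e else 0"] conjI allI impI)
        fix k assume "k < length ((map fst Fs)[i := H'])"
        then show "(if k = j then e else 0) \<in> (map fst Fs)[i := H'] ! k"
          using j iH(1) f(1)[of j] sub[of k] subspace_0[OF \<open>subspace H'\<close>]
          by (auto simp: nth_list_update subspace_0)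
      next
        show "e = (\<Sum>k<length ((map fst Fs)[i := H']). if k = j then e else 0)"
          using j(1) by simp
      qed
      then show ?thesis using forms H by (auto simp: defining_forms_def)
    qed
    then show "\<exists>B\<in>P. \<forall>e\<in>E - B. \<alpha> H e = 0" using iH(1) by (auto simp: P_def)
  qed
  ultimately have "block_basis \<alpha> \<A> E P" unfolding block_basis_def by (intro conjI)
  then show ?thesis by blast
qed


lemma dim_hyperplane:
  assumes W: "subspace W" and a: "linear_form a" and w: "w \<in> W" "a w \<noteq> 0"
  shows "dim W = dim (W \<inter> {v. a v = 0}) + 1"
proof -
  let ?K = "W \<inter> {v. a v = 0}"
  have K: "subspace ?K"
    using W by (auto simp: subspace_def linear_formD[OF a])
  obtain B where B: "B \<subseteq> ?K" "independent B" "?K \<subseteq> span B" "card B = dim ?K"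
    by (rule basis_exists[of ?K])
  have "span B \<subseteq> ?K" using B(1) K by (rule span_minimal)
  then have "w \<notin> span B" using w by blast
  then have indep: "independent (insert w B)" and "w \<notin> B"
    using B(2) independent_insertI span_base by auto
  have "W \<subseteq> span (insert w B)"
  proof
    fix v assume v: "v \<in> W"
    have "v - (a v / a w) *s w \<in> ?K"
      using v w W by (simp add: linear_formD[OF a] subspace_diff subspace_scale)
    then have "v - (a v / a w) *s w \<in> span B" using B(3) by blast
    then show "v \<in> span (insert w B)" unfolding span_breakdown_eq by blast
  qed
  moreover have "insert w B \<subseteq> W" using B(1) w(1) by blast
  ultimately have "card (insert w B) = dim W" using basis_card_eq_dim indep by blast
  then show ?thesis using B(4) \<open>w \<notin> B\<close> finiteI_independent[OF B(2)] by simp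
qed

lemma linear_form_zero_on_span:
  assumes "linear_form a" "\<And>e. e \<in> B \<Longrightarrow> a e = 0" "v \<in> span B" shows "a v = 0"
proof -
  have "span B \<subseteq> {v. a v = 0}"
    using assms(2) by (intro span_minimal) (auto simp: subspace_def linear_formD[OF assms(1)])
  then show ?thesis using assms(3) by blast
qed

text \<open>The spans of the blocks are the factors, each carrying the traces of the hyperplanes that belong to its block. Such a
  hyperplane is recovered from its trace because its form vanishes on all other factors.\<close>

lemma product_of_block_basis:
  assumes block: "block_basis \<alpha> \<A> E P" and fin: "finite \<A>"
    and forms: "defining_forms scale \<A> \<alpha>"
    and lin: "\<And>H. H \<in> \<A> \<Longrightarrow> linear_form (\<alpha> H)"
    and nz: "\<And>H. H \<in> \<A> \<Longrightarrow> \<exists>v. \<alpha> H v \<noteq> 0"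
  shows "\<exists>Fs. is_product_decomposition scale \<A> Fs \<and> (\<forall>(W, \<B>)\<in>set Fs. dim W \<in> {1, 2})"
proof -
  have E: "independent E" "span E = UNIV" and P: "\<Union>P = E" "pairwise disjnt P" "\<And>B. B \<in> P \<Longrightarrow> card B \<in> {1, 2}"
    using block by (simp_all add: block_basis_def)
  have finE: "finite E" using finiteI_independent E(1) by blast
  have "P \<subseteq> Pow E" using P(1) by blast
  then have "finite P" by (rule finite_subset) (simp add: finE)
  then obtain Bs where Bs: "set Bs = P" "distinct Bs" using finite_distinct_list by blast
  let ?n = "length Bs"
  define ar where "ar B = {H \<inter> span B | H. H \<in> \<A> \<and> (\<forall>e\<in>E - B. \<alpha> H e = 0)}" for B
  define Fs where "Fs = map (\<lambda>B. (span B, ar B)) Bs"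
  have Ws: "map fst Fs = map span Bs" by (simp add: Fs_def)
  have kernel: "H = {v. \<alpha> H v = 0}" if "H \<in> \<A>" for H
    using forms that by (simp add: defining_forms_def)
  have mem_kernel: "v \<in> H \<longleftrightarrow> \<alpha> H v = 0" if "H \<in> \<A>" for H v
    using kernel[OF that] by blast
  have B_P: "Bs ! i \<in> P" "Bs ! i \<subseteq> E" if "i < ?n" for i
    using that Bs(1) P(1) by auto
  have disj: "Bs ! j \<subseteq> E - Bs ! i" if "i < ?n" "j < ?n" "i \<noteq> j" for i j
  proof -
    have "Bs ! i \<noteq> Bs ! j" using that Bs(2) by (simp add: nth_eq_iff_index_eq)
    then show ?thesis
      using pairwiseD[OF P(2) B_P(1)[OF that(1)] B_P(1)[OF that(2)]] B_P(2)[OF that(2)]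
      by (auto simp: disjnt_def)
  qed
  \<comment> \<open>A form in the coordinates of one block only sees the component of a vector in that block.\<close>
  have local_form: "a (\<Sum>j<?n. x j) = a (x i)"
    if a: "linear_form a" "\<forall>e\<in>E - Bs ! i. a e = 0" and x: "\<forall>j<?n. x j \<in> span (Bs ! j)" and i: "i < ?n"
    for a x i
  proof -
    have "a (x j) = 0" if "j < ?n" "j \<noteq> i" for j
    proof (rule linear_form_zero_on_span[OF a(1)])
      show "x j \<in> span (Bs ! j)" using x that(1) by blast
      show "a e = 0" if "e \<in> Bs ! j" for e
        using that a(2) disj[OF i \<open>j < ?n\<close>] \<open>j \<noteq> i\<close> by blast
    qed
    then have "(\<Sum>j<?n. a (x j)) = (\<Sum>j<?n. if j = i then a (x i) else 0)"
      by (intro sum.cong) auto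
    also have "\<dots> = a (x i)" using i by simp
    finally show ?thesis by (simp only: linear_formD(5)[OF a(1)])
  qed
  have span: "\<exists>x. (\<forall>i<?n. x i \<in> span (Bs ! i)) \<and> v = (\<Sum>i<?n. x i)" for v
  proof (intro exI conjI allI impI)
    let ?x = "\<lambda>i. \<Sum>e\<in>Bs ! i. representation E v e *s e"
    show "?x i \<in> span (Bs ! i)" if "i < ?n" for i
      by (intro span_sum span_scale span_base)
    have "v = (\<Sum>e\<in>E. representation E v e *s e)"
      using E finE by (intro sum_representation_eq[symmetric]) auto
    also have "\<dots> = (\<Sum>B\<in>P. \<Sum>e\<in>B. representation E v e *s e)"
    proof -
      have "\<forall>B\<in>P. finite B" using finite_subset[OF _ finE] P(1) by blast
      moreover have "\<forall>B\<in>P. \<forall>C\<in>P. B \<noteq> C \<longrightarrow> B \<inter> C = {}"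
        using P(2) unfolding pairwise_def disjnt_def by blast
      ultimately show ?thesis
        using sum.Union_disjoint[of P "\<lambda>e. representation E v e *s e"] unfolding P(1) by simp
    qed
    also have "\<dots> = (\<Sum>i<?n. ?x i)"
    proof -
      have "bij_betw ((!) Bs) {..<?n} P" using bij_betw_nth[OF Bs(2) refl] Bs(1) by simp
      from sum.reindex_bij_betw[OF this, of "\<lambda>B. \<Sum>e\<in>B. representation E v e *s e"] show ?thesis by simp
    qed
    finally show "v = (\<Sum>i<?n. ?x i)" .
  qed
  have indep: "x i = 0" if x: "\<forall>i<?n. x i \<in> span (Bs ! i)" "(\<Sum>i<?n. x i) = 0" and i: "i < ?n" for x i
  proof -
    have "coordinate_form E e (x i) = 0" if e: "e \<in> E" for e
    proof (cases "e \<in> Bs ! i")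
      case True
      have "\<forall>e'\<in>E - Bs ! i. coordinate_form E e e' = 0"
        using coordinate_form(2)[OF E e] True by auto
      from local_form[OF coordinate_form(1)[OF E] this x(1) i]
      show ?thesis by (simp add: x(2) linear_formD[OF coordinate_form(1)[OF E]])
    next
      case False
      show ?thesis
      proof (rule linear_form_zero_on_span[OF coordinate_form(1)[OF E]])
        show "x i \<in> span (Bs ! i)" using x(1) i by blast
        show "coordinate_form E e e' = 0" if "e' \<in> Bs ! i" for e'
          using coordinate_form(2)[OF E e, of e'] that B_P(2)[OF i] False by auto
      qed
    qed
    moreover have "x i = (\<Sum>e\<in>E. coordinate_form E e (x i) *s e)"
      unfolding coordinate_form_def using E finE by (intro sum_representation_eq[symmetric]) auto
    ultimately show ?thesis by simp
  qed
  have UNIV: "foldr sum_set (map span Bs) {0} = UNIV"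
  proof (intro equalityI subsetI UNIV_I)
    fix v show "v \<in> foldr sum_set (map span Bs) {0}" using span[of v] unfolding foldr_sum_set by simp
  qed
  have "direct_sum_decomposition scale (map fst Fs)"
    unfolding direct_sum_decomposition_iff Ws
    using UNIV indep by (simp add: subspace_span)
  moreover have "central_arrangement scale W \<B>" if WB: "(W, \<B>) \<in> set Fs" for W \<B>
  proof -
    obtain B where B: "B \<in> P" "W = span B" "\<B> = ar B" using WB Bs(1) by (auto simp: Fs_def)
    have "hyperplane_in scale (span B) (H \<inter> span B)" if H: "H \<in> \<A>" "\<forall>e\<in>E - B. \<alpha> H e = 0" for H
    proof -
      have "\<exists>e\<in>B. \<alpha> H e \<noteq> 0"
      proof (rule ccontr)
        assume "\<not> (\<exists>e\<in>B. \<alpha> H e \<noteq> 0)"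
        then have "\<alpha> H e = 0" if "e \<in> E" for e using H(2) that by blast
        then have "\<alpha> H v = 0" for v
          using linear_form_zero_on_span[OF lin[OF H(1)], of E v] E(2) by simp
        then show False using nz[OF H(1)] by blast
      qed
      then obtain e where e: "e \<in> span B" "\<alpha> H e \<noteq> 0" using span_base by blast
      have eq: "H \<inter> span B = span B \<inter> {v. \<alpha> H v = 0}" using kernel[OF H(1)] by blast
      have "subspace (span B \<inter> {v. \<alpha> H v = 0})"
        using subspace_span[of B] by (auto simp: subspace_def linear_formD[OF lin[OF H(1)]])
      then show ?thesis
        unfolding hyperplane_in_def eq using dim_hyperplane[OF subspace_span lin[OF H(1)] e] by blast
    qed
    moreover have "finite (ar B)" using fin by (simp add: ar_def)
    ultimately show ?thesis unfolding central_arrangement_def B(2,3) by (auto simp: ar_def)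
  qed
  moreover have "arr_product_list Fs = (UNIV, \<A>)"
  proof -
    have replace: "foldr sum_set ((map span Bs)[i := H \<inter> span (Bs ! i)]) {0} = H"
      if i: "i < ?n" and H: "H \<in> \<A>" "\<forall>e\<in>E - Bs ! i. \<alpha> H e = 0" for i H
    proof (intro equalityI subsetI)
      fix v assume "v \<in> foldr sum_set ((map span Bs)[i := H \<inter> span (Bs ! i)]) {0}"
      then obtain x where x: "\<forall>j<?n. x j \<in> (map span Bs)[i := H \<inter> span (Bs ! i)] ! j" "v = (\<Sum>j<?n. x j)"
        unfolding foldr_sum_set by auto
      have "\<forall>j<?n. x j \<in> span (Bs ! j)"
      proof (intro allI impI)
        fix j assume "j < ?n"
        then show "x j \<in> span (Bs ! j)" using x(1)[THEN spec, of j] i by (cases "j = i") simp_all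
      qed
      then have "\<alpha> H v = \<alpha> H (x i)" unfolding x(2) by (rule local_form[OF lin[OF H(1)] H(2) _ i])
      moreover have "x i \<in> H" using x(1)[THEN spec, of i] i by simp
      ultimately show "v \<in> H" by (simp add: mem_kernel[OF H(1)])
    next
      fix v assume v: "v \<in> H"
      obtain x where x: "\<forall>j<?n. x j \<in> span (Bs ! j)" "v = (\<Sum>j<?n. x j)" using span[of v] by blast
      have "\<alpha> H v = \<alpha> H (x i)" unfolding x(2) by (rule local_form[OF lin[OF H(1)] H(2) x(1) i])
      then have "x i \<in> H" using v by (simp add: mem_kernel[OF H(1)])
      then have "\<forall>j<?n. x j \<in> (map span Bs)[i := H \<inter> span (Bs ! i)] ! j"
        using x(1) i by (auto simp: nth_list_update)
      then show "v \<in> foldr sum_set ((map span Bs)[i := H \<inter> span (Bs ! i)]) {0}"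
        unfolding foldr_sum_set using x(2) by (intro exI[of _ x]) simp
    qed
    have "{foldr sum_set ((map span Bs)[i := K]) {0} | i K. i < length Fs \<and> K \<in> snd (Fs ! i)} = \<A>"
    proof (intro equalityI subsetI)
      fix X assume "X \<in> {foldr sum_set ((map span Bs)[i := K]) {0} | i K. i < length Fs \<and> K \<in> snd (Fs ! i)}"
      then obtain i K where iK: "i < ?n" "K \<in> ar (Bs ! i)" "X = foldr sum_set ((map span Bs)[i := K]) {0}"
        by (auto simp: Fs_def)
      then obtain H where H: "K = H \<inter> span (Bs ! i)" "H \<in> \<A>" "\<forall>e\<in>E - Bs ! i. \<alpha> H e = 0"
        by (auto simp: ar_def)
      then show "X \<in> \<A>" using replace[OF iK(1) H(2,3)] iK(3) by simp
    next
      fix H assume H: "H \<in> \<A>"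
      then obtain B where B: "B \<in> P" "\<forall>e\<in>E - B. \<alpha> H e = 0" using block unfolding block_basis_def by blast
      then obtain i where i: "i < ?n" "B = Bs ! i" using Bs(1) by (metis in_set_conv_nth)
      have "H = foldr sum_set ((map span Bs)[i := H \<inter> span (Bs ! i)]) {0}"
        using replace[OF i(1) H] B(2) i(2) by simp
      moreover have "i < length Fs" "H \<inter> span (Bs ! i) \<in> snd (Fs ! i)"
        using i B(2) H by (auto simp: Fs_def ar_def)
      ultimately show "H \<in> {foldr sum_set ((map span Bs)[i := K]) {0} | i K. i < length Fs \<and> K \<in> snd (Fs ! i)}"
        by blast
    qed
    then show ?thesis unfolding arr_product_list_eq Ws UNIV by simp
  qed
  ultimately have "is_product_decomposition scale \<A> Fs"
    unfolding is_product_decomposition_def by blast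
  moreover have "\<forall>(W, \<B>)\<in>set Fs. dim W \<in> {1, 2}"
  proof -
    have "dim (span B) \<in> {1, 2}" if "B \<in> P" for B
    proof -
      have "independent B" using E(1) that P(1) by (intro independent_mono[OF E(1)]) blast
      then show ?thesis using P(3)[OF that] by (simp add: dim_eq_card_independent)
    qed
    then show ?thesis using Bs(1) by (auto simp: Fs_def)
  qed
  ultimately show ?thesis by blast
qed

end

section \<open>The four conditions\<close>

context coordinatized_space
begin

lemma long_dependency_not_free:
  fixes \<alpha> :: "'v set \<Rightarrow> 'v \<Rightarrow> 'k"
  assumes fin: "finite \<A>" and lin: "\<And>H. H \<in> \<A> \<Longrightarrow> linear_form (\<alpha> H)"
    and nz: "\<And>H. H \<in> \<A> \<Longrightarrow> \<exists>v. \<alpha> H v \<noteq> 0"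
    and dep: "long_dependency \<alpha> \<A> T H0"
    and \<mu>: "\<mu> \<in> Poly_Mapping.keys (\<Prod>H\<in>\<A> - insert H0 T. form_poly b (\<alpha> H) ^ m H)"
    and large: "\<And>H. H \<in> insert H0 T \<Longrightarrow> monomial_degree \<mu> < m H"
  shows "\<not> free_multiarrangement b \<alpha> \<A> m"
proof -
  obtain c h e where T: "T \<subseteq> \<A>" "H0 \<in> \<A>" "H0 \<notin> T"
    and relation: "\<forall>v. \<alpha> H0 v = (\<Sum>H\<in>T. c H * \<alpha> H v)" and inj: "inj_on h {..<3::nat}"
    and h: "\<forall>i<3. h i \<in> T \<and> c (h i) \<noteq> 0 \<and> (\<forall>H\<in>T. \<alpha> H (e i) = (if H = h i then 1 else 0))"
    using dep unfolding long_dependency_def by (elim conjE exE)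
  have distinct: "h 0 \<noteq> h 1" "h 0 \<noteq> h 2" "h 1 \<noteq> h 2"
    using inj_on_contraD[OF inj, of 0 1] inj_on_contraD[OF inj, of 0 2] inj_on_contraD[OF inj, of 1 2] by simp_all
  note h0 = h[THEN spec, of 0, simplified] and h1 = h[THEN spec, of 1, simplified] and h2 = h[THEN spec, of 2, simplified]
  show ?thesis
  proof (rule not_free_of_dual_vectors[OF fin lin nz T _ _ _ distinct _ _ _ _ _ _ _ \<mu> large])
    show "\<alpha> H0 v = (\<Sum>H\<in>T. c H * \<alpha> H v)" for v using relation ..
    show "\<alpha> H (e 0) = (if H = h 0 then 1 else 0)" if "H \<in> T" for H using h0 that by simp
    show "\<alpha> H (e 1) = (if H = h 1 then 1 else 0)" if "H \<in> T" for H using h1 that by simp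
    show "\<alpha> H (e 2) = (if H = h 2 then 1 else 0)" if "H \<in> T" for H using h2 that by simp
  qed (use h0 h1 h2 in simp_all)
qed

text \<open>On the hyperplanes of the dependency alone, with multiplicity one, the product of the remaining forms is \<open>1\<close>, with
  the monomial of degree zero.\<close>

lemma long_dependency_not_free_subarrangement:
  assumes fin: "finite \<A>" and lin: "\<And>H. H \<in> \<A> \<Longrightarrow> linear_form (\<alpha> H)"
    and nz: "\<And>H. H \<in> \<A> \<Longrightarrow> \<exists>v. \<alpha> H v \<noteq> 0"
    and dep: "long_dependency \<alpha> \<A> T H0"
  shows "insert H0 T \<subseteq> \<A>" "\<not> free_arrangement b \<alpha> (insert H0 T)"
proof -
  show sub: "insert H0 T \<subseteq> \<A>" using dep by (simp add: long_dependency_def)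
  have dep': "long_dependency \<alpha> (insert H0 T) T H0"
    using dep unfolding long_dependency_def by (elim conjE) (intro conjI; (assumption | blast))
  show "\<not> free_arrangement b \<alpha> (insert H0 T)"
    unfolding free_arrangement_def
    by (rule long_dependency_not_free[OF finite_subset[OF sub fin] _ _ dep', where \<mu> = 0])
       (use sub lin nz in \<open>auto simp: monomial_degree_def\<close>)
qed

text \<open>Multiplicity one outside the dependency fixes the product of the remaining forms, and then every
  sufficiently large multiplicity on the dependency is not free.\<close>

lemma long_dependency_infinite_NFM:
  assumes fin: "finite \<A>" and lin: "\<And>H. H \<in> \<A> \<Longrightarrow> linear_form (\<alpha> H)"
    and nz: "\<And>H. H \<in> \<A> \<Longrightarrow> \<exists>v. \<alpha> H v \<noteq> 0"
    and dep: "long_dependency \<alpha> \<A> T H0"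
  shows "infinite (NFM b \<alpha> \<A>)"
proof -
  let ?C = "insert H0 T"
  have sub: "?C \<subseteq> \<A>" using dep by (simp add: long_dependency_def)
  have "(\<Prod>H\<in>\<A> - ?C. form_poly b (\<alpha> H)) \<noteq> 0"
  proof (rule polys_prod_nonzero)
    fix H assume "H \<in> \<A> - ?C"
    then show "form_poly b (\<alpha> H) \<noteq> 0" using nz[of H] form_poly_eq_0[OF lin[of H]] by blast
  qed
  then obtain \<mu> where \<mu>: "\<mu> \<in> Poly_Mapping.keys (\<Prod>H\<in>\<A> - ?C. form_poly b (\<alpha> H))"
    using keys_eq_empty by blast
  define mult where "mult N = (\<lambda>H\<in>\<A>. if H \<in> ?C then Suc (monomial_degree \<mu>) + N else 1)" for N
  have "mult N \<in> NFM b \<alpha> \<A>" for N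
  proof -
    have "mult N \<in> multiplicities \<A>" by (auto simp: mult_def multiplicities_def)
    moreover have "\<not> free_multiarrangement b \<alpha> \<A> (mult N)"
    proof (rule long_dependency_not_free[OF fin lin nz dep, where \<mu> = \<mu>])
      have "(\<Prod>H\<in>\<A> - ?C. form_poly b (\<alpha> H) ^ mult N H) = (\<Prod>H\<in>\<A> - ?C. form_poly b (\<alpha> H))"
        by (rule prod.cong) (auto simp: mult_def)
      then show "\<mu> \<in> Poly_Mapping.keys (\<Prod>H\<in>\<A> - ?C. form_poly b (\<alpha> H) ^ mult N H)" using \<mu> by simp
      show "monomial_degree \<mu> < mult N H" if "H \<in> ?C" for H
        using that sub by (auto simp: mult_def)
    qed
    ultimately show ?thesis by (simp add: NFM_def)
  qed
  then have "range mult \<subseteq> NFM b \<alpha> \<A>" by blast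
  moreover have "inj mult"
  proof (rule injI)
    fix N N' assume "mult N = mult N'"
    then have "mult N H0 = mult N' H0" by simp
    then show "N = N'" using sub by (simp add: mult_def)
  qed
  then have "infinite (range mult)" using finite_imageD infinite_UNIV_nat by blast
  ultimately show ?thesis using finite_subset by blast
qed

lemma block_basis_subset: "block_basis \<alpha> \<A> E P \<Longrightarrow> \<B> \<subseteq> \<A> \<Longrightarrow> block_basis \<alpha> \<B> E P"
  unfolding block_basis_def by blast

end

theorem theorem2p4:
  fixes scale :: "'k::field \<Rightarrow> 'v::ab_group_add \<Rightarrow> 'v"
    and b :: "'n::finite \<Rightarrow> 'v"
    and \<A> :: "'v set set"
    and \<alpha> :: "'v set \<Rightarrow> 'v \<Rightarrow> 'k"
  assumes "finite_dimensional_vector_space scale (range b)" and "inj b"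
    and "central_arrangement scale UNIV \<A>"
    and "defining_forms scale \<A> \<alpha>"
  shows "(totally_free b \<alpha> \<A> \<longleftrightarrow> finite (NFM b \<alpha> \<A>)) \<and>
         (finite (NFM b \<alpha> \<A>) \<longleftrightarrow>
            (\<exists>Fs. is_product_decomposition scale \<A> Fs \<and>
                  (\<forall>(W, \<B>)\<in>set Fs. vector_space.dim scale W \<in> {1, 2}))) \<and>
         ((\<exists>Fs. is_product_decomposition scale \<A> Fs \<and>
                (\<forall>(W, \<B>)\<in>set Fs. vector_space.dim scale W \<in> {1, 2})) \<longleftrightarrow>
            (\<forall>\<B>. \<B> \<subseteq> \<A> \<longrightarrow> free_arrangement b \<alpha> \<B>))"
proof -
  interpret coordinatized_space scale b
    by (intro coordinatized_space.intro coordinatized_space_axioms.intro assms)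
  have fin: "finite \<A>" using assms(3) by (simp add: central_arrangement_def)
  have lin: "linear_form (\<alpha> H)" if "H \<in> \<A>" for H
    using assms(4) that by (simp add: defining_forms_def)
  have nz: "\<exists>v. \<alpha> H v \<noteq> 0" if "H \<in> \<A>" for H
  proof (rule ccontr)
    assume "\<not> (\<exists>v. \<alpha> H v \<noteq> 0)"
    moreover have "{v. \<alpha> H v = 0} = H" using assms(4) that by (simp add: defining_forms_def)
    ultimately have "H = UNIV" by auto
    moreover have "vector_space.dim scale UNIV = vector_space.dim scale H + 1"
      using assms(3) that by (simp add: central_arrangement_def hyperplane_in_def)
    ultimately show False by simp
  qed
  let ?dec = "\<exists>Fs. is_product_decomposition scale \<A> Fs \<and>
                  (\<forall>(W, \<B>)\<in>set Fs. vector_space.dim scale W \<in> {1, 2})"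
  have dec: "?dec" if no_dep: "\<And>T H0. \<not> long_dependency \<alpha> \<A> T H0"
  proof -
    have "\<exists>E P. block_basis \<alpha> \<A> E P"
      by (rule block_basis_or_long_dependency[OF fin _ _ no_dep]) (erule lin, erule nz)
    then obtain E P where block: "block_basis \<alpha> \<A> E P" by (elim exE)
    show ?dec
      by (rule product_of_block_basis[OF block fin assms(4)]) (erule lin, erule nz)
  qed
  have free: "free_multiarrangement b \<alpha> \<B> m" if decomp: "?dec" and sub: "\<B> \<subseteq> \<A>" for \<B> m
  proof -
    from decomp obtain Fs where Fs: "is_product_decomposition scale \<A> Fs"
      "\<forall>(W, \<B>)\<in>set Fs. vector_space.dim scale W \<in> {1, 2}" by (elim exE conjE)
    from block_basis_of_product[OF Fs assms(4)] obtain E P where "block_basis \<alpha> \<A> E P" by (elim exE)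
    then have block: "block_basis \<alpha> \<B> E P" using sub by (rule block_basis_subset)
    show ?thesis
    proof (rule block_basis_imp_free[OF block finite_subset[OF sub fin]])
      fix H assume "H \<in> \<B>"
      then have H: "H \<in> \<A>" using sub by blast
      show "linear_form (\<alpha> H)" by (rule lin[OF H])
      show "\<exists>v. \<alpha> H v \<noteq> 0" by (rule nz[OF H])
    qed
  qed
  have 12: "finite (NFM b \<alpha> \<A>)" if "totally_free b \<alpha> \<A>"
    using that by (simp add: totally_free_iff_NFM_empty)
  have 23: "?dec" if "finite (NFM b \<alpha> \<A>)"
  proof (rule dec, rule notI)
    fix T H0 assume dep: "long_dependency \<alpha> \<A> T H0"
    have "infinite (NFM b \<alpha> \<A>)"
      by (rule long_dependency_infinite_NFM[OF fin _ _ dep]) (erule lin, erule nz)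
    then show False using that by (rule notE)
  qed
  have 31: "totally_free b \<alpha> \<A>" if "?dec"
    unfolding totally_free_def using free[OF that order.refl] by (rule ballI)
  have 34: "\<forall>\<B>. \<B> \<subseteq> \<A> \<longrightarrow> free_arrangement b \<alpha> \<B>" if "?dec"
    unfolding free_arrangement_def by (intro allI impI free[OF that])
  have 43: "?dec" if "\<forall>\<B>. \<B> \<subseteq> \<A> \<longrightarrow> free_arrangement b \<alpha> \<B>"
  proof (rule dec, rule notI)
    fix T H0 assume dep: "long_dependency \<alpha> \<A> T H0"
    have "insert H0 T \<subseteq> \<A>"
      by (rule long_dependency_not_free_subarrangement(1)[OF fin _ _ dep]) (erule lin, erule nz)
    then have "free_arrangement b \<alpha> (insert H0 T)" using that by blast
    moreover have "\<not> free_arrangement b \<alpha> (insert H0 T)"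
      by (rule long_dependency_not_free_subarrangement(2)[OF fin _ _ dep]) (erule lin, erule nz)
    ultimately show False by (rule notE[rotated])
  qed
  show ?thesis using 12 23 31 34 43 by argo
qed

end
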